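(* For any positive real $\epsilon>0$ there exists a polynomial-time algorithm which, when $f_1,\dots,f_n$ are monotone submodular and $\mathcal{I}$ is defined by a knapsack constraint or is the family of independent sets of a matroid, outputs $p\in\Delta(\mathcal{I})$ with $\min_{k\in[n]}\sum_{X\in\mathcal{I}}p_Xf_k(X)\ge(1-1/e-\epsilon)\nu^*$.
   Context: $E$ finite, $f_1,\dots,f_n\colon2^E\to\mathbb{R}_{\ge0}$ with $f_k(\emptyset)=0$ given by value oracles, submodular ($f(X)+f(Y)\ge f(X\cup Y)+f(X\cap Y)$) and monotone. A knapsack constraint: $\mathcal{I}=\{X:\sum_{e\in X}s(e)\le C\}$ for sizes $s$ and capacity $C$. $\Delta(\mathcal{I})$ is the set of probability distributions over $\mathcal{I}$ and $\nu^*=\max_{p\in\Delta(\mathcal{I})}\min_{k}\sum_Xp_Xf_k(X)$. *)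

theory Defs
  imports "HOL-Probability.Probability" "HOL-Computational_Algebra.Polynomial"
begin

section \<open>Robust submodular maximization\<close>

definition submodular_on :: "'a set \<Rightarrow> ('a set \<Rightarrow> real) \<Rightarrow> bool" where
  "submodular_on E f \<longleftrightarrow>
     (\<forall>X\<subseteq>E. \<forall>Y\<subseteq>E. f X + f Y \<ge> f (X \<union> Y) + f (X \<inter> Y))"

definition objective :: "'a set \<Rightarrow> ('a set \<Rightarrow> real) \<Rightarrow> bool" where
  "objective E f \<longleftrightarrow>
     (\<forall>X\<subseteq>E. f X \<ge> 0) \<and> f {} = 0 \<and> submodular_on E f \<and> mono_on (Pow E) f"

definition matroid :: "'a set \<Rightarrow> 'a set set \<Rightarrow> bool" where
  "matroid E \<I> \<longleftrightarrow>
     finite E \<and> \<I> \<subseteq> Pow E \<and> {} \<in> \<I> \<and>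
     (\<forall>X\<in>\<I>. \<forall>Y\<subseteq>X. Y \<in> \<I>) \<and>
     (\<forall>X\<in>\<I>. \<forall>Y\<in>\<I>. card X < card Y \<longrightarrow> (\<exists>y\<in>Y - X. insert y X \<in> \<I>))"

definition distributions :: "'a set set \<Rightarrow> 'a set pmf set" where
  "distributions \<I> = {p. set_pmf p \<subseteq> \<I>}"

definition robust_value ::
  "nat \<Rightarrow> (nat \<Rightarrow> 'a set \<Rightarrow> real) \<Rightarrow> 'a set set \<Rightarrow> 'a set pmf \<Rightarrow> real" where
  "robust_value n f \<I> p = (MIN k\<in>{..<n}. \<Sum>X\<in>\<I>. pmf p X * f k X)"

text \<open>The supremum below is a maximum; see \<open>nu_star_max\<close>.\<close>

definition nu_star :: "nat \<Rightarrow> (nat \<Rightarrow> 'a set \<Rightarrow> real) \<Rightarrow> 'a set set \<Rightarrow> real" where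
  "nu_star n f \<I> = (SUP p\<in>distributions \<I>. robust_value n f \<I> p)"

text \<open>The ground set of an input is \<open>{..<m}\<close> and the objectives are indexed by \<open>{..<n}\<close>.\<close>

datatype constraint =
    Knapsack "nat \<Rightarrow> real" real
  | Matroid "nat set set"

fun feasible :: "nat \<Rightarrow> constraint \<Rightarrow> nat set set" where
  "feasible m (Knapsack s C) = {X. X \<subseteq> {..<m} \<and> (\<Sum>e\<in>X. s e) \<le> C}"
| "feasible m (Matroid \<I>) = \<I>"

fun valid_constraint :: "nat \<Rightarrow> constraint \<Rightarrow> bool" where
  "valid_constraint m (Knapsack s C) \<longleftrightarrow> (\<forall>e<m. s e \<ge> 0) \<and> C \<ge> 0"
| "valid_constraint m (Matroid \<I>) \<longleftrightarrow> matroid {..<m} \<I>"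


section \<open>Algorithms with oracles\<close>

text \<open>
  Algorithms are programs of a real RAM, presented as a structured language. The memory
  consists of named unbounded arrays of natural numbers and of real numbers; a scalar is cell
  \<open>0\<close> of an array. Every executed assignment, oracle call and test costs one unit.
  Natural numbers have only addition and truncated subtraction (with multiplication, unit cost
  would be unreasonable), and there is no rounding from reals to natural numbers. Real division
  by zero returns zero. No real constants occur in programs other than those computed from
  natural numbers.
\<close>

datatype nexp =
    NConst nat
  | NGet string nexp
  | NAdd nexp nexp
  | NSub nexp nexp

datatype rexp =
    RNat nexp
  | RGet string nexp
  | RAdd rexp rexp
  | RSub rexp rexp
  | RMul rexp rexp
  | RDiv rexp rexp

datatype bexp =
    NLess nexp nexp
  | RLess rexp rexp
  | BNot bexp
  | BAnd bexp bexp

text \<open>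
  \<open>Value x i k S\<close> stores in \<open>x[i]\<close> the value of the \<open>k\<close>-th objective at the set whose
  indicator vector is the array \<open>S\<close>; \<open>Indep x i S\<close> stores \<open>1\<close> or \<open>0\<close>
  according to the independence of that set.
\<close>

datatype com =
    Skip
  | NAssign string nexp nexp
  | RAssign string nexp rexp
  | Value string nexp nexp string
  | Indep string nexp string
  | Seq com com
  | Cond bexp com com
  | While bexp com

record state =
  nmem :: "string \<Rightarrow> nat \<Rightarrow> nat"
  rmem :: "string \<Rightarrow> nat \<Rightarrow> real"

fun nval :: "nexp \<Rightarrow> state \<Rightarrow> nat" where
  "nval (NConst c) \<sigma> = c"
| "nval (NGet x a) \<sigma> = nmem \<sigma> x (nval a \<sigma>)"
| "nval (NAdd a b) \<sigma> = nval a \<sigma> + nval b \<sigma>"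
| "nval (NSub a b) \<sigma> = nval a \<sigma> - nval b \<sigma>"

fun rval :: "rexp \<Rightarrow> state \<Rightarrow> real" where
  "rval (RNat a) \<sigma> = real (nval a \<sigma>)"
| "rval (RGet x a) \<sigma> = rmem \<sigma> x (nval a \<sigma>)"
| "rval (RAdd a b) \<sigma> = rval a \<sigma> + rval b \<sigma>"
| "rval (RSub a b) \<sigma> = rval a \<sigma> - rval b \<sigma>"
| "rval (RMul a b) \<sigma> = rval a \<sigma> * rval b \<sigma>"
| "rval (RDiv a b) \<sigma> = rval a \<sigma> / rval b \<sigma>"

fun bval :: "bexp \<Rightarrow> state \<Rightarrow> bool" where
  "bval (NLess a b) \<sigma> \<longleftrightarrow> nval a \<sigma> < nval b \<sigma>"
| "bval (RLess a b) \<sigma> \<longleftrightarrow> rval a \<sigma> < rval b \<sigma>"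
| "bval (BNot b) \<sigma> \<longleftrightarrow> \<not> bval b \<sigma>"
| "bval (BAnd b c) \<sigma> \<longleftrightarrow> bval b \<sigma> \<and> bval c \<sigma>"

definition nstore :: "string \<Rightarrow> nat \<Rightarrow> nat \<Rightarrow> state \<Rightarrow> state" where
  "nstore x i v \<sigma> = \<sigma>\<lparr>nmem := (nmem \<sigma>)(x := (nmem \<sigma> x)(i := v))\<rparr>"

definition rstore :: "string \<Rightarrow> nat \<Rightarrow> real \<Rightarrow> state \<Rightarrow> state" where
  "rstore x i v \<sigma> = \<sigma>\<lparr>rmem := (rmem \<sigma>)(x := (rmem \<sigma> x)(i := v))\<rparr>"

text \<open>The subset of \<open>{..<m}\<close> with indicator vector \<open>x[i], \<dots>, x[i + m - 1]\<close>.\<close>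

definition stored_set :: "nat \<Rightarrow> string \<Rightarrow> nat \<Rightarrow> state \<Rightarrow> nat set" where
  "stored_set m x i \<sigma> = {e. e < m \<and> nmem \<sigma> x (i + e) \<noteq> 0}"

text \<open>
  \<open>exec m f J c \<sigma> t \<tau>\<close>: started in \<open>\<sigma>\<close>, program \<open>c\<close> halts after \<open>t\<close> steps in \<open>\<tau>\<close>, where
  \<open>f\<close> answers value queries and \<open>J\<close> answers independence queries.
\<close>

inductive exec ::
  "nat \<Rightarrow> (nat \<Rightarrow> nat set \<Rightarrow> real) \<Rightarrow> nat set set \<Rightarrow> com \<Rightarrow> state \<Rightarrow> nat \<Rightarrow> state \<Rightarrow> bool"
  for m f J where
  exec_Skip: "exec m f J Skip \<sigma> 1 \<sigma>"
| exec_NAssign: "exec m f J (NAssign x i a) \<sigma> 1 (nstore x (nval i \<sigma>) (nval a \<sigma>) \<sigma>)"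
| exec_RAssign: "exec m f J (RAssign x i a) \<sigma> 1 (rstore x (nval i \<sigma>) (rval a \<sigma>) \<sigma>)"
| exec_Value:
    "exec m f J (Value x i k S) \<sigma> 1
       (rstore x (nval i \<sigma>) (f (nval k \<sigma>) (stored_set m S 0 \<sigma>)) \<sigma>)"
| exec_Indep:
    "exec m f J (Indep x i S) \<sigma> 1
       (nstore x (nval i \<sigma>) (if stored_set m S 0 \<sigma> \<in> J then 1 else 0) \<sigma>)"
| exec_Seq:
    "exec m f J c \<sigma> t \<rho> \<Longrightarrow> exec m f J d \<rho> u \<tau> \<Longrightarrow> exec m f J (Seq c d) \<sigma> (t + u) \<tau>"
| exec_CondTrue: "bval b \<sigma> \<Longrightarrow> exec m f J c \<sigma> t \<tau> \<Longrightarrow> exec m f J (Cond b c d) \<sigma> (t + 1) \<tau>"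
| exec_CondFalse: "\<not> bval b \<sigma> \<Longrightarrow> exec m f J d \<sigma> t \<tau> \<Longrightarrow> exec m f J (Cond b c d) \<sigma> (t + 1) \<tau>"
| exec_WhileFalse: "\<not> bval b \<sigma> \<Longrightarrow> exec m f J (While b c) \<sigma> 1 \<sigma>"
| exec_WhileTrue:
    "bval b \<sigma> \<Longrightarrow> exec m f J c \<sigma> t \<rho> \<Longrightarrow> exec m f J (While b c) \<rho> u \<tau> \<Longrightarrow>
       exec m f J (While b c) \<sigma> (t + u + 1) \<tau>"

inductive_cases exec_SeqE: "exec m f J (Seq c d) \<sigma> t \<tau>"

lemma exec_deterministic:
  "exec m f J c \<sigma> t \<tau> \<Longrightarrow> exec m f J c \<sigma> t' \<tau>' \<Longrightarrow> t' = t \<and> \<tau>' = \<tau>"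
proof (induction arbitrary: t' \<tau>' rule: exec.induct)
  case (exec_Seq c \<sigma> t \<rho> d u \<tau>)
  from exec_Seq.prems obtain t1 \<rho>1 u1
    where *: "t' = t1 + u1" "exec m f J c \<sigma> t1 \<rho>1" "exec m f J d \<rho>1 u1 \<tau>'"
    by (rule exec_SeqE)
  from exec_Seq.IH(1)[OF *(2)] exec_Seq.IH(2)[of u1 \<tau>'] * show ?case by simp
next
  case (exec_CondTrue b \<sigma> c t \<tau> d)
  from exec_CondTrue.prems exec_CondTrue.hyps(1) obtain t1
    where *: "t' = t1 + 1" "exec m f J c \<sigma> t1 \<tau>'"
    by (cases rule: exec.cases) auto
  from exec_CondTrue.IH[OF *(2)] * show ?case by simp
next
  case (exec_CondFalse b \<sigma> d t \<tau> c)
  from exec_CondFalse.prems exec_CondFalse.hyps(1) obtain t1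
    where *: "t' = t1 + 1" "exec m f J d \<sigma> t1 \<tau>'"
    by (cases rule: exec.cases) auto
  from exec_CondFalse.IH[OF *(2)] * show ?case by simp
next
  case (exec_WhileFalse b \<sigma> c)
  from exec_WhileFalse.prems exec_WhileFalse.hyps show ?case
    by (cases rule: exec.cases) auto
next
  case (exec_WhileTrue b \<sigma> c t \<rho> u \<tau>)
  from exec_WhileTrue.prems exec_WhileTrue.hyps(1) obtain t1 \<rho>1 u1
    where *: "t' = t1 + u1 + 1" "exec m f J c \<sigma> t1 \<rho>1" "exec m f J (While b c) \<rho>1 u1 \<tau>'"
    by (cases rule: exec.cases) auto
  from exec_WhileTrue.IH(1)[OF *(2)] exec_WhileTrue.IH(2)[of u1 \<tau>'] * show ?case by simp
qed (erule exec.cases; simp)+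

text \<open>
  A knapsack constraint is given explicitly by its sizes and capacity (and independence queries
  carry no information); a matroid is given by its independence oracle only. All other memory
  cells are initially zero.
\<close>

fun independence_oracle :: "constraint \<Rightarrow> nat set set" where
  "independence_oracle (Knapsack s C) = {}"
| "independence_oracle (Matroid \<I>) = \<I>"

definition blank :: "nat \<Rightarrow> nat \<Rightarrow> state" where
  "blank m n = nstore ''m'' 0 m (nstore ''n'' 0 n \<lparr>nmem = \<lambda>_ _. 0, rmem = \<lambda>_ _. 0\<rparr>)"

fun input :: "nat \<Rightarrow> nat \<Rightarrow> constraint \<Rightarrow> state" where
  "input m n (Knapsack s C) =
     (blank m n)\<lparr>rmem := (\<lambda>_ _. 0)
        (''s'' := (\<lambda>e. if e < m then s e else 0), ''C'' := (\<lambda>_. 0)(0 := C))\<rparr>"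
| "input m n (Matroid \<I>) = nstore ''matroid'' 0 1 (blank m n)"

definition runs_to ::
  "com \<Rightarrow> nat \<Rightarrow> nat \<Rightarrow> (nat \<Rightarrow> nat set \<Rightarrow> real) \<Rightarrow> constraint \<Rightarrow> nat \<Rightarrow> state \<Rightarrow> bool" where
  "runs_to A m n f c t \<tau> \<longleftrightarrow> exec m f (independence_oracle c) A (input m n c) t \<tau>"

text \<open>
  A distribution is output as a list of \<open>len[0]\<close> sets with weights: the \<open>j\<close>-th set has its
  indicator vector in \<open>S[j * m], \<dots>, S[j * m + m - 1]\<close> and weight \<open>p[j]\<close>. A set may be listed
  repeatedly. As weights are positive, the list cannot be longer than the running time.
\<close>

definition outputs :: "nat \<Rightarrow> state \<Rightarrow> nat set pmf \<Rightarrow> bool" where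
  "outputs m \<tau> p \<longleftrightarrow>
     (\<forall>j < nmem \<tau> ''len'' 0. rmem \<tau> ''p'' j > 0) \<and>
     (\<forall>X. pmf p X =
        (\<Sum>j < nmem \<tau> ''len'' 0. if stored_set m ''S'' (j * m) \<tau> = X then rmem \<tau> ''p'' j else 0))"


section \<open>Attainment of the optimum\<close>

lemma finite_feasible:
  assumes "valid_constraint m c"
  shows "finite (feasible m c)"
proof (cases c)
  case (Knapsack s C)
  then show ?thesis by (auto intro: finite_subset[of _ "Pow {..<m}"])
next
  case (Matroid \<I>)
  with assms have "\<I> \<subseteq> Pow {..<m}" by (simp add: matroid_def)
  then show ?thesis using Matroid by (auto intro: finite_subset)
qed

lemma empty_feasible: "valid_constraint m c \<Longrightarrow> {} \<in> feasible m c"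
  by (cases c) (auto simp: matroid_def)

lemma continuous_on_MIN:
  fixes g :: "'i \<Rightarrow> 'b::topological_space \<Rightarrow> real"
  assumes "finite K" "K \<noteq> {}" "\<And>k. k \<in> K \<Longrightarrow> continuous_on S (g k)"
  shows "continuous_on S (\<lambda>x. MIN k\<in>K. g k x)"
  using assms
proof (induction K rule: finite_ne_induct)
  case (insert k K)
  have "(\<lambda>x. MIN j\<in>insert k K. g j x) = (\<lambda>x. min (g k x) (MIN j\<in>K. g j x))"
    using insert.hyps by (intro ext) simp
  with insert show ?case by (auto intro!: continuous_on_min)
qed simp

theorem nu_star_max:
  fixes \<I> :: "'a set set"
  assumes fin: "finite \<I>" and ne: "\<I> \<noteq> {}" and n: "n \<ge> 1"
  shows "\<exists>p\<in>distributions \<I>. robust_value n f \<I> p = nu_star n f \<I> \<and>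
           (\<forall>q\<in>distributions \<I>. robust_value n f \<I> q \<le> nu_star n f \<I>)"
proof -
  let ?g = "\<lambda>w::'a set \<Rightarrow> real. MIN k\<in>{..<n}. \<Sum>X\<in>\<I>. w X * f k X"
  let ?B = "PiE UNIV (\<lambda>X. if X \<in> \<I> then {0..1::real} else {0})"
  let ?K = "?B \<inter> {w. (\<Sum>X\<in>\<I>. w X) = 1}"
  have coord: "continuous_on S (\<lambda>w::'a set \<Rightarrow> real. w X)" for S X
    by (rule continuous_on_subset[OF continuous_on_product_coordinates]) simp
  have "compactin (product_topology (\<lambda>_. euclidean) UNIV) ?B"
    by (subst compactin_PiE) auto
  then have "compact ?B"
    by (simp add: euclidean_product_topology)
  moreover have "closed {w::'a set \<Rightarrow> real. (\<Sum>X\<in>\<I>. w X) = 1}"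
    by (intro closed_Collect_eq continuous_intros coord)
  ultimately have K: "compact ?K" by (rule compact_Int_closed)
  have in_K: "pmf q \<in> ?K" if "q \<in> distributions \<I>" for q
    using that fin
    by (auto simp: distributions_def pmf_le_1 sum_pmf_eq_1 set_pmf_iff subset_iff)
  obtain X0 where X0: "X0 \<in> \<I>" using ne by blast
  then have "return_pmf X0 \<in> distributions \<I>" by (simp add: distributions_def)
  then have K_ne: "?K \<noteq> {}" using in_K by blast
  have "continuous_on ?K ?g"
    using n by (intro continuous_on_MIN continuous_intros coord) (auto simp: lessThan_empty_iff)
  from continuous_attains_sup[OF K K_ne this] obtain w
    where w: "w \<in> ?K" and w_max: "\<And>v. v \<in> ?K \<Longrightarrow> ?g v \<le> ?g w" by blast
  have w0: "w X = 0" if "X \<notin> \<I>" for X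
    using w that by (auto simp: PiE_iff dest!: spec[of _ X])
  have w_pos: "0 \<le> w X" for X
    using w by (cases "X \<in> \<I>") (auto simp: PiE_iff w0 dest!: spec[of _ X])
  have "(\<integral>\<^sup>+X. ennreal (w X) \<partial>count_space UNIV) = (\<Sum>X\<in>\<I>. ennreal (w X))"
    using fin w0 w_pos
    by (intro nn_integral_count_space') auto
  also have "\<dots> = 1" using w w_pos by simp
  finally have pmf_w: "pmf (embed_pmf w) X = w X" for X
    using w_pos by (intro pmf_embed_pmf) auto
  let ?p = "embed_pmf w"
  have p: "?p \<in> distributions \<I>"
  proof -
    have "X \<in> \<I>" if "X \<in> set_pmf ?p" for X
      using that w0[of X] pmf_w[of X] by (auto simp: set_pmf_iff)
    then show ?thesis by (auto simp: distributions_def)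
  qed
  have val: "robust_value n f \<I> ?p = ?g w" by (simp add: robust_value_def pmf_w)
  have le: "robust_value n f \<I> q \<le> robust_value n f \<I> ?p" if "q \<in> distributions \<I>" for q
    using w_max[OF in_K[OF that]] unfolding val by (simp add: robust_value_def)
  have "nu_star n f \<I> = robust_value n f \<I> ?p"
    unfolding nu_star_def using p le by (intro cSup_eq_maximum) auto
  with p le show ?thesis by metis
qed

end

(*
  Multiplicative weights reduce the problem to maximizing one function F = sum_k w_k min(f_k, B) up to
  a factor 1 - 1/e - delta; the output is uniform over the sets found in all rounds. The truncation
  level B is a polynomial multiple of a = min_k max_e f_k({e}), which is within a polynomial factor of
  nu*; hence polynomially many rounds suffice, and truncation costs only a factor 1 - delta.

  Knapsack (Sviridenko): try every start of at most three elements, together with all elements of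
  size zero, and extend it greedily by density.

  Matroid (Buchbinder and Feldman): local search over bases partitioned into l classes, with potential
  sum_J alpha_|J| F(union of the classes in J). The coefficients make an exchange argument along
  Brualdi's bijection telescope to F(S) >= (1 - (1 + 1/l)^(-l)) F(Opt). As l is constant, the potential
  needs constantly many value queries; linearly many best-improvement steps suffice.
*)

theory Submission
  imports Defs
begin

section \<open>Monotone submodular functions\<close>

text \<open>Truncation is forced by the width of the weights method: its number of rounds grows with
  the ratio of the largest objective value to the optimum \<nu> = \<open>nu_star\<close>, and no
  polynomial in m and n bounds this ratio. The scale \<open>a\<close> replaces a guess of \<nu>,
  because a / n \<le> \<nu> \<le> m a: subadditivity bounds one objective by its singletons, and a
  uniform mixture of n sets, one good for each objective, is worth a / n to all of them. The cap B =
  \<kappa> (m + 1) n a then makes truncation cost a factor 1 - 1/\<kappa>, and the regret n \<kappa>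
  B dictates the number of rounds. If a = 0, then \<nu> = 0 and every distribution will do.

  The constants l, K and \<kappa> depend on \<epsilon> alone and are compiled into the program text.
  Loop bounds that are products are formed as reals, since naturals cannot be multiplied and reals
  cannot be rounded. Time and correctness are proved apart: time from the program text, for every
  content of the memory; correctness by invariants of halting runs.\<close>

lemma objectiveD:
  assumes "objective E f"
  shows objective_nonneg: "X \<subseteq> E \<Longrightarrow> 0 \<le> f X"
    and objective_empty: "f {} = 0"
    and objective_mono: "X \<subseteq> Y \<Longrightarrow> Y \<subseteq> E \<Longrightarrow> f X \<le> f Y"
    and objective_submodular: "X \<subseteq> E \<Longrightarrow> Y \<subseteq> E \<Longrightarrow> f (X \<union> Y) + f (X \<inter> Y) \<le> f X + f Y"
  using assms unfolding objective_def submodular_on_def mono_on_def by auto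

text \<open>Submodularity is applied to \<open>A \<union> D\<close> and \<open>B\<close>: their
  union is \<open>B \<union> D\<close>, and their intersection contains \<open>A\<close>, so
  monotonicity allows it to be replaced by \<open>A\<close>.\<close>

lemma objective_diminishing:
  assumes f: "objective E f" and "A \<subseteq> B" "B \<subseteq> E" "D \<subseteq> E"
  shows "f (B \<union> D) - f B \<le> f (A \<union> D) - f A"
proof -
  have "f ((A \<union> D) \<union> B) + f ((A \<union> D) \<inter> B) \<le> f (A \<union> D) + f B"
    using assms by (intro objective_submodular[OF f]) auto
  moreover have "(A \<union> D) \<union> B = B \<union> D" using assms by auto
  moreover have "f A \<le> f ((A \<union> D) \<inter> B)"
    using assms by (intro objective_mono[OF f]) auto
  ultimately show ?thesis by simp
qed

lemma objective_diminishing_insert: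
  assumes "objective E f" "A \<subseteq> B" "B \<subseteq> E" "e \<in> E"
  shows "f (insert e B) - f B \<le> f (insert e A) - f A"
  using objective_diminishing[OF assms(1-3), of "{e}"] assms(4) by simp

text \<open>The elements of \<open>D\<close> are added one at a time; diminishing returns bound each
  gain by the gain over \<open>A\<close> alone. An optimum is thus compared with \<open>A\<close>
  through single elements.\<close>

lemma objective_union_le_sum:
  assumes f: "objective E f" and "finite D" "D \<subseteq> E" "A \<subseteq> E"
  shows "f (A \<union> D) - f A \<le> (\<Sum>e\<in>D. f (insert e A) - f A)"
  using assms(2,3)
proof (induction D)
  case (insert e D)
  have "f (insert e (A \<union> D)) - f (A \<union> D) \<le> f (insert e A) - f A"
    using insert assms by (intro objective_diminishing_insert[OF f]) auto
  with insert show ?case by simp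
qed simp

text \<open>An element is worth least on top of all the rest of \<open>A\<close>; putting
  \<open>D\<close> back one element at a time therefore gains at least these marginals.\<close>

lemma objective_sum_remove_le:
  assumes f: "objective E f" and "finite D" "D \<subseteq> A" "A \<subseteq> E"
  shows "(\<Sum>u\<in>D. f A - f (A - {u})) \<le> f A - f (A - D)"
  using assms(2,3)
proof (induction D)
  case (insert u D)
  have "f (insert u (A - {u})) - f (A - {u}) \<le> f (insert u (A - insert u D)) - f (A - insert u D)"
    using insert assms by (intro objective_diminishing_insert[OF f]) auto
  moreover have "insert u (A - {u}) = A" "insert u (A - insert u D) = A - D"
    using insert by auto
  ultimately show ?case using insert by simp
qed simp

text \<open>Monotonicity orders the four values with the intersection lowest and the union highest;
  for numbers in this order the inequality survives capping at \<open>B\<close>.\<close>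

lemma objective_truncate:
  assumes f: "objective E f" and B: "0 \<le> (B::real)"
  shows "objective E (\<lambda>X. min (f X) B)"
  unfolding objective_def submodular_on_def
proof (intro conjI allI impI)
  fix X Y assume XY: "X \<subseteq> E" "Y \<subseteq> E"
  have "f (X \<inter> Y) \<le> f X" "f (X \<inter> Y) \<le> f Y" "f X \<le> f (X \<union> Y)" "f Y \<le> f (X \<union> Y)"
    using XY by (auto intro!: objective_mono[OF f])
  with objective_submodular[OF f XY]
  show "min (f (X \<union> Y)) B + min (f (X \<inter> Y)) B \<le> min (f X) B + min (f Y) B"
    by (auto simp: min_def)
next
  show "mono_on (Pow E) (\<lambda>X. min (f X) B)"
    by (rule mono_onI) (auto dest: objective_mono[OF f] intro: min.mono)
qed (use B objective_nonneg[OF f] objective_empty[OF f] in auto)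

lemma objective_weighted_sum:
  assumes f: "\<And>k. k \<in> K \<Longrightarrow> objective E (f k)" and w: "\<And>k. k \<in> K \<Longrightarrow> 0 \<le> (w k :: real)"
  shows "objective E (\<lambda>X. \<Sum>k\<in>K. w k * f k X)"
  unfolding objective_def submodular_on_def
proof (intro conjI allI impI)
  fix X Y assume XY: "X \<subseteq> E" "Y \<subseteq> E"
  have "(\<Sum>k\<in>K. w k * (f k (X \<union> Y) + f k (X \<inter> Y))) \<le> (\<Sum>k\<in>K. w k * (f k X + f k Y))"
    using XY by (intro sum_mono mult_left_mono objective_submodular[OF f] w)
  then show "(\<Sum>k\<in>K. w k * f k (X \<union> Y)) + (\<Sum>k\<in>K. w k * f k (X \<inter> Y))
      \<le> (\<Sum>k\<in>K. w k * f k X) + (\<Sum>k\<in>K. w k * f k Y)"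
    by (simp add: distrib_left sum.distrib)
next
  show "mono_on (Pow E) (\<lambda>X. \<Sum>k\<in>K. w k * f k X)"
    by (rule mono_onI) (auto intro!: sum_mono mult_left_mono w objective_mono[OF f])
qed (use w objective_nonneg[OF f] objective_empty[OF f] in \<open>auto intro!: sum_nonneg\<close>)


section \<open>Matroid bases\<close>

definition basis :: "'a set set \<Rightarrow> 'a set \<Rightarrow> bool" where
  "basis \<I> B \<longleftrightarrow> B \<in> \<I> \<and> (\<forall>X\<in>\<I>. card X \<le> card B)"

lemma matroidD:
  assumes "matroid E \<I>"
  shows matroid_finite: "finite E"
    and matroid_subset: "X \<in> \<I> \<Longrightarrow> X \<subseteq> E"
    and matroid_empty: "{} \<in> \<I>"
    and matroid_down: "X \<in> \<I> \<Longrightarrow> Y \<subseteq> X \<Longrightarrow> Y \<in> \<I>"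
    and matroid_exchange: "X \<in> \<I> \<Longrightarrow> Y \<in> \<I> \<Longrightarrow> card X < card Y \<Longrightarrow> \<exists>y\<in>Y - X. insert y X \<in> \<I>"
  using assms unfolding matroid_def by blast+

lemma matroid_finite_indep: "matroid E \<I> \<Longrightarrow> X \<in> \<I> \<Longrightarrow> finite X"
  using matroid_finite matroid_subset finite_subset by metis

lemma matroid_augment:
  assumes M: "matroid E \<I>" and "X \<in> \<I>" "Y \<in> \<I>" "card X \<le> card Y"
  shows "\<exists>Z\<in>\<I>. X \<subseteq> Z \<and> Z \<subseteq> X \<union> Y \<and> card Z = card Y"
  using assms(2,4)
proof (induction "card Y - card X" arbitrary: X)
  case 0
  then show ?case by (intro bexI[of _ X]) auto
next
  case (Suc d)
  then have "card X < card Y" by simp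
  from matroid_exchange[OF M Suc.prems(1) assms(3) this]
  obtain y where y: "y \<in> Y - X" "insert y X \<in> \<I>" by blast
  have "card (insert y X) = Suc (card X)"
    using y matroid_finite_indep[OF M Suc.prems(1)] by simp
  with Suc y have "\<exists>Z\<in>\<I>. insert y X \<subseteq> Z \<and> Z \<subseteq> insert y X \<union> Y \<and> card Z = card Y"
    by (intro Suc.hyps(1)) auto
  with y show ?case by blast
qed

lemma basis_exists:
  assumes M: "matroid E \<I>"
  shows "\<exists>B. basis \<I> B"
proof -
  have "finite \<I>" using M by (auto simp: matroid_def intro: finite_subset[of _ "Pow E"])
  then have "finite (card ` \<I>)" "card ` \<I> \<noteq> {}" using matroid_empty[OF M] by auto
  then have "Max (card ` \<I>) \<in> card ` \<I>" "\<And>X. X \<in> \<I> \<Longrightarrow> card X \<le> Max (card ` \<I>)" by auto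
  then show ?thesis unfolding basis_def by (metis imageE)
qed

lemma basis_superset:
  assumes M: "matroid E \<I>" and X: "X \<in> \<I>"
  shows "\<exists>B. basis \<I> B \<and> X \<subseteq> B"
proof -
  obtain B where B: "basis \<I> B" using basis_exists[OF M] by blast
  then have "card X \<le> card B" "B \<in> \<I>" using X by (auto simp: basis_def)
  from matroid_augment[OF M X this(2,1)] B show ?thesis unfolding basis_def by metis
qed

lemma maximal_independent_basis:
  assumes M: "matroid E \<I>" and X: "X \<in> \<I>" and max: "\<And>e. e \<in> E - X \<Longrightarrow> insert e X \<notin> \<I>"
  shows "basis \<I> X"
proof -
  have "card Y \<le> card X" if "Y \<in> \<I>" for Y
  proof (rule ccontr)
    assume "\<not> ?thesis"
    then have "card X < card Y" by simp
    from matroid_exchange[OF M X that this]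
    obtain y where "y \<in> Y - X" "insert y X \<in> \<I>" by blast
    then show False using max[of y] matroid_subset[OF M that] by blast
  qed
  with X show ?thesis by (simp add: basis_def)
qed

text \<open>In terms of circuits: \<open>insert a B\<close> contains a circuit through
  \<open>a\<close>. Each other element of it may leave \<open>B\<close> in exchange for
  \<open>a\<close>, and these elements are not all spanned by \<open>A - {a}\<close>, since
  otherwise \<open>a\<close> would be too.\<close>

lemma symmetric_exchange:
  assumes M: "matroid E \<I>" and A: "basis \<I> A" and B: "basis \<I> B" and a: "a \<in> A - B"
  shows "\<exists>b\<in>B - A. insert b (A - {a}) \<in> \<I> \<and> insert a (B - {b}) \<in> \<I>"
proof -
  have AI: "A \<in> \<I>" and BI: "B \<in> \<I>" and AB: "card A = card B"
    using A B by (auto simp: basis_def intro: antisym)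
  have fin: "finite A" "finite B" using AI BI matroid_finite_indep[OF M] by auto
  have "insert a B \<notin> \<I>"
  proof
    assume "insert a B \<in> \<I>"
    then have "card (insert a B) \<le> card B" using B by (simp add: basis_def)
    with a fin show False by simp
  qed
  \<comment> \<open>A smallest such \<open>C\<close> is the fundamental circuit of \<open>a\<close>
    with respect to \<open>B\<close>, without \<open>a\<close> itself.\<close>
  then have "\<exists>C. C \<subseteq> B \<and> insert a C \<notin> \<I>" by blast
  then obtain C where C: "C \<subseteq> B" "insert a C \<notin> \<I>"
    and C_min: "\<And>C'. C' \<subseteq> B \<Longrightarrow> insert a C' \<notin> \<I> \<Longrightarrow> card C \<le> card C'"
    using ex_has_least_nat[of "\<lambda>C. C \<subseteq> B \<and> insert a C \<notin> \<I>" _ card] by metis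
  have CI: "C \<in> \<I>" using matroid_down[OF M BI C(1)] .
  have finC: "finite C" using C fin finite_subset by blast
  \<comment> \<open>Enlarging \<open>insert a (C - {b})\<close> to full size inside
    \<open>insert a B\<close> must omit \<open>b\<close>, because \<open>insert a C\<close> is
    dependent; only \<open>insert a (B - {b})\<close> is left.\<close>
  have swapB: "insert a (B - {b}) \<in> \<I>" if b: "b \<in> C" for b
  proof -
    have "card (C - {b}) < card C" using b finC by (meson card_Diff1_less)
    then have I: "insert a (C - {b}) \<in> \<I>"
      using C_min[of "C - {b}"] C(1) by fastforce
    have "card (insert a (C - {b})) \<le> card B"
      using B I by (simp add: basis_def)
    from matroid_augment[OF M I BI this]
    obtain Z where Z: "Z \<in> \<I>" "insert a (C - {b}) \<subseteq> Z"
        "Z \<subseteq> insert a (C - {b}) \<union> B" "card Z = card B" by blast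
    have "Z \<subseteq> insert a B" using Z(3) C(1) by blast
    have "b \<notin> Z"
    proof
      assume "b \<in> Z"
      with Z have "insert a C \<subseteq> Z" by auto
      with Z(1) C(2) show False using matroid_down[OF M] by blast
    qed
    with \<open>Z \<subseteq> insert a B\<close> have "Z \<subseteq> insert a (B - {b})" by blast
    moreover have "card (insert a (B - {b})) = card B"
      using a b C fin by (metis DiffD1 DiffD2 card_Suc_Diff1 card_insert_disjoint finite_Diff subsetD)
    ultimately have "Z = insert a (B - {b})"
      using Z fin by (intro card_subset_eq) auto
    with Z show ?thesis by simp
  qed
  \<comment> \<open>The span argument without a closure operator: \<open>C\<close> is extended by
    elements of \<open>A - {a}\<close> to an independent \<open>I\<close> of size
    \<open>card A - 1\<close>, then by some \<open>y\<close> of \<open>A\<close>, which cannot be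
    \<open>a\<close>. Exchange from \<open>insert y I\<close> into \<open>A - {a}\<close> must then
    pick an element of \<open>C\<close>.\<close>
  have "\<exists>b\<in>C - A. insert b (A - {a}) \<in> \<I>"
  proof (rule ccontr)
    assume no: "\<not> ?thesis"
    have AaI: "A - {a} \<in> \<I>" by (rule matroid_down[OF M AI]) simp
    have cA: "card (A - {a}) = card A - 1" "card A > 0"
      using a fin by (auto simp: card_gt_0_iff card_Diff_singleton)
    have "card C < card A"
    proof (rule ccontr)
      assume "\<not> ?thesis"
      then have "card (A - {a}) < card C" using cA by simp
      from matroid_exchange[OF M AaI CI this]
      obtain c where c: "c \<in> C - (A - {a})" "insert c (A - {a}) \<in> \<I>" by blast
      have "c \<noteq> a" using c(1) C(1) a by blast
      with c no show False by blast
    qed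
    then have "card C \<le> card (A - {a})" using cA by simp
    from matroid_augment[OF M CI AaI this]
    obtain I where I: "I \<in> \<I>" "C \<subseteq> I" "I \<subseteq> C \<union> (A - {a})" "card I = card (A - {a})" by blast
    then have "card I < card A" using cA by simp
    from matroid_exchange[OF M I(1) AI this]
    obtain y where y: "y \<in> A - I" "insert y I \<in> \<I>" by blast
    have "y \<noteq> a"
    proof
      assume "y = a"
      then have "insert a C \<subseteq> insert y I" using I by auto
      with y(2) C(2) show False using matroid_down[OF M] by blast
    qed
    have "card (A - {a}) < card (insert y I)"
      using y I matroid_finite_indep[OF M I(1)] by simp
    from matroid_exchange[OF M AaI y(2) this]
    obtain z where z: "z \<in> insert y I - (A - {a})" "insert z (A - {a}) \<in> \<I>" by blast
    have "z \<in> C" using z y I \<open>y \<noteq> a\<close> by auto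
    moreover have "z \<noteq> a" using \<open>z \<in> C\<close> C a by auto
    ultimately have "z \<in> C - A" using z by auto
    with no z(2) show False by blast
  qed
  then show ?thesis using swapB C by blast
qed

text \<open>Brualdi's theorem: a symmetric exchange between \<open>A\<close> and \<open>B\<close> replaces \<open>B\<close> by a basis closer to \<open>A\<close>.\<close>

lemma basis_exchange_bijection:
  assumes M: "matroid E \<I>" and A: "basis \<I> A" and B: "basis \<I> B"
  shows "\<exists>\<phi>. bij_betw \<phi> A B \<and> (\<forall>u\<in>A. \<phi> u \<notin> A - {u} \<and> insert (\<phi> u) (A - {u}) \<in> \<I>)"
  using B
proof (induction "card (A - B)" arbitrary: B)
  case 0
  have fin: "finite A" "finite B" using A 0 by (auto simp: basis_def intro: matroid_finite_indep[OF M])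
  have "card A = card B" using A 0 by (auto simp: basis_def intro: antisym)
  moreover have "A \<subseteq> B" using 0 fin by auto
  ultimately have "A = B" using fin by (intro card_subset_eq) auto
  then show ?case using A by (intro exI[of _ id]) (auto simp: basis_def insert_absorb bij_betw_def)
next
  case (Suc d)
  have fin: "finite A" "finite B" using A Suc.prems by (auto simp: basis_def intro: matroid_finite_indep[OF M])
  from Suc obtain a where a: "a \<in> A - B" by (metis card.empty equals0I nat.distinct(1))
  from symmetric_exchange[OF M A Suc.prems a]
  obtain b where b: "b \<in> B - A" "insert b (A - {a}) \<in> \<I>" "insert a (B - {b}) \<in> \<I>" by blast
  let ?B = "insert a (B - {b})"
  have "card ?B = Suc (card (B - {b}))" using a fin by (intro card_insert_disjoint) auto
  also have "\<dots> = card B" using b fin by (intro card_Suc_Diff1) auto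
  finally have "basis \<I> ?B" using Suc.prems b unfolding basis_def by simp
  moreover have "A - ?B = (A - B) - {a}" using b by blast
  then have "d = card (A - ?B)" using Suc.hyps(2) a fin by simp
  ultimately have "\<exists>\<phi>. bij_betw \<phi> A ?B \<and> (\<forall>u\<in>A. \<phi> u \<notin> A - {u} \<and> insert (\<phi> u) (A - {u}) \<in> \<I>)"
    by (intro Suc.hyps(1))
  then obtain \<phi> where \<phi>: "bij_betw \<phi> A ?B"
      "\<And>u. u \<in> A \<Longrightarrow> \<phi> u \<notin> A - {u} \<and> insert (\<phi> u) (A - {u}) \<in> \<I>"
    by blast
  \<comment> \<open>\<open>a\<close> lies in both \<open>A\<close> and \<open>?B\<close>, and
    \<open>\<phi> u \<notin> A - {u}\<close> leaves only \<open>a\<close> as a preimage of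
    \<open>a\<close>. Hence \<open>\<phi>\<close> can be redirected at \<open>a\<close> to
    \<open>b\<close> without losing bijectivity.\<close>
  have "\<phi> a = a"
  proof (rule ccontr)
    assume ne: "\<phi> a \<noteq> a"
    have "a \<in> \<phi> ` A" using bij_betw_imp_surj_on[OF \<phi>(1)] by simp
    then obtain u where u: "u \<in> A" "\<phi> u = a" by blast
    with ne have "u \<noteq> a" by auto
    with \<phi>(2)[OF u(1)] u a show False by simp
  qed
  let ?\<phi> = "\<phi>(a := b)"
  have "\<phi> ` (A - {a}) = \<phi> ` A - {a}"
    using a \<open>\<phi> a = a\<close> bij_betw_imp_inj_on[OF \<phi>(1)] by (subst inj_on_image_set_diff[of \<phi> A]) auto
  also have "\<dots> = B - {b}" using bij_betw_imp_surj_on[OF \<phi>(1)] a b by auto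
  finally have "bij_betw \<phi> (A - {a}) (B - {b})"
    using bij_betw_imp_inj_on[OF \<phi>(1)] by (auto simp: bij_betw_def intro: inj_on_subset)
  then have "bij_betw ?\<phi> (A - {a}) (B - {b})"
    by (subst bij_betw_cong[of _ _ \<phi>]) auto
  moreover have "bij_betw ?\<phi> {a} {b}" by (simp add: bij_betw_def)
  ultimately have "bij_betw ?\<phi> ((A - {a}) \<union> {a}) ((B - {b}) \<union> {b})"
    by (rule bij_betw_combine) auto
  moreover have "(A - {a}) \<union> {a} = A" "(B - {b}) \<union> {b} = B" using a b by auto
  ultimately have "bij_betw ?\<phi> A B" by simp
  moreover have "?\<phi> u \<notin> A - {u} \<and> insert (?\<phi> u) (A - {u}) \<in> \<I>" if "u \<in> A" for u
    using \<phi>(2)[OF that] b by auto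
  ultimately show ?case by blast
qed


section \<open>Non-oblivious local search\<close>

text \<open>The coefficient is (1 + 1/l)^(i - 1) / ((l - 1) choose (i - 1)), split into two naturals
  because programs contain no other constants. Truncated subtraction gives 1 at i = 0, where the
  union of classes is empty and contributes nothing.\<close>

definition ls_num :: "nat \<Rightarrow> nat \<Rightarrow> nat" where
  "ls_num l i = (l + 1) ^ (i - 1)"

definition ls_den :: "nat \<Rightarrow> nat \<Rightarrow> nat" where
  "ls_den l i = l ^ (i - 1) * ((l - 1) choose (i - 1))"

definition ls_coeff :: "nat \<Rightarrow> nat \<Rightarrow> real" where
  "ls_coeff l i = real (ls_num l i) / real (ls_den l i)"

lemma ls_coeff_nonneg: "0 \<le> ls_coeff l i"
  by (simp add: ls_coeff_def)

text \<open>The binomials satisfy i ((l - 1) choose i) = (l - i) ((l - 1) choose (i - 1)), and the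
  powers contribute (l + 1) / l. The recursion fixes the coefficients up to scaling; it is the
  condition for the exchange sum to telescope.\<close>

lemma ls_coeff_rec:
  assumes i: "1 \<le> i" "i < l"
  shows "real l * real (l - i) * ls_coeff l (Suc i) = (1 + real l) * real i * ls_coeff l i"
proof -
  obtain j where j: "i = Suc j" using i by (cases i) auto
  obtain k where k: "l = Suc k" using i by (cases l) auto
  have jk: "j < k" using i j k by simp
  have "Suc j * (k choose Suc j) = (k - j) * (k choose j)"
    using jk by (metis binomial_absorb_comp binomial_absorption diff_Suc_1 Suc_pred zero_less_diff mult.commute
      Suc_times_binomial_eq add_diff_inverse_nat choose_mult_lemma not_less_iff_gr_or_eq)
  then have eq: "real (Suc j) * real (k choose Suc j) = real (k - j) * real (k choose j)"
    by (metis of_nat_mult)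
  have pos: "real (k choose j) > 0" "real (k choose Suc j) > 0" using jk by auto
  have lk: "l - i = k - j" using j k by simp
  define x a b p q where xs: "x = real (k - j)" "a = real (k choose Suc j)" "b = real (k choose j)"
    "p = (real k + 2) ^ j" "q = (real k + 1) ^ j"
  have A: "ls_coeff l (Suc i) = (real k + 2) * p / ((real k + 1) * q * a)"
    by (simp add: ls_coeff_def ls_num_def ls_den_def j k xs algebra_simps)
  have B: "ls_coeff l i = p / (q * b)"
    by (simp add: ls_coeff_def ls_num_def ls_den_def j k xs add_ac)
  have pos': "a > 0" "b > 0" "q > 0" using pos by (auto simp: xs)
  have "x / a = real i / b" using eq pos by (simp add: field_simps xs j)
  moreover have "real l * x * ls_coeff l (Suc i) = (real k + 2) * p / q * (x / a)"
    using pos' unfolding A unfolding k by (simp add: divide_simps)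
  moreover have "(1 + real l) * real i * ls_coeff l i = (real k + 2) * p / q * (real i / b)"
    using pos' unfolding B unfolding k by (simp add: field_simps)
  ultimately show ?thesis unfolding lk xs(1)[symmetric] by simp
qed

lemma ls_coeff_1: "ls_coeff l 1 = 1"
  by (simp add: ls_coeff_def ls_num_def ls_den_def)

lemma ls_coeff_top:
  assumes "1 \<le> l"
  shows "ls_coeff l l = (1 + 1 / real l) ^ (l - 1)"
  using assms by (simp add: ls_coeff_def ls_num_def ls_den_def power_divide[symmetric] add_divide_distrib add.commute)

lemma ls_coeff_top_ge_1: "1 \<le> l \<Longrightarrow> 1 \<le> ls_coeff l l"
  by (simp add: ls_coeff_top one_le_power)

text \<open>Label 0 marks elements outside the current base and labels 1 to \<open>l\<close> its
  classes, so that one array holds both the base and its partition.\<close>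

definition labelled :: "'a set \<Rightarrow> ('a \<Rightarrow> nat) \<Rightarrow> nat set \<Rightarrow> 'a set" where
  "labelled E L J = {e \<in> E. L e \<in> J}"

definition ls_potential :: "nat \<Rightarrow> 'a set \<Rightarrow> ('a set \<Rightarrow> real) \<Rightarrow> ('a \<Rightarrow> nat) \<Rightarrow> real" where
  "ls_potential l E F L = (\<Sum>J\<in>Pow {1..l}. ls_coeff l (card J) * F (labelled E L J))"

text \<open>Double counting: \<open>(J, j) \<mapsto> (J - {j}, j)\<close> is a bijection from the
  pairs with \<open>j\<close> inside the set to those with \<open>j\<close> outside.\<close>

lemma sum_Pow_remove:
  fixes G :: "nat set \<Rightarrow> nat \<Rightarrow> real"
  assumes "finite A"
  shows "(\<Sum>J\<in>Pow A. \<Sum>j\<in>J. G (J - {j}) j) = (\<Sum>J\<in>Pow A. \<Sum>j\<in>A - J. G J j)"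
proof -
  have fin: "J \<in> Pow A \<Longrightarrow> finite J" for J using assms finite_subset by auto
  have "(\<Sum>J\<in>Pow A. \<Sum>j\<in>J. G (J - {j}) j) = (\<Sum>(J, j)\<in>(SIGMA J:Pow A. J). G (J - {j}) j)"
    using assms fin by (subst sum.Sigma) auto
  also have "\<dots> = (\<Sum>(J, j)\<in>(SIGMA J:Pow A. A - J). G J j)"
    by (rule sum.reindex_bij_witness[of _ "\<lambda>(J, j). (insert j J, j)" "\<lambda>(J, j). (J - {j}, j)"]) auto
  also have "\<dots> = (\<Sum>J\<in>Pow A. \<Sum>j\<in>A - J. G J j)"
    using assms fin by (subst sum.Sigma) auto
  finally show ?thesis .
qed

text \<open>
  The coefficients are chosen so that all terms but the ones for the empty and the full index
  set cancel.
\<close>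

lemma ls_identity:
  fixes h :: "nat set \<Rightarrow> real"
  assumes l: "1 \<le> l"
  shows "(\<Sum>J\<in>Pow {1..l}. ls_coeff l (card J) * (real (card J) * h J + real l * (\<Sum>j\<in>J. h J - h (J - {j}))))
    = real l * (real l + 1) * ls_coeff l l * h {1..l} - real l ^ 2 * h {}"
proof -
  let ?P = "Pow {1..l}" and ?a = "\<lambda>J. ls_coeff l (card J)"
  have fin: "finite J" if "J \<in> ?P" for J using that finite_subset by auto
  have card: "card (J - {j}) = card J - 1" "0 < card J" if "J \<in> ?P" "j \<in> J" for J j
    using that fin by (auto simp: card_gt_0_iff)
  \<comment> \<open>In the removal terms \<open>h J\<close> is reached from the
    \<open>l - card J\<close> sets with one more index, whence the coefficient of the next
    size.\<close>
  have "(\<Sum>J\<in>?P. \<Sum>j\<in>J. ?a J * h (J - {j})) = (\<Sum>J\<in>?P. \<Sum>j\<in>J. ls_coeff l (Suc (card (J - {j}))) * h (J - {j}))"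
    using card by (intro sum.cong refl) auto
  also have "\<dots> = (\<Sum>J\<in>?P. \<Sum>j\<in>{1..l} - J. ls_coeff l (Suc (card J)) * h J)"
    by (rule sum_Pow_remove) simp
  also have "\<dots> = (\<Sum>J\<in>?P. real (l - card J) * ls_coeff l (Suc (card J)) * h J)"
    using fin by (intro sum.cong refl) (auto simp: card_Diff_subset)
  finally have remove: "(\<Sum>J\<in>?P. \<Sum>j\<in>J. ?a J * h (J - {j}))
      = (\<Sum>J\<in>?P. real (l - card J) * ls_coeff l (Suc (card J)) * h J)" .
  have "(\<Sum>J\<in>?P. ?a J * (real (card J) * h J + real l * (\<Sum>j\<in>J. h J - h (J - {j}))))
      = (\<Sum>J\<in>?P. (1 + real l) * real (card J) * ?a J * h J)
        - real l * (\<Sum>J\<in>?P. \<Sum>j\<in>J. ?a J * h (J - {j}))"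
    by (simp add: sum_subtractf sum_distrib_left algebra_simps flip: sum.distrib)
  also have "\<dots> = (\<Sum>J\<in>?P. ((1 + real l) * real (card J) * ?a J
        - real l * real (l - card J) * ls_coeff l (Suc (card J))) * h J)"
    unfolding remove by (simp add: sum_subtractf sum_distrib_left algebra_simps)
  \<comment> \<open>The first product vanishes for the empty set and the second for
    \<open>{1..l}\<close>; for all sizes in between the two agree by
    \<open>ls_coeff_rec\<close>.\<close>
  also have "\<dots> = (\<Sum>J\<in>?P. if J = {} then - (real l ^ 2) * h {} else if J = {1..l}
        then real l * (real l + 1) * ls_coeff l l * h {1..l} else 0)"
  proof (intro sum.cong refl)
    fix J assume J: "J \<in> ?P"
    show "((1 + real l) * real (card J) * ?a J
        - real l * real (l - card J) * ls_coeff l (Suc (card J))) * h J =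
      (if J = {} then - (real l ^ 2) * h {} else if J = {1..l}
        then real l * (real l + 1) * ls_coeff l l * h {1..l} else 0)"
    proof (cases "J = {} \<or> J = {1..l}")
      case True
      then show ?thesis using ls_coeff_1[of l] l by (auto simp: power2_eq_square algebra_simps)
    next
      case False
      then have "J \<subset> {1..l}" using J by auto
      then have "card J < l" using psubset_card_mono[of "{1..l}" J] by simp
      moreover have "1 \<le> card J" using False fin[OF J] by (simp add: Suc_le_eq card_gt_0_iff)
      ultimately show ?thesis using ls_coeff_rec[of "card J" l] False by simp
    qed
  qed
  also have "\<dots> = (\<Sum>J\<in>{{}, {1..l}}. if J = {} then - (real l ^ 2) * h {} else if J = {1..l}
        then real l * (real l + 1) * ls_coeff l l * h {1..l} else 0)"
    by (rule sum.mono_neutral_right) auto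
  also have "\<dots> = real l * (real l + 1) * ls_coeff l l * h {1..l} - real l ^ 2 * h {}"
    using l by (subst sum.insert) auto
  finally show ?thesis .
qed

text \<open>This is \<open>ls_identity\<close> at the constant function 1. Its right side contains
  l^2, which the closed form of the top coefficient, (l + 1) \<open>ls_coeff l l\<close> = l (1 +
  1/l)^l, turns into the power in the ratio.\<close>

lemma ls_ratio:
  assumes l: "1 \<le> l"
  shows "real l * (real l + 1) * ls_coeff l l * (1 - (1 + 1 / real l) powi (- int l))
    = (\<Sum>J\<in>Pow {1..l}. ls_coeff l (card J) * real (card J))"
proof -
  have "(\<Sum>J\<in>Pow {1..l}. ls_coeff l (card J) * real (card J))
      = real l * (real l + 1) * ls_coeff l l - real l ^ 2"
    using ls_identity[OF l, of "\<lambda>_. 1"] by simp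
  moreover obtain k where k: "l = Suc k" using l by (cases l) auto
  have "(real l + 1) * ls_coeff l l = real l * (1 + 1 / real l) ^ l"
  proof -
    have "real l * (1 + 1 / real l) = real l + 1" using l by (simp add: field_simps)
    moreover have "(1 + 1 / real l) ^ l = (1 + 1 / real l) * (1 + 1 / real l) ^ k"
      by (metis k power_Suc)
    ultimately have "real l * (1 + 1 / real l) ^ l = (real l + 1) * (1 + 1 / real l) ^ k"
      by (metis mult.assoc)
    moreover have "ls_coeff l l = (1 + 1 / real l) ^ k" using ls_coeff_top[OF l] k by simp
    ultimately show ?thesis by metis
  qed
  moreover have "(1 + 1 / real l) ^ l \<noteq> 0"
    using zero_less_power[of "1 + 1 / real l" l] by (smt (verit) divide_nonneg_nonneg of_nat_0_le_iff)
  ultimately show ?thesis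
    by (simp add: power_int_minus right_diff_distrib power2_eq_square mult.assoc) 
qed

text \<open>Removing \<open>u\<close> first can only increase what \<open>v\<close> adds, so gain
  and loss may both be measured against the unchanged union. The hypothesis on \<open>v\<close>
  admits \<open>v = u\<close>, a mere relabelling.\<close>

lemma ls_swap_gain:
  assumes F: "objective E F" and L: "\<And>e. e \<in> E \<Longrightarrow> L e \<in> {0..l}"
    and u: "u \<in> E" and v: "v \<in> E" "v \<notin> labelled E L {1..l} - {u}" and J: "J \<subseteq> {1..l}"
  shows "F (labelled E (L(u := 0, v := k)) J) - F (labelled E L J)
    \<ge> (if k \<in> J then F (insert v (labelled E L J)) - F (labelled E L J) else 0)
      - (F (labelled E L J) - F (labelled E L J - {u}))"
proof -
  let ?P = "labelled E L J"
  have PE: "?P \<subseteq> E" by (auto simp: labelled_def)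
  have "v \<notin> ?P - {u}" using v J by (auto simp: labelled_def)
  then have eq: "labelled E (L(u := 0, v := k)) J = (if k \<in> J then insert v (?P - {u}) else ?P - {u})"
    using v J by (auto simp: labelled_def)
  have "F (insert v ?P) - F ?P \<le> F (insert v (?P - {u})) - F (?P - {u})"
    using PE v by (intro objective_diminishing_insert[OF F]) auto
  then show ?thesis unfolding eq by auto
qed

text \<open>Summation over all swaps along \<open>\<phi>\<close> and all new labels: in the union
  over \<open>J\<close>, the new element arrives for \<open>card J\<close> of the \<open>l\<close>
  labels, while the removal happens for all \<open>l\<close>. Once the losses are grouped by class,
  \<open>ls_identity\<close> cancels every union but the full one and the empty one.\<close>

lemma ls_total_gain:
  assumes F: "objective E F" and fin: "finite E" and L: "\<And>e. e \<in> E \<Longrightarrow> L e \<in> {0..l}"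
    and l: "1 \<le> l"
    and S: "S = labelled E L {1..l}" and Q: "Q \<subseteq> E" and \<phi>: "bij_betw \<phi> S Q"
    and \<phi>S: "\<And>u. u \<in> S \<Longrightarrow> \<phi> u \<notin> S - {u}"
  shows "(\<Sum>u\<in>S. \<Sum>k=1..l. ls_potential l E F (L(u := 0, \<phi> u := k)) - ls_potential l E F L)
    \<ge> real l * (real l + 1) * ls_coeff l l * ((1 - (1 + 1 / real l) powi (- int l)) * F Q - F S)"
proof -
  let ?P = "labelled E L" and ?a = "\<lambda>J. ls_coeff l (card J)" and ?J = "Pow {1..l}"
  have SE: "S \<subseteq> E" unfolding S labelled_def by auto
  then have finS: "finite S" using fin finite_subset by blast
  have finQ: "finite Q" using Q fin finite_subset by blast
  have one: "(\<Sum>u\<in>S. \<Sum>k=1..l. F (P' u k) - F (?P J))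
      \<ge> real (card J) * (F Q - F (?P J)) - real l * (\<Sum>j\<in>J. F (?P J) - F (?P (J - {j})))"
    if J: "J \<in> ?J" and P': "P' = (\<lambda>u k. labelled E (L(u := 0, \<phi> u := k)) J)" for J P'
  proof -
    have PE: "?P J \<subseteq> E" and PS: "?P J \<subseteq> S" using J by (auto simp: labelled_def S)
    have finJ: "finite J" using J finite_subset by auto
    \<comment> \<open>Every element of \<open>Q\<close> is inserted by exactly one swap, so the
      insertions together gain at least what the union lacks to \<open>F Q\<close>.\<close>
    have "F Q - F (?P J) \<le> F (?P J \<union> Q) - F (?P J)"
      using Q PE by (intro diff_right_mono objective_mono[OF F]) auto
    also have "\<dots> \<le> (\<Sum>e\<in>Q. F (insert e (?P J)) - F (?P J))"
      using Q PE finQ by (intro objective_union_le_sum[OF F]) auto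
    also have "\<dots> = (\<Sum>u\<in>S. F (insert (\<phi> u) (?P J)) - F (?P J))"
      using sum.reindex_bij_betw[OF \<phi>, of "\<lambda>e. F (insert e (?P J)) - F (?P J)"] by simp
    finally have A: "F Q - F (?P J) \<le> (\<Sum>u\<in>S. F (insert (\<phi> u) (?P J)) - F (?P J))" .
    have "(\<Sum>u\<in>S. F (?P J) - F (?P J - {u})) = (\<Sum>u\<in>?P J. F (?P J) - F (?P J - {u}))"
      using PS finS by (intro sum.mono_neutral_right) auto
    \<comment> \<open>Splitting the union by label replaces the losses of single elements by the
      loss of a whole class, the difference that occurs in \<open>ls_identity\<close>.\<close>
    also have "\<dots> = (\<Sum>u\<in>(\<Union>j\<in>J. ?P {j}). F (?P J) - F (?P J - {u}))"
      by (intro sum.cong refl) (auto simp: labelled_def)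
    also have "\<dots> = (\<Sum>j\<in>J. \<Sum>u\<in>?P {j}. F (?P J) - F (?P J - {u}))"
      using finJ fin by (intro sum.UNION_disjoint) (auto simp: labelled_def)
    also have "\<dots> \<le> (\<Sum>j\<in>J. F (?P J) - F (?P (J - {j})))"
    proof (intro sum_mono)
      fix j assume "j \<in> J"
      then have "(\<Sum>u\<in>?P {j}. F (?P J) - F (?P J - {u})) \<le> F (?P J) - F (?P J - ?P {j})"
        using fin PE by (intro objective_sum_remove_le[OF F]) (auto simp: labelled_def)
      also have "?P J - ?P {j} = ?P (J - {j})" by (auto simp: labelled_def)
      finally show "(\<Sum>u\<in>?P {j}. F (?P J) - F (?P J - {u})) \<le> F (?P J) - F (?P (J - {j}))" .
    qed
    finally have B: "(\<Sum>u\<in>S. F (?P J) - F (?P J - {u})) \<le> (\<Sum>j\<in>J. F (?P J) - F (?P (J - {j})))" .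
    have "{1..l} \<inter> J = J" using J by auto
    then have "(\<Sum>u\<in>S. \<Sum>k=1..l. (if k \<in> J then F (insert (\<phi> u) (?P J)) - F (?P J) else 0)
          - (F (?P J) - F (?P J - {u})))
        = real (card J) * (\<Sum>u\<in>S. F (insert (\<phi> u) (?P J)) - F (?P J))
          - real l * (\<Sum>u\<in>S. F (?P J) - F (?P J - {u}))"
      by (simp add: sum_subtractf sum_distrib_left sum.If_cases right_diff_distrib)
    moreover have "\<dots> \<ge> real (card J) * (F Q - F (?P J)) - real l * (\<Sum>j\<in>J. F (?P J) - F (?P (J - {j})))"
      by (intro diff_mono mult_left_mono A B) auto
    moreover have "(\<Sum>u\<in>S. \<Sum>k=1..l. F (P' u k) - F (?P J))
        \<ge> (\<Sum>u\<in>S. \<Sum>k=1..l. (if k \<in> J then F (insert (\<phi> u) (?P J)) - F (?P J) else 0)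
          - (F (?P J) - F (?P J - {u})))"
      unfolding P'
    proof (intro sum_mono ls_swap_gain[OF F L])
      fix u assume u: "u \<in> S"
      show "u \<in> E" using u SE by auto
      show "\<phi> u \<in> E" using bij_betwE[OF \<phi>] u Q by auto
      show "\<phi> u \<notin> labelled E L {1..l} - {u}" using \<phi>S[OF u] S by simp
    qed (use J in auto)
    ultimately show ?thesis by linarith
  qed
  have h0: "F (?P {}) = 0" using objective_empty[OF F] by (simp add: labelled_def)
  have "(\<Sum>u\<in>S. \<Sum>k=1..l. ls_potential l E F (L(u := 0, \<phi> u := k)) - ls_potential l E F L)
     = (\<Sum>u\<in>S. \<Sum>k=1..l. \<Sum>J\<in>?J. ?a J * (F (labelled E (L(u := 0, \<phi> u := k)) J) - F (?P J)))"
    by (simp add: ls_potential_def sum_subtractf right_diff_distrib)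
  also have "\<dots> = (\<Sum>u\<in>S. \<Sum>J\<in>?J. \<Sum>k=1..l. ?a J * (F (labelled E (L(u := 0, \<phi> u := k)) J) - F (?P J)))"
    by (intro sum.cong refl sum.swap)
  also have "\<dots> = (\<Sum>J\<in>?J. \<Sum>u\<in>S. \<Sum>k=1..l. ?a J * (F (labelled E (L(u := 0, \<phi> u := k)) J) - F (?P J)))"
    by (rule sum.swap)
  also have "\<dots> = (\<Sum>J\<in>?J. ?a J * (\<Sum>u\<in>S. \<Sum>k=1..l. F (labelled E (L(u := 0, \<phi> u := k)) J) - F (?P J)))"
    by (simp add: sum_distrib_left)
  also have "\<dots> \<ge> (\<Sum>J\<in>?J. ?a J * (real (card J) * (F Q - F (?P J)) - real l * (\<Sum>j\<in>J. F (?P J) - F (?P (J - {j})))))"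
    by (intro sum_mono mult_left_mono one ls_coeff_nonneg) auto
  also have "(\<Sum>J\<in>?J. ?a J * (real (card J) * (F Q - F (?P J)) - real l * (\<Sum>j\<in>J. F (?P J) - F (?P (J - {j})))))
      = (\<Sum>J\<in>?J. ?a J * real (card J)) * F Q
        - (\<Sum>J\<in>?J. ?a J * (real (card J) * F (?P J) + real l * (\<Sum>j\<in>J. F (?P J) - F (?P (J - {j})))))"
    by (simp add: algebra_simps sum_subtractf sum.distrib sum_distrib_left sum_distrib_right)
  also have "\<dots> = real l * (real l + 1) * ls_coeff l l * (1 - (1 + 1 / real l) powi (- int l)) * F Q
      - real l * (real l + 1) * ls_coeff l l * F S"
    unfolding ls_identity[OF l, of "\<lambda>J. F (?P J)"] ls_ratio[OF l] h0 S by simp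
  finally show ?thesis by (subst right_diff_distrib) (simp only: mult.assoc)
qed

text \<open>Averaging: if each of the at most l |E| swaps along Brualdi's bijection gained less than
  \<delta> F(Q) / |E|, all of them would gain less than l \<delta> F(Q). By
  \<open>ls_total_gain\<close> they gain at least that, since (l + 1) \<open>ls_coeff l l\<close>
  \<ge> 1.\<close>

lemma ls_improving_swap:
  assumes M: "matroid E \<I>" and F: "objective E F" and L: "\<And>e. e \<in> E \<Longrightarrow> L e \<in> {0..l}"
    and l: "1 \<le> l" and S: "S = labelled E L {1..l}" "basis \<I> S" and Q: "basis \<I> Q"
    and \<delta>: "0 < \<delta>" and FQ: "0 < F Q" and low: "F S \<le> (1 - (1 + 1 / real l) powi (- int l) - \<delta>) * F Q"
  shows "\<exists>u\<in>E. \<exists>v\<in>E. \<exists>k\<in>{1..l}. v \<notin> S - {u} \<and> insert v (S - {u}) \<in> \<I> \<and>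
    ls_potential l E F (L(u := 0, v := k)) \<ge> ls_potential l E F L + \<delta> * F Q / real (card E)"
proof (rule ccontr)
  assume no: "\<not> ?thesis"
  obtain \<phi> where \<phi>: "bij_betw \<phi> S Q" "\<And>u. u \<in> S \<Longrightarrow> \<phi> u \<notin> S - {u} \<and> insert (\<phi> u) (S - {u}) \<in> \<I>"
    using basis_exchange_bijection[OF M S(2) Q] by blast
  have SE: "S \<subseteq> E" and QE: "Q \<subseteq> E" using S(2) Q matroid_subset[OF M] by (auto simp: basis_def)
  have fin: "finite E" using matroid_finite[OF M] .
  have finS: "finite S" using SE fin finite_subset by blast
  have "S \<noteq> {}"
  proof
    assume "S = {}"
    then have "Q = {}" using \<phi>(1) by (simp add: bij_betw_def)
    then show False using FQ objective_empty[OF F] by simp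
  qed
  then have S0: "card S > 0" "card S \<le> card E" using finS card_mono[OF fin SE] by (auto simp: card_gt_0_iff)
  let ?g = "\<delta> * F Q / real (card E)"
  let ?gain = "\<lambda>u k. ls_potential l E F (L(u := 0, \<phi> u := k)) - ls_potential l E F L"
  have "(\<Sum>u\<in>S. \<Sum>k=1..l. ?gain u k) < (\<Sum>u\<in>S. \<Sum>k=1..l. ?g)"
  proof (intro sum_strict_mono finS \<open>S \<noteq> {}\<close>)
    fix u k assume u: "u \<in> S" and k: "k \<in> {1..l}"
    have "u \<in> E" "\<phi> u \<in> E" using u SE QE bij_betwE[OF \<phi>(1)] by auto
    with no \<phi>(2)[OF u] k have "\<not> ls_potential l E F (L(u := 0, \<phi> u := k)) \<ge> ls_potential l E F L + ?g"
      by blast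
    then show "?gain u k < ?g" by simp
  qed (use l in auto)
  also have "\<dots> = real (card S) * real l * ?g" by simp
  also have "\<dots> \<le> real (card E) * real l * ?g"
    using S0 \<delta> FQ by (intro mult_right_mono) auto
  also have "\<dots> = real l * 1 * 1 * (\<delta> * F Q)" using S0 by simp
  also have "\<dots> \<le> real l * (real l + 1) * ls_coeff l l * (\<delta> * F Q)"
    using \<delta> FQ ls_coeff_top_ge_1[OF l] by (intro mult_mono) auto
  also have "\<dots> \<le> real l * (real l + 1) * ls_coeff l l * ((1 - (1 + 1 / real l) powi (- int l)) * F Q - F S)"
    using low ls_coeff_top_ge_1[OF l] by (intro mult_left_mono) (auto simp: algebra_simps)
  also have "\<dots> \<le> (\<Sum>u\<in>S. \<Sum>k=1..l. ?gain u k)"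
    using \<phi>(2) by (intro ls_total_gain[OF F fin L l S(1) QE \<phi>(1)]) auto
  finally show False by simp
qed

text \<open>All unions of classes lie inside the independent set formed by all classes, so none is
  worth more than \<open>v\<close>. This caps the number of improving steps.\<close>

lemma ls_potential_le:
  assumes F: "objective E F" and S: "labelled E L {1..l} \<in> \<I>" and Q: "\<And>X. X \<in> \<I> \<Longrightarrow> F X \<le> v"
  shows "ls_potential l E F L \<le> (\<Sum>J\<in>Pow {1..l}. ls_coeff l (card J)) * v"
proof -
  have "F (labelled E L J) \<le> v" if "J \<subseteq> {1..l}" for J
    using that objective_mono[OF F, of "labelled E L J" "labelled E L {1..l}"] Q[OF S]
    by (force simp: labelled_def)
  then show ?thesis unfolding ls_potential_def sum_distrib_right
    by (intro sum_mono mult_left_mono ls_coeff_nonneg) auto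
qed

lemma ls_potential_nonneg:
  assumes F: "objective E F"
  shows "0 \<le> ls_potential l E F L"
  unfolding ls_potential_def
  by (intro sum_nonneg mult_nonneg_nonneg ls_coeff_nonneg objective_nonneg[OF F]) (auto simp: labelled_def)


section \<open>The greedy algorithm for a knapsack constraint\<close>

lemma exp_1_le_3: "exp (1::real) \<le> 3"
  using exp_le by simp

lemma finite_has_argmax:
  fixes f :: "'a \<Rightarrow> real"
  assumes "finite A" "A \<noteq> {}"
  shows "\<exists>x\<in>A. \<forall>y\<in>A. f y \<le> f x"
  using ex_is_arg_min_if_finite[OF assms, of "\<lambda>x. - f x"] by (auto simp: is_arg_min_linorder)

text \<open>\<open>a\<close>, \<open>b\<close>, \<open>c\<close> are picked greedily by value. Over
  any \<open>Y\<close> that contains them, an element of \<open>Q\<close> gains at most each of the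
  three successive increments, hence at most their mean, and they telescope to
  \<open>F {a, b, c}\<close>. The three may coincide, so a small \<open>Q\<close> needs no separate
  treatment.\<close>

lemma heavy_triple:
  assumes F: "objective E F" and Q: "Q \<subseteq> E" "finite Q" "Q \<noteq> {}"
  shows "\<exists>a\<in>Q. \<exists>b\<in>Q. \<exists>c\<in>Q. \<forall>e\<in>Q. \<forall>Y. {a, b, c} \<subseteq> Y \<longrightarrow> Y \<subseteq> E \<longrightarrow>
    F (insert e Y) - F Y \<le> F {a, b, c} / 3"
proof -
  have ex: "\<exists>a\<in>Q. \<forall>e\<in>Q. F (insert e A) \<le> F (insert a A)" for A
    using finite_has_argmax[of Q "\<lambda>e. F (insert e A)"] Q by blast
  obtain a where a: "a \<in> Q" "\<And>e. e \<in> Q \<Longrightarrow> F {e} \<le> F {a}" using ex[of "{}"] by blast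
  obtain b where b: "b \<in> Q" "\<And>e. e \<in> Q \<Longrightarrow> F {e, a} \<le> F {b, a}" using ex[of "{a}"] by blast
  obtain c where c: "c \<in> Q" "\<And>e. e \<in> Q \<Longrightarrow> F {e, b, a} \<le> F {c, b, a}" using ex[of "{b, a}"] by blast
  have "F (insert e Y) - F Y \<le> F {a, b, c} / 3" if e: "e \<in> Q" and Y: "{a, b, c} \<subseteq> Y" "Y \<subseteq> E" for e Y
  proof -
    have "F (insert e Y) - F Y \<le> F {e} - F {}"
      using Y Q e by (intro objective_diminishing_insert[OF F]) auto
    moreover have "F (insert e Y) - F Y \<le> F {e, a} - F {a}"
      using Y Q e by (intro objective_diminishing_insert[OF F]) auto
    moreover have "F (insert e Y) - F Y \<le> F {e, b, a} - F {b, a}"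
      using Y Q e by (intro objective_diminishing_insert[OF F]) auto
    moreover have "{a, b, c} = {c, b, a}" by auto
    ultimately show ?thesis
      using a(2)[OF e] b(2)[OF e] c(2)[OF e] objective_empty[OF F] by simp
  qed
  with a(1) b(1) c(1) show ?thesis by blast
qed

definition gain_density :: "('a set \<Rightarrow> real) \<Rightarrow> ('a \<Rightarrow> real) \<Rightarrow> 'a set \<Rightarrow> 'a \<Rightarrow> real" where
  "gain_density F s Y e = (F (insert e Y) - F Y) / s e"

text \<open>\<open>R\<close> stands for the candidates examined so far: the same predicate is the
  invariant of the scan and, for \<open>R = E\<close>, the result of a whole step. Density 0 with
  \<open>Y' = Y\<close> records that no candidate fits with positive density.\<close>

definition greedy_step ::
  "'a set \<Rightarrow> ('a set \<Rightarrow> real) \<Rightarrow> ('a \<Rightarrow> real) \<Rightarrow> real \<Rightarrow> 'a set \<Rightarrow> 'a set \<Rightarrow> real \<Rightarrow> 'a set \<Rightarrow> bool" where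
  "greedy_step E F s C R Y d Y' \<longleftrightarrow> 0 \<le> d \<and>
     (\<forall>e\<in>R - Y. sum s (insert e Y) \<le> C \<longrightarrow> gain_density F s Y e \<le> d) \<and>
     (Y' = Y \<and> d = 0 \<or> (\<exists>e\<in>E - Y. sum s (insert e Y) \<le> C \<and> Y' = insert e Y \<and> gain_density F s Y e = d))"

text \<open>
  While the target value is not reached, the gap to the optimum decays exponentially in the
  fraction of the remaining capacity that has been used.
\<close>

definition greedy_progress ::
  "'a set \<Rightarrow> ('a set \<Rightarrow> real) \<Rightarrow> ('a \<Rightarrow> real) \<Rightarrow> real \<Rightarrow> 'a set \<Rightarrow> 'a set \<Rightarrow> nat \<Rightarrow> 'a set \<Rightarrow> bool" where
  "greedy_progress E F s C Q Y0 i Y \<longleftrightarrow>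
     ((1 - 1 / exp 1) * F Q \<le> F Y \<or>
     (i \<le> card Y \<and> F (Q \<union> Y0) - F Y
        \<le> exp (- (sum s Y - sum s Y0) / (C - sum s Y0)) * (F (Q \<union> Y0) - F Y0)))"

text \<open>Let \<open>u\<close> be the densest element of \<open>Q\<close> still missing. If it
  fits, the element chosen is at least as dense and the gap shrinks by the factor exp (- s/D), where
  s is its size and D the capacity left by the start. If it does not fit, adding it anyway would use
  up the capacity and leave at most a 1/e share of the gap, and its own gain is small enough to
  forgo.\<close>

lemma greedy_progress_step:
  assumes F: "objective E F" and fin: "finite E" and s: "\<And>e. e \<in> E \<Longrightarrow> 0 \<le> s e"
    and Q: "Q \<subseteq> E" and Y0: "Y0 \<subseteq> E" "\<And>e. e \<in> E - Y0 \<Longrightarrow> 0 < s e"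
    and cap: "sum s (Q - Y0) \<le> C - sum s Y0"
    and heavy: "\<And>e Y. e \<in> Q \<Longrightarrow> Y0 \<subseteq> Y \<Longrightarrow> Y \<subseteq> E \<Longrightarrow> F (insert e Y) - F Y \<le> F Y0 / 3"
    and Y: "Y0 \<subseteq> Y" "Y \<subseteq> E" and prog: "greedy_progress E F s C Q Y0 i Y"
    and step: "greedy_step E F s C E Y d Y'"
  shows "greedy_progress E F s C Q Y0 (Suc i) Y'"
proof -
  have Y'E: "Y' \<subseteq> E" "Y \<subseteq> Y'" using step Y by (auto simp: greedy_step_def)
  have mono: "F Y \<le> F Y'" by (intro objective_mono[OF F] Y'E)
  have reached: ?thesis if "(1 - 1 / exp 1) * F Q \<le> F Y"
    using that mono by (auto simp: greedy_progress_def)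
  have FQ: "(1 - 1 / exp 1) * F Q \<le> F Q"
    using objective_nonneg[OF F Q] by (simp add: algebra_simps)
  have FQQ: "F Q \<le> F (Q \<union> Y0)" using Q Y0 by (intro objective_mono[OF F]) auto
  show ?thesis
  proof (cases "(1 - 1 / exp 1) * F Q \<le> F Y \<or> F (Q \<union> Y0) \<le> F Y")
    case True
    then show ?thesis using reached FQ FQQ by linarith
  next
    case False
    let ?R = "Q - Y" and ?D = "C - sum s Y0" and ?G = "F (Q \<union> Y0) - F Y"
    let ?ex = "exp (- (sum s Y - sum s Y0) / ?D)"
    have finY: "finite Y" and finR: "finite ?R" using Y Q fin finite_subset by blast+
    have prog': "i \<le> card Y" "?G \<le> ?ex * (F (Q \<union> Y0) - F Y0)"
      using prog False by (auto simp: greedy_progress_def)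
    have "?R \<noteq> {}"
    proof
      assume "?R = {}"
      then have "Q \<union> Y0 \<subseteq> Y" using Y by auto
      then have "F (Q \<union> Y0) \<le> F Y" using Y by (intro objective_mono[OF F]) auto
      with False show False by simp
    qed
    have spos: "0 < s e" "e \<in> E" if "e \<in> ?R" for e using that Q Y Y0(2)[of e] by auto
    have "\<exists>u\<in>?R. \<forall>e\<in>?R. gain_density F s Y e \<le> gain_density F s Y u"
      using finite_has_argmax[OF finR \<open>?R \<noteq> {}\<close>] .
    then obtain u where u: "u \<in> ?R" and u_max: "\<And>e. e \<in> ?R \<Longrightarrow> gain_density F s Y e \<le> gain_density F s Y u" by blast
    have dens: "F (insert e Y) - F Y = s e * gain_density F s Y e" if "e \<in> ?R" for e
      using spos[OF that] by (simp add: gain_density_def)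
    have dens0: "0 \<le> gain_density F s Y u"
      using spos[OF u] Y objective_mono[OF F, of Y "insert u Y"]
      by (simp add: gain_density_def subset_insertI)
    have Q_Y0: "sum s ?R \<le> ?D"
    proof -
      have "sum s ?R \<le> sum s (Q - Y0)"
        using Q fin finite_subset s Y by (intro sum_mono2) (auto intro: finite_subset)
      then show ?thesis using cap by simp
    qed
    have D: "0 < ?D"
      using sum_pos[OF finR \<open>?R \<noteq> {}\<close>, of s] spos(1) Q_Y0 by fastforce
    \<comment> \<open>The missing elements of \<open>Q\<close> close the gap and have total size at
      most \<open>?D\<close>, so the densest of them has density at least the gap divided by
      \<open>?D\<close>.\<close>
    have "?G \<le> F (Y \<union> ?R) - F Y"
      using Q Y by (intro diff_right_mono objective_mono[OF F]) auto
    also have "\<dots> \<le> (\<Sum>e\<in>?R. F (insert e Y) - F Y)"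
      using Q Y finR by (intro objective_union_le_sum[OF F]) auto
    also have "\<dots> \<le> (\<Sum>e\<in>?R. s e * gain_density F s Y u)"
      using dens u_max spos by (intro sum_mono) (simp add: mult_left_mono less_imp_le)
    also have "\<dots> = sum s ?R * gain_density F s Y u" by (simp add: sum_distrib_right)
    also have "\<dots> \<le> ?D * gain_density F s Y u" using Q_Y0 dens0 by (rule mult_right_mono)
    finally have G: "?G / ?D \<le> gain_density F s Y u" using D by (simp add: field_simps)
    have add: "F (Q \<union> Y0) - F (insert e Y)
          \<le> exp (- (sum s (insert e Y) - sum s Y0) / ?D) * (F (Q \<union> Y0) - F Y0)"
      if e: "e \<in> E - Y" "?G / ?D \<le> gain_density F s Y e" for e
    proof -
      have se: "0 < s e" using e Y Y0(2)[of e] by auto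
      have "?G / ?D * s e \<le> gain_density F s Y e * s e" using e se by (intro mult_right_mono) auto
      also have "\<dots> = F (insert e Y) - F Y" using se by (simp add: gain_density_def)
      finally have "F (Q \<union> Y0) - F (insert e Y) \<le> ?G * (1 + (- s e / ?D))"
        by (simp add: algebra_simps)
      also have "\<dots> \<le> ?G * exp (- s e / ?D)"
        using False by (intro mult_left_mono exp_ge_add_one_self) auto
      also have "\<dots> \<le> (?ex * (F (Q \<union> Y0) - F Y0)) * exp (- s e / ?D)"
        by (intro mult_right_mono prog') auto
      also have "\<dots> = (?ex * exp (- s e / ?D)) * (F (Q \<union> Y0) - F Y0)" by simp
      also have "?ex * exp (- s e / ?D) = exp (- (sum s (insert e Y) - sum s Y0) / ?D)"
        using e finY by (simp add: exp_add[symmetric] add_divide_distrib[symmetric] algebra_simps)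
      finally show ?thesis .
    qed
    show ?thesis
    proof (cases "sum s (insert u Y) \<le> C")
      case True
      then have ud: "gain_density F s Y u \<le> d" using step u Q by (auto simp: greedy_step_def)
      have "0 < ?G / ?D" using False D by simp
      then have "d \<noteq> 0" using G ud by linarith
      with step obtain e where e: "e \<in> E - Y" "Y' = insert e Y" "gain_density F s Y e = d"
        by (auto simp: greedy_step_def)
      have "F (Q \<union> Y0) - F Y' \<le> exp (- (sum s Y' - sum s Y0) / ?D) * (F (Q \<union> Y0) - F Y0)"
        unfolding e(2) using e G ud by (intro add) auto
      moreover have "Suc i \<le> card Y'" using e prog' finY by simp
      ultimately show ?thesis by (simp add: greedy_progress_def)
    next
      case nofit: False
      have uE: "u \<in> E - Y" using u Q by auto
      have FY0: "0 \<le> F Y0" "F Y0 \<le> F (Q \<union> Y0)"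
        using objective_nonneg[OF F Y0(1)] Q Y0 by (auto intro!: objective_mono[OF F])
      have "F (Q \<union> Y0) - F (insert u Y)
          \<le> exp (- (sum s (insert u Y) - sum s Y0) / ?D) * (F (Q \<union> Y0) - F Y0)"
        using uE G by (rule add)
      also have "- (sum s (insert u Y) - sum s Y0) / ?D \<le> -1"
        using nofit D by (simp add: field_simps)
      then have "exp (- (sum s (insert u Y) - sum s Y0) / ?D) * (F (Q \<union> Y0) - F Y0)
          \<le> exp (-1) * (F (Q \<union> Y0) - F Y0)"
        using FY0 by (intro mult_right_mono) auto
      finally have 1: "F (Q \<union> Y0) - F (insert u Y) \<le> (F (Q \<union> Y0) - F Y0) / exp 1"
        by (simp add: exp_minus field_simps)
      have 2: "F (insert u Y) - F Y \<le> F Y0 / 3" using u Y by (intro heavy) auto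
      \<comment> \<open>As e \<le> 3, the forgone gain is at most F(Y0) / e, precisely what the gap
        bound saves by starting from \<open>Y0\<close>. This is why starts have three
        elements.\<close>
      have "F Y0 / 3 \<le> F Y0 / exp 1" using FY0 exp_1_le_3 by (intro divide_left_mono) auto
      then have "(1 - 1 / exp 1) * F (Q \<union> Y0) \<le> F Y"
        using 1 2 by (simp add: diff_divide_distrib left_diff_distrib)
      moreover have "(1 - 1 / exp 1) * F Q \<le> (1 - 1 / exp 1) * F (Q \<union> Y0)"
        using FQQ by (intro mult_left_mono) auto
      ultimately show ?thesis using reached by linarith
    qed
  qed
qed

lemma greedy_progress_start: "greedy_progress E F s C Q Y0 0 Y0"
  by (simp add: greedy_progress_def)

text \<open>As long as the target is missed every step adds an element; after \<open>card E\<close>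
  steps \<open>Y = E\<close>, which is at least as good as \<open>Q\<close>.\<close>

lemma greedy_progress_end:
  assumes F: "objective E F" and fin: "finite E" and Q: "Q \<subseteq> E" and Y: "Y \<subseteq> E"
    and prog: "greedy_progress E F s C Q Y0 (card E) Y"
  shows "(1 - 1 / exp 1) * F Q \<le> F Y"
proof (rule ccontr)
  assume no: "\<not> ?thesis"
  then have "card E \<le> card Y" using prog by (simp add: greedy_progress_def)
  then have "Y = E" using card_seteq[OF fin Y] by simp
  moreover have "F Q \<le> F E" by (intro objective_mono[OF F] Q) simp
  moreover have "(1 - 1 / exp 1) * F Q \<le> F Q"
    using objective_nonneg[OF F Q] by (simp add: algebra_simps)
  ultimately show False using no by simp
qed


section \<open>Multiplicative weights\<close>

text \<open>A converse of 1 - y \<le> exp (- y): on [0, 1/2] one has ln (1 - y) \<ge> - y - 2 y^2,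
  and y^2 \<le> \<eta> y for y = \<eta> x. Its price is the factor 1 + 2 \<eta>.\<close>

lemma exp_le_one_minus:
  assumes "0 \<le> x" "x \<le> (1::real)" "0 < \<eta>" "\<eta> \<le> 1 / 2"
  shows "exp (- (\<eta> * (1 + 2 * \<eta>) * x)) \<le> 1 - \<eta> * x"
proof -
  have *: "0 \<le> \<eta> * x" "\<eta> * x \<le> 1 / 2"
    using assms mult_mono[of \<eta> "1/2" x 1] by auto
  have "(\<eta> * x)\<^sup>2 \<le> \<eta> * \<eta> * x"
    using assms by (simp add: power2_eq_square mult_left_le mult_mono mult.assoc mult.left_commute)
  then have "- (\<eta> * (1 + 2 * \<eta>) * x) \<le> - (\<eta> * x) - 2 * (\<eta> * x)\<^sup>2"
    by (simp add: algebra_simps)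
  also have "\<dots> \<le> ln (1 - \<eta> * x)" by (rule ln_one_minus_pos_lower_bound[OF *])
  finally show ?thesis using * by (simp add: ln_ge_iff)
qed

lemma mw_step_lower:
  assumes "0 \<le> x" "x \<le> (1::real)" "0 < \<eta>" "\<eta> \<le> 1 / 2" "exp (- (\<eta> * (1 + 2 * \<eta>) * y)) \<le> w"
  shows "exp (- (\<eta> * (1 + 2 * \<eta>) * (y + x))) \<le> w * (1 - \<eta> * x)"
proof -
  have "exp (- (\<eta> * (1 + 2 * \<eta>) * (y + x))) = exp (- (\<eta> * (1 + 2 * \<eta>) * y)) * exp (- (\<eta> * (1 + 2 * \<eta>) * x))"
    by (simp add: exp_add[symmetric] algebra_simps)
  also have "\<dots> \<le> w * (1 - \<eta> * x)"
    using exp_le_one_minus[OF assms(1-4)] assms(5) by (intro mult_mono) (auto intro: order_trans[OF exp_ge_zero])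
  finally show ?thesis .
qed

text \<open>The total weight is the potential of the method: an answer whose weighted mean is at
  least \<open>v\<close> shrinks it by 1 - \<eta> v \<le> exp (- \<eta> v).\<close>

lemma mw_step_upper:
  fixes w x :: "nat \<Rightarrow> real"
  assumes "0 \<le> \<eta>" "sum w K * v \<le> (\<Sum>k\<in>K. w k * x k)" "sum w K \<le> N * exp (- (\<eta> * v * j))" "0 \<le> sum w K"
  shows "(\<Sum>k\<in>K. w k * (1 - \<eta> * x k)) \<le> N * exp (- (\<eta> * v * (j + 1)))"
proof -
  have "(\<Sum>k\<in>K. w k * (1 - \<eta> * x k)) = sum w K - \<eta> * (\<Sum>k\<in>K. w k * x k)"
    by (simp add: right_diff_distrib sum_subtractf sum_distrib_left mult_ac)
  also have "\<dots> \<le> sum w K - \<eta> * (sum w K * v)"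
    using assms by (intro diff_left_mono mult_left_mono) auto
  also have "\<dots> = sum w K * (1 + (- (\<eta> * v)))" by (simp add: algebra_simps)
  also have "\<dots> \<le> sum w K * exp (- (\<eta> * v))"
    using assms by (intro mult_left_mono exp_ge_add_one_self)
  also have "\<dots> \<le> N * exp (- (\<eta> * v * j)) * exp (- (\<eta> * v))"
    using assms by (intro mult_right_mono) auto
  also have "\<dots> = N * exp (- (\<eta> * v * (j + 1)))"
    by (simp add: exp_add[symmetric] algebra_simps)
  finally show ?thesis .
qed

text \<open>A single weight is at most the total, and the exponents of the two bounds are compared.
  The crude n \<le> exp n puts n in place of ln n in the regret, which keeps the number of rounds an
  arithmetic expression.\<close>

lemma mw_end:
  fixes w :: "nat \<Rightarrow> real"
  assumes "exp (- (\<eta> * (1 + 2 * \<eta>) * y)) \<le> w k" "sum w {..<n} \<le> real n * exp (- (\<eta> * v * t))"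
    "\<And>k. k < n \<Longrightarrow> 0 \<le> w k" "k < n" "0 < \<eta>"
  shows "v * t - real n / \<eta> \<le> (1 + 2 * \<eta>) * y"
proof -
  have "exp (- (\<eta> * (1 + 2 * \<eta>) * y)) \<le> w k" by fact
  also have "\<dots> \<le> sum w {..<n}" using assms by (intro member_le_sum) auto
  also have "\<dots> \<le> real n * exp (- (\<eta> * v * t))" by fact
  also have "\<dots> \<le> exp (real n) * exp (- (\<eta> * v * t))"
    using exp_ge_add_one_self[of "real n"] by (intro mult_right_mono) (linarith, simp)
  finally have "\<eta> * v * t - real n \<le> \<eta> * (1 + 2 * \<eta>) * y"
    by (simp add: exp_add[symmetric])
  then show ?thesis using assms by (simp add: field_simps)
qed

section \<open>Uniform mixtures and bounds on the optimum\<close>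

lemma uniform_distribution:
  fixes Xs :: "nat \<Rightarrow> 'a set"
  assumes T: "0 < T" and Xs: "\<And>j. j < T \<Longrightarrow> Xs j \<in> \<I>" and fin: "finite \<I>"
  shows "\<exists>p\<in>distributions \<I>. (\<forall>X. pmf p X = (\<Sum>j<T. if Xs j = X then 1 / real T else 0)) \<and>
    (\<forall>h. (\<Sum>X\<in>\<I>. pmf p X * h X) = (\<Sum>j<T. h (Xs j)) / real T)"
proof -
  define p where "p = map_pmf Xs (pmf_of_set {..<T})"
  have ne: "{..<T} \<noteq> {}" using T by auto
  have p: "p \<in> distributions \<I>"
    using Xs ne by (auto simp: distributions_def p_def set_pmf_of_set)
  have pmf: "pmf p X = (\<Sum>j<T. if Xs j = X then 1 / real T else 0)" for X
  proof -
    have "pmf p X = measure (measure_pmf (pmf_of_set {..<T})) (Xs -` {X})"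
      by (simp add: p_def pmf_map)
    also have "\<dots> = real (card ({..<T} \<inter> Xs -` {X})) / real T"
      using ne by (subst measure_pmf_of_set) auto
    also have "\<dots> = (\<Sum>j<T. if Xs j = X then 1 / real T else 0)"
      by (simp add: sum.If_cases Int_def vimage_def)
    finally show ?thesis .
  qed
  have "(\<Sum>X\<in>\<I>. pmf p X * h X) = (\<Sum>j<T. h (Xs j)) / real T" for h
  proof -
    have "(\<Sum>X\<in>\<I>. pmf p X * h X) = (\<Sum>X\<in>\<I>. \<Sum>j<T. if Xs j = X then h X / real T else 0)"
      unfolding pmf sum_distrib_right by (intro sum.cong refl) auto
    also have "\<dots> = (\<Sum>j<T. \<Sum>X\<in>\<I>. if Xs j = X then h X / real T else 0)"
      by (rule sum.swap)
    also have "\<dots> = (\<Sum>j<T. h (Xs j) / real T)"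
      using Xs fin by (intro sum.cong refl) (simp add: sum.delta)
    finally show ?thesis by (simp add: sum_divide_distrib)
  qed
  with p pmf show ?thesis by blast
qed

lemma distributions_sum_1: "finite \<I> \<Longrightarrow> p \<in> distributions \<I> \<Longrightarrow> (\<Sum>X\<in>\<I>. pmf p X) = 1"
  by (simp add: distributions_def sum_pmf_eq_1)

lemma optimal_distribution:
  assumes "finite \<I>" "\<I> \<noteq> {}" "1 \<le> n"
  obtains p where "p \<in> distributions \<I>" "\<And>k. k < n \<Longrightarrow> nu_star n f \<I> \<le> (\<Sum>X\<in>\<I>. pmf p X * f k X)"
proof -
  obtain p where p: "p \<in> distributions \<I>" "robust_value n f \<I> p = nu_star n f \<I>"
    using nu_star_max[OF assms] by blast
  have "nu_star n f \<I> \<le> (\<Sum>X\<in>\<I>. pmf p X * f k X)" if "k < n" for k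
    unfolding p(2)[symmetric] robust_value_def using that by (intro Min_le) auto
  with p that show thesis by blast
qed

lemma nu_star_ge:
  assumes I: "finite \<I>" and n: "1 \<le> n" and p: "p \<in> distributions \<I>"
    and ge: "\<And>k. k < n \<Longrightarrow> v \<le> (\<Sum>X\<in>\<I>. pmf p X * f k X)"
  shows "v \<le> nu_star n f \<I>"
proof -
  have "\<I> \<noteq> {}" using p set_pmf_not_empty[of p] by (auto simp: distributions_def)
  then have "robust_value n f \<I> p \<le> nu_star n f \<I>" using nu_star_max[OF I _ n] p by blast
  moreover have "v \<le> robust_value n f \<I> p"
    unfolding robust_value_def using n ge by (subst Min_ge_iff) (auto simp: lessThan_empty_iff)
  ultimately show ?thesis by simp
qed

lemma nu_star_nonneg:
  assumes I: "finite \<I>" "\<I> \<noteq> {}" and n: "1 \<le> n" and f: "\<And>k X. k < n \<Longrightarrow> X \<in> \<I> \<Longrightarrow> 0 \<le> f k X"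
  shows "0 \<le> nu_star n f \<I>"
proof -
  obtain X where "X \<in> \<I>" using I by blast
  then have "return_pmf X \<in> distributions \<I>" by (simp add: distributions_def)
  then show ?thesis using f by (intro nu_star_ge[OF I(1) n]) (auto intro!: sum_nonneg)
qed

lemma nu_star_le:
  assumes I: "finite \<I>" "\<I> \<noteq> {}" and n: "1 \<le> n" and k: "k < n" and v: "\<And>X. X \<in> \<I> \<Longrightarrow> f k X \<le> v"
  shows "nu_star n f \<I> \<le> v"
proof -
  obtain p where p: "p \<in> distributions \<I>" "nu_star n f \<I> \<le> (\<Sum>X\<in>\<I>. pmf p X * f k X)"
    using optimal_distribution[OF I n] k by metis
  note p(2)
  also have "(\<Sum>X\<in>\<I>. pmf p X * f k X) \<le> (\<Sum>X\<in>\<I>. pmf p X * v)"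
    using v by (intro sum_mono mult_left_mono) auto
  also have "\<dots> = v" using distributions_sum_1[OF I(1) p(1)] by (simp add: sum_distrib_right[symmetric])
  finally show ?thesis .
qed

text \<open>By subadditivity the one objective \<open>k\<close> is at most \<open>card E\<close>
  times \<open>a\<close> on every feasible set; downward closure makes the singletons of such a set
  feasible.\<close>

lemma nu_star_le_singletons:
  assumes fin: "finite E" and I: "\<I> \<subseteq> Pow E" "\<I> \<noteq> {}" and down: "\<And>X Y. X \<in> \<I> \<Longrightarrow> Y \<subseteq> X \<Longrightarrow> Y \<in> \<I>"
    and n: "1 \<le> n" and k: "k < n" and f: "objective E (f k)" and a: "0 \<le> a" "\<And>e. {e} \<in> \<I> \<Longrightarrow> f k {e} \<le> a"
  shows "nu_star n f \<I> \<le> real (card E) * a"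
proof (rule nu_star_le[OF finite_subset[OF I(1)] I(2) n k])
  fix X assume X: "X \<in> \<I>"
  then have XE: "X \<subseteq> E" using I by auto
  then have finX: "finite X" using fin finite_subset by blast
  have "f k X - f k {} \<le> (\<Sum>e\<in>X. f k {e} - f k {})"
    using objective_union_le_sum[OF f finX XE, of "{}"] by simp
  also have "\<dots> \<le> (\<Sum>e\<in>X. a)"
    using a(2) down[OF X] objective_empty[OF f] by (intro sum_mono) auto
  also have "\<dots> \<le> real (card E) * a"
    using a card_mono[OF fin XE] by (simp add: mult_right_mono)
  finally show "f k X \<le> real (card E) * a" using objective_empty[OF f] by simp
qed (use fin in auto)

text \<open>The uniform mixture of one witness per objective gives each objective a 1/n share of at
  least \<open>a\<close>, all other shares being nonnegative.\<close>

lemma nu_star_ge_individual: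
  assumes fin: "finite \<I>" and n: "1 \<le> n" and f: "\<And>k X. k < n \<Longrightarrow> X \<in> \<I> \<Longrightarrow> 0 \<le> f k X"
    and a: "\<And>k. k < n \<Longrightarrow> \<exists>X\<in>\<I>. a \<le> f k X"
  shows "a / real n \<le> nu_star n f \<I>"
proof -
  obtain Xs where Xs: "\<And>k. k < n \<Longrightarrow> Xs k \<in> \<I> \<and> a \<le> f k (Xs k)" using a by metis
  obtain p where p: "p \<in> distributions \<I>" "\<And>h. (\<Sum>X\<in>\<I>. pmf p X * h X) = (\<Sum>j<n. h (Xs j)) / real n"
    using uniform_distribution[of n Xs \<I>] n Xs fin by (metis less_le_trans zero_less_one)
  show ?thesis
  proof (rule nu_star_ge[OF fin n p(1)])
    fix k assume k: "k < n"
    have "a \<le> f k (Xs k)" using Xs k by blast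
    also have "\<dots> \<le> (\<Sum>j<n. f k (Xs j))" using Xs f k by (intro member_le_sum) auto
    finally show "a / real n \<le> (\<Sum>X\<in>\<I>. pmf p X * f k X)"
      unfolding p(2) by (intro divide_right_mono) auto
  qed
qed

text \<open>
  Truncation at \<open>B\<close> costs only a factor \<open>1 - \<delta>\<close>: the comparator mixes the optimal distribution
  with a small multiple of sets at which the truncated objectives attain \<open>B\<close>.
\<close>

lemma truncated_weighted_max_ge:
  assumes I: "finite \<I>" "{} \<in> \<I>" and n: "1 \<le> n"
    and f: "\<And>k X. k < n \<Longrightarrow> X \<in> \<I> \<Longrightarrow> 0 \<le> f k X"
    and \<delta>: "0 < \<delta>" "\<delta> \<le> 1" and B: "0 \<le> B" "real n * nu_star n f \<I> \<le> \<delta> * B"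
    and w: "\<And>k. k < n \<Longrightarrow> 0 \<le> w k"
    and V: "\<And>X. X \<in> \<I> \<Longrightarrow> (\<Sum>k<n. w k * min (f k X) B) \<le> V"
  shows "sum w {..<n} * ((1 - \<delta>) * nu_star n f \<I>) \<le> V"
proof -
  let ?\<nu> = "nu_star n f \<I>"
  let ?g = "\<lambda>k X. min (f k X) B"
  have ne: "\<I> \<noteq> {}" using I by blast
  obtain p where p: "p \<in> distributions \<I>" "\<And>k. k < n \<Longrightarrow> ?\<nu> \<le> (\<Sum>X\<in>\<I>. pmf p X * f k X)"
    using optimal_distribution[OF I(1) ne n] by metis
  \<comment> \<open>For each objective either truncation never acts, and any set may serve as
    witness, or some feasible set reaches the cap.\<close>
  have "\<exists>X\<in>\<I>. (\<forall>Y\<in>\<I>. f k Y \<le> B) \<or> B \<le> f k X" for k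
    using I(2) by (meson linear)
  then obtain Xs where Xs: "\<And>k. Xs k \<in> \<I>" "\<And>k. (\<forall>Y\<in>\<I>. f k Y \<le> B) \<or> B \<le> f k (Xs k)" by metis
  have gnn: "0 \<le> ?g k X" if "k < n" "X \<in> \<I>" for k X using f[OF that] B by simp
  have nu0: "0 \<le> ?\<nu>" by (rule nu_star_nonneg[OF I(1) ne n f])
  have comp: "(1 - \<delta>) * ?\<nu> \<le> (1 - \<delta>) * (\<Sum>X\<in>\<I>. pmf p X * ?g k X) + \<delta> / real n * (\<Sum>j<n. ?g k (Xs j))"
    if k: "k < n" for k
  proof (cases "\<forall>Y\<in>\<I>. f k Y \<le> B")
    case True
    then have "(\<Sum>X\<in>\<I>. pmf p X * ?g k X) = (\<Sum>X\<in>\<I>. pmf p X * f k X)"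
      by (intro sum.cong refl) simp
    moreover have "0 \<le> (\<Sum>j<n. ?g k (Xs j))" using gnn[OF k] Xs by (intro sum_nonneg) auto
    moreover have "(1 - \<delta>) * ?\<nu> \<le> (1 - \<delta>) * (\<Sum>X\<in>\<I>. pmf p X * f k X)"
      using p(2)[OF k] \<delta> by (intro mult_left_mono) auto
    ultimately show ?thesis using \<delta> by (simp add: add_increasing2)
  next
    case False
    then have "B = ?g k (Xs k)" using Xs(2)[of k] by (metis min.absorb2)
    also have "\<dots> \<le> (\<Sum>j<n. ?g k (Xs j))" using gnn[OF k] Xs k by (intro member_le_sum) auto
    finally have "\<delta> / real n * B \<le> \<delta> / real n * (\<Sum>j<n. ?g k (Xs j))" using \<delta> by (intro mult_left_mono) auto
    \<comment> \<open>Here the size of \<open>B\<close> enters: a share \<delta> / n of one set at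
      the cap is already worth the optimum, however much truncation takes from the optimal
      distribution.\<close>
    moreover have "?\<nu> \<le> \<delta> / real n * B" using B n by (simp add: field_simps)
    moreover have "0 \<le> (1 - \<delta>) * (\<Sum>X\<in>\<I>. pmf p X * ?g k X)"
      using gnn[OF k] \<delta> by (intro mult_nonneg_nonneg sum_nonneg) auto
    moreover have "(1 - \<delta>) * ?\<nu> \<le> ?\<nu>" using \<delta> nu0 by (simp add: algebra_simps)
    ultimately show ?thesis by linarith
  qed
  let ?G = "\<lambda>X. \<Sum>k<n. w k * ?g k X"
  have "sum w {..<n} * ((1 - \<delta>) * ?\<nu>) = (\<Sum>k<n. w k * ((1 - \<delta>) * ?\<nu>))" by (simp add: sum_distrib_right)
  also have "\<dots> \<le> (\<Sum>k<n. w k * ((1 - \<delta>) * (\<Sum>X\<in>\<I>. pmf p X * ?g k X) + \<delta> / real n * (\<Sum>j<n. ?g k (Xs j))))"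
    using w comp by (intro sum_mono mult_left_mono) auto
  also have "\<dots> = (1 - \<delta>) * (\<Sum>k<n. \<Sum>X\<in>\<I>. pmf p X * (w k * ?g k X)) + \<delta> / real n * (\<Sum>k<n. \<Sum>j<n. w k * ?g k (Xs j))"
    by (simp add: distrib_left sum.distrib sum_distrib_left mult_ac)
  also have "(\<Sum>k<n. \<Sum>X\<in>\<I>. pmf p X * (w k * ?g k X)) = (\<Sum>X\<in>\<I>. pmf p X * ?G X)"
    by (subst sum.swap) (simp add: sum_distrib_left)
  also have "(\<Sum>k<n. \<Sum>j<n. w k * ?g k (Xs j)) = (\<Sum>j<n. ?G (Xs j))"
    by (rule sum.swap)
  also have "(1 - \<delta>) * (\<Sum>X\<in>\<I>. pmf p X * ?G X) + \<delta> / real n * (\<Sum>j<n. ?G (Xs j))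
      \<le> (1 - \<delta>) * (\<Sum>X\<in>\<I>. pmf p X * V) + \<delta> / real n * (\<Sum>j<n. V)"
    using \<delta> V Xs by (intro add_mono mult_left_mono sum_mono) auto
  also have "(\<Sum>X\<in>\<I>. pmf p X * V) = V"
    using distributions_sum_1[OF I(1) p(1)] by (simp add: sum_distrib_right[symmetric])
  also have "(1 - \<delta>) * V + \<delta> / real n * (\<Sum>j<n. V) = V" using n by (simp add: algebra_simps)
  finally show ?thesis .
qed


section \<open>Reasoning about programs\<close>

text \<open>Time is dropped so that correctness reduces to rewriting along halting runs;
  \<open>polytime\<close> supplies halting and the time bound.\<close>

definition reaches :: "nat \<Rightarrow> (nat \<Rightarrow> nat set \<Rightarrow> real) \<Rightarrow> nat set set \<Rightarrow> com \<Rightarrow> state \<Rightarrow> state \<Rightarrow> bool" where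
  "reaches m f J c \<sigma> \<tau> \<longleftrightarrow> (\<exists>t. exec m f J c \<sigma> t \<tau>)"

lemma nmem_nstore: "nmem (nstore x i v \<sigma>) y j = (if y = x \<and> j = i then v else nmem \<sigma> y j)"
  and rmem_nstore: "rmem (nstore x i v \<sigma>) = rmem \<sigma>"
  and nmem_rstore: "nmem (rstore x i r \<sigma>) = nmem \<sigma>"
  and rmem_rstore: "rmem (rstore x i r \<sigma>) y j = (if y = x \<and> j = i then r else rmem \<sigma> y j)"
  by (auto simp: nstore_def rstore_def)

lemmas mem_simps [simp] = nmem_nstore rmem_nstore nmem_rstore rmem_rstore

inductive_cases exec_SkipE: "exec m f J Skip \<sigma> t \<tau>"
inductive_cases exec_NAssignE: "exec m f J (NAssign x i a) \<sigma> t \<tau>"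
inductive_cases exec_RAssignE: "exec m f J (RAssign x i a) \<sigma> t \<tau>"
inductive_cases exec_ValueE: "exec m f J (Value x i k S) \<sigma> t \<tau>"
inductive_cases exec_CondE: "exec m f J (Cond b c d) \<sigma> t \<tau>"

lemma reaches_Skip: "reaches m f J Skip \<sigma> \<tau> \<longleftrightarrow> \<tau> = \<sigma>"
  unfolding reaches_def by (metis exec_SkipE exec_Skip)

lemma reaches_NAssign: "reaches m f J (NAssign x i a) \<sigma> \<tau> \<longleftrightarrow> \<tau> = nstore x (nval i \<sigma>) (nval a \<sigma>) \<sigma>"
  unfolding reaches_def by (metis exec_NAssignE exec_NAssign)

lemma reaches_RAssign: "reaches m f J (RAssign x i r) \<sigma> \<tau> \<longleftrightarrow> \<tau> = rstore x (nval i \<sigma>) (rval r \<sigma>) \<sigma>"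
  unfolding reaches_def by (metis exec_RAssignE exec_RAssign)

lemma reaches_Value:
  "reaches m f J (Value x i k S) \<sigma> \<tau> \<longleftrightarrow> \<tau> = rstore x (nval i \<sigma>) (f (nval k \<sigma>) (stored_set m S 0 \<sigma>)) \<sigma>"
  unfolding reaches_def by (metis exec_ValueE exec_Value)

lemma reaches_Indep:
  "reaches m f J (Indep x i S) \<sigma> \<tau> \<longleftrightarrow>
     \<tau> = nstore x (nval i \<sigma>) (if stored_set m S 0 \<sigma> \<in> J then 1 else 0) \<sigma>"
  (is "_ \<longleftrightarrow> \<tau> = ?\<tau>")
proof
  assume "reaches m f J (Indep x i S) \<sigma> \<tau>"
  then obtain t where "exec m f J (Indep x i S) \<sigma> t \<tau>" unfolding reaches_def by blast
  from exec_deterministic[OF this exec_Indep] show "\<tau> = ?\<tau>" by simp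
next
  assume "\<tau> = ?\<tau>"
  then show "reaches m f J (Indep x i S) \<sigma> \<tau>" unfolding reaches_def using exec_Indep by blast
qed

lemma reaches_Seq: "reaches m f J (Seq c d) \<sigma> \<tau> \<longleftrightarrow> (\<exists>\<rho>. reaches m f J c \<sigma> \<rho> \<and> reaches m f J d \<rho> \<tau>)"
  unfolding reaches_def by (metis exec_SeqE exec_Seq)

lemma reaches_Cond:
  "reaches m f J (Cond b c d) \<sigma> \<tau> \<longleftrightarrow> (if bval b \<sigma> then reaches m f J c \<sigma> \<tau> else reaches m f J d \<sigma> \<tau>)"
  unfolding reaches_def by (metis exec_CondE exec_CondTrue exec_CondFalse)

lemmas reaches_simps [simp] = reaches_Skip reaches_NAssign reaches_RAssign reaches_Value reaches_Indep reaches_Seq reaches_Cond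

fun modN :: "com \<Rightarrow> string set" where
  "modN (NAssign x i a) = {x}"
| "modN (Indep x i S) = {x}"
| "modN (Seq c d) = modN c \<union> modN d"
| "modN (Cond b c d) = modN c \<union> modN d"
| "modN (While b c) = modN c"
| "modN _ = {}"

fun modR :: "com \<Rightarrow> string set" where
  "modR (RAssign x i a) = {x}"
| "modR (Value x i k S) = {x}"
| "modR (Seq c d) = modR c \<union> modR d"
| "modR (Cond b c d) = modR c \<union> modR d"
| "modR (While b c) = modR c"
| "modR _ = {}"

definition agree :: "string set \<Rightarrow> string set \<Rightarrow> state \<Rightarrow> state \<Rightarrow> bool" where
  "agree VN VR \<sigma> \<tau> \<longleftrightarrow> (\<forall>x. x \<notin> VN \<longrightarrow> nmem \<tau> x = nmem \<sigma> x) \<and> (\<forall>x. x \<notin> VR \<longrightarrow> rmem \<tau> x = rmem \<sigma> x)"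

lemma agreeD:
  assumes "agree VN VR \<sigma> \<tau>"
  shows agree_nmem: "x \<notin> VN \<Longrightarrow> nmem \<tau> x = nmem \<sigma> x" and agree_rmem: "x \<notin> VR \<Longrightarrow> rmem \<tau> x = rmem \<sigma> x"
  using assms by (auto simp: agree_def)

lemma agree_refl [simp]: "agree VN VR \<sigma> \<sigma>"
  by (simp add: agree_def)

lemma exec_agree: "exec m f J c \<sigma> t \<tau> \<Longrightarrow> agree (modN c) (modR c) \<sigma> \<tau>"
  by (induction rule: exec.induct) (auto simp: agree_def nstore_def rstore_def)

lemma reaches_agree: "reaches m f J c \<sigma> \<tau> \<Longrightarrow> agree (modN c) (modR c) \<sigma> \<tau>"
  by (auto simp: reaches_def intro: exec_agree)

lemma reaches_frame:
  assumes "reaches m f J c \<sigma> \<tau>"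
  shows reaches_nmem: "x \<notin> modN c \<Longrightarrow> nmem \<tau> x = nmem \<sigma> x" and reaches_rmem: "x \<notin> modR c \<Longrightarrow> rmem \<tau> x = rmem \<sigma> x"
  using agreeD[OF reaches_agree[OF assms]] by auto

abbreviation nv :: "string \<Rightarrow> nexp" where "nv x \<equiv> NGet x (NConst 0)"
abbreviation rv :: "string \<Rightarrow> rexp" where "rv x \<equiv> RGet x (NConst 0)"
abbreviation nset :: "string \<Rightarrow> nexp \<Rightarrow> com" where "nset x a \<equiv> NAssign x (NConst 0) a"
abbreviation rset :: "string \<Rightarrow> rexp \<Rightarrow> com" where "rset x a \<equiv> RAssign x (NConst 0) a"

text \<open>The guard is an arbitrary test rather than a natural number as bound, because some
  bounds can only be written as real expressions.\<close>

definition For :: "string \<Rightarrow> bexp \<Rightarrow> com \<Rightarrow> com" where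
  "For i b c = Seq (nset i (NConst 0)) (While b (Seq c (nset i (NAdd (nv i) (NConst 1)))))"

lemma modN_For [simp]: "modN (For i b c) = insert i (modN c)"
  and modR_For [simp]: "modR (For i b c) = modR c"
  by (auto simp: For_def)

lemma While_inv:
  assumes "exec m f J (While b c) \<sigma> t \<tau>" "P \<sigma>"
    and "\<And>\<rho> \<rho>' u. P \<rho> \<Longrightarrow> bval b \<rho> \<Longrightarrow> exec m f J c \<rho> u \<rho>' \<Longrightarrow> P \<rho>'"
  shows "P \<tau> \<and> \<not> bval b \<tau>"
  using assms(1,2)
proof (induction "While b c" \<sigma> t \<tau> rule: exec.induct)
  case exec_WhileTrue
  then show ?case using assms(3) by blast
qed auto

text \<open>The guard has to mean a counter below \<open>L\<close> only in states that differ from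
  the initial one in arrays the loop may change, so it may refer to anything the body leaves alone.
  \<open>P\<close> must not depend on the counter array at cell 0, which is overwritten between
  iterations.\<close>

lemma For_inv:
  assumes ex: "reaches m f J (For i b c) \<sigma> \<tau>" and i: "i \<notin> modN c"
    and guard: "\<And>\<rho>. agree (insert i (modN c)) (modR c) \<sigma> \<rho> \<Longrightarrow> bval b \<rho> \<longleftrightarrow> nmem \<rho> i 0 < L"
    and start: "P 0 \<sigma>" and indep: "\<And>j \<rho> v. P j \<rho> \<Longrightarrow> P j (nstore i 0 v \<rho>)"
    and step: "\<And>j \<rho> \<rho>'. j < L \<Longrightarrow> nmem \<rho> i 0 = j \<Longrightarrow> P j \<rho> \<Longrightarrow>
       agree (insert i (modN c)) (modR c) \<sigma> \<rho> \<Longrightarrow> reaches m f J c \<rho> \<rho>' \<Longrightarrow> P (Suc j) \<rho>'"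
  shows "P L \<tau>" and "nmem \<tau> i 0 = L"
proof -
  let ?P = "\<lambda>\<rho>. agree (insert i (modN c)) (modR c) \<sigma> \<rho> \<and> nmem \<rho> i 0 \<le> L \<and> P (nmem \<rho> i 0) \<rho>"
  let ?c = "Seq c (nset i (NAdd (nv i) (NConst 1)))"
  from ex obtain t where t: "exec m f J (While b ?c) (nstore i 0 0 \<sigma>) t \<tau>"
    by (auto simp: For_def reaches_def elim!: exec_SeqE exec_NAssignE)
  have "?P \<tau> \<and> \<not> bval b \<tau>"
  proof (rule While_inv[OF t])
    show "?P (nstore i 0 0 \<sigma>)" using start indep by (auto simp: agree_def)
  next
    fix \<rho> \<rho>' u
    assume P: "?P \<rho>" and b: "bval b \<rho>" and e: "exec m f J ?c \<rho> u \<rho>'"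
    have lt: "nmem \<rho> i 0 < L" using guard[of \<rho>] P b by simp
    from e have "reaches m f J ?c \<rho> \<rho>'" by (auto simp: reaches_def)
    then obtain \<rho>1 where \<rho>1: "reaches m f J c \<rho> \<rho>1" "\<rho>' = nstore i 0 (nmem \<rho>1 i 0 + 1) \<rho>1" by auto
    have "nmem \<rho>1 i 0 = nmem \<rho> i 0" using reaches_nmem[OF \<rho>1(1) i] by simp
    moreover have "P (Suc (nmem \<rho> i 0)) \<rho>1" using step[OF lt refl _ _ \<rho>1(1)] P by simp
    moreover have "agree (insert i (modN c)) (modR c) \<sigma> \<rho>1"
      using P reaches_agree[OF \<rho>1(1)] by (auto simp: agree_def)
    ultimately show "?P \<rho>'" using indep lt \<rho>1(2) by (auto simp: agree_def)
  qed
  with guard[of \<tau>] have "nmem \<tau> i 0 = L" and "?P \<tau>" by auto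
  then show "P L \<tau>" "nmem \<tau> i 0 = L" by auto
qed


section \<open>Polynomial running time\<close>

definition sizes :: "nat \<Rightarrow> nat \<Rightarrow> state \<Rightarrow> bool" where
  "sizes m n \<sigma> \<longleftrightarrow> nmem \<sigma> ''m'' 0 = m \<and> nmem \<sigma> ''n'' 0 = n"

definition poly_bounded :: "(nat \<Rightarrow> nat \<Rightarrow> nat) \<Rightarrow> bool" where
  "poly_bounded h \<longleftrightarrow> (\<exists>q :: nat poly. \<forall>m n. h m n \<le> poly q (m + n))"

text \<open>The bound holds from every state of the given sizes and for all oracles, whatever else
  is in memory, and the sizes survive the run. This makes the property compositional, with no
  invariants in the time analysis.\<close>

definition polytime :: "com \<Rightarrow> bool" where
  "polytime c \<longleftrightarrow> ''m'' \<notin> modN c \<and> ''n'' \<notin> modN c \<and>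
     (\<exists>h. poly_bounded h \<and> (\<forall>m n f J \<sigma>. sizes m n \<sigma> \<longrightarrow> (\<exists>t \<tau>. exec m f J c \<sigma> t \<tau> \<and> t \<le> h m n)))"

lemma polytimeI:
  assumes "''m'' \<notin> modN c" "''n'' \<notin> modN c" "poly_bounded h"
    "\<And>m n f J \<sigma>. sizes m n \<sigma> \<Longrightarrow> \<exists>t \<tau>. exec m f J c \<sigma> t \<tau> \<and> t \<le> h m n"
  shows "polytime c"
  using assms unfolding polytime_def by blast

lemma polytimeD:
  assumes "polytime c"
  shows polytime_m: "''m'' \<notin> modN c" and polytime_n: "''n'' \<notin> modN c"
  using assms by (auto simp: polytime_def)

lemma poly_bounded_const: "poly_bounded (\<lambda>m n. a)"
  unfolding poly_bounded_def by (rule exI[of _ "[:a:]"]) simp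

lemma poly_bounded_m: "poly_bounded (\<lambda>m n. m)"
  and poly_bounded_n: "poly_bounded (\<lambda>m n. n)"
  unfolding poly_bounded_def by (rule exI[of _ "[:0, 1:]"]; simp)+

lemma poly_bounded_add: "poly_bounded h \<Longrightarrow> poly_bounded k \<Longrightarrow> poly_bounded (\<lambda>m n. h m n + k m n)"
  unfolding poly_bounded_def by (metis add_mono poly_add)

lemma poly_bounded_mult: "poly_bounded h \<Longrightarrow> poly_bounded k \<Longrightarrow> poly_bounded (\<lambda>m n. h m n * k m n)"
  unfolding poly_bounded_def by (metis mult_le_mono poly_mult)

lemmas poly_bounded_intros =
  poly_bounded_const poly_bounded_m poly_bounded_n poly_bounded_add poly_bounded_mult

lemma polytime_one:
  assumes "''m'' \<notin> modN c" "''n'' \<notin> modN c" "\<And>m f J \<sigma>. \<exists>\<tau>. exec m f J c \<sigma> 1 \<tau>"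
  shows "polytime c"
  using assms by (intro polytimeI[OF _ _ poly_bounded_const[of 1]]) blast+

lemma polytime_Skip: "polytime Skip"
  by (rule polytime_one) (simp, simp, rule exI, rule exec_Skip)

lemma polytime_NAssign: "x \<noteq> ''m'' \<Longrightarrow> x \<noteq> ''n'' \<Longrightarrow> polytime (NAssign x i a)"
  by (rule polytime_one) (simp, simp, rule exI, rule exec_NAssign)

lemma polytime_RAssign: "polytime (RAssign x i r)"
  by (rule polytime_one) (simp, simp, rule exI, rule exec_RAssign)

lemma polytime_Value: "polytime (Value x i k S)"
  by (rule polytime_one) (simp, simp, rule exI, rule exec_Value)

lemma polytime_Indep: "x \<noteq> ''m'' \<Longrightarrow> x \<noteq> ''n'' \<Longrightarrow> polytime (Indep x i S)"
  by (rule polytime_one) (simp, simp, rule exI, rule exec_Indep)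

lemma exec_sizes:
  assumes "exec m f J c \<sigma> t \<tau>" "polytime c" "sizes m n \<sigma>"
  shows "sizes m n \<tau>"
  using exec_agree[OF assms(1)] assms(2,3) by (simp add: sizes_def polytime_def agree_def)

lemma polytime_Seq:
  assumes c: "polytime c" and d: "polytime d"
  shows "polytime (Seq c d)"
proof -
  from c obtain h where h: "poly_bounded h"
    "\<And>m n f J \<sigma>. sizes m n \<sigma> \<Longrightarrow> \<exists>t \<tau>. exec m f J c \<sigma> t \<tau> \<and> t \<le> h m n" unfolding polytime_def by blast
  from d obtain k where k: "poly_bounded k"
    "\<And>m n f J \<sigma>. sizes m n \<sigma> \<Longrightarrow> \<exists>t \<tau>. exec m f J d \<sigma> t \<tau> \<and> t \<le> k m n" unfolding polytime_def by blast
  have "\<exists>t \<tau>. exec m f J (Seq c d) \<sigma> t \<tau> \<and> t \<le> h m n + k m n" if "sizes m n \<sigma>" for m n f J \<sigma>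
    using h(2)[OF that, of f J] k(2)[OF exec_sizes[OF _ c that]] by (meson add_mono exec_Seq)
  moreover have "poly_bounded (\<lambda>m n. h m n + k m n)" by (intro poly_bounded_intros h k)
  ultimately show ?thesis using polytimeD[OF c] polytimeD[OF d] by (intro polytimeI) auto
qed

lemma polytime_Cond:
  assumes c: "polytime c" and d: "polytime d"
  shows "polytime (Cond b c d)"
proof -
  from c obtain h where h: "poly_bounded h"
    "\<And>m n f J \<sigma>. sizes m n \<sigma> \<Longrightarrow> \<exists>t \<tau>. exec m f J c \<sigma> t \<tau> \<and> t \<le> h m n" unfolding polytime_def by blast
  from d obtain k where k: "poly_bounded k"
    "\<And>m n f J \<sigma>. sizes m n \<sigma> \<Longrightarrow> \<exists>t \<tau>. exec m f J d \<sigma> t \<tau> \<and> t \<le> k m n" unfolding polytime_def by blast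
  have "\<exists>t \<tau>. exec m f J (Cond b c d) \<sigma> t \<tau> \<and> t \<le> h m n + k m n + 1" if "sizes m n \<sigma>" for m n f J \<sigma>
  proof (cases "bval b \<sigma>")
    case True
    then show ?thesis using h(2)[OF that, of f J] by (fastforce intro: exec_CondTrue)
  next
    case False
    then show ?thesis using k(2)[OF that, of f J] by (fastforce intro: exec_CondFalse)
  qed
  moreover have "poly_bounded (\<lambda>m n. h m n + k m n + 1)"
    by (intro poly_bounded_intros h k)
  ultimately show ?thesis using polytimeD[OF c] polytimeD[OF d] by (intro polytimeI) auto
qed

text \<open>Induction on the iterations left; each costs the body and two more units, for the
  increment and the test.\<close>

lemma polytime_For:
  assumes c: "polytime c" and i: "i \<notin> modN c" "i \<noteq> ''m''" "i \<noteq> ''n''" and L: "poly_bounded L"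
    and guard: "\<And>m n \<sigma>. sizes m n \<sigma> \<Longrightarrow> bval b \<sigma> \<Longrightarrow> nmem \<sigma> i 0 < L m n"
  shows "polytime (For i b c)"
proof -
  from c obtain h where h: "poly_bounded h"
    "\<And>m n f J \<sigma>. sizes m n \<sigma> \<Longrightarrow> \<exists>t \<tau>. exec m f J c \<sigma> t \<tau> \<and> t \<le> h m n" unfolding polytime_def by blast
  let ?c = "Seq c (nset i (NAdd (nv i) (NConst 1)))"
  have loop: "\<exists>t \<tau>. exec m f J (While b ?c) \<sigma> t \<tau> \<and> t \<le> (L m n - nmem \<sigma> i 0) * (h m n + 2) + 1"
    if "sizes m n \<sigma>" for m n f J \<sigma>
    using that
  proof (induction "L m n - nmem \<sigma> i 0" arbitrary: \<sigma> rule: less_induct)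
    case less
    show ?case
    proof (cases "bval b \<sigma>")
      case True
      then have lt: "nmem \<sigma> i 0 < L m n" using guard less.prems by blast
      obtain t \<rho> where t: "exec m f J c \<sigma> t \<rho>" "t \<le> h m n" using h(2)[OF less.prems] by blast
      let ?\<rho> = "nstore i 0 (nmem \<rho> i 0 + 1) \<rho>"
      have eq: "nmem \<rho> i 0 = nmem \<sigma> i 0" using exec_agree[OF t(1)] i by (simp add: agree_def)
      have "sizes m n ?\<rho>" using exec_sizes[OF t(1) c less.prems] i by (simp add: sizes_def)
      moreover have "L m n - nmem ?\<rho> i 0 < L m n - nmem \<sigma> i 0" using lt eq by simp
      ultimately obtain u \<tau> where u: "exec m f J (While b ?c) ?\<rho> u \<tau>"
          "u \<le> (L m n - nmem ?\<rho> i 0) * (h m n + 2) + 1"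
        using less.hyps by blast
      have "exec m f J ?c \<sigma> (t + 1) ?\<rho>"
        using exec_Seq[OF t(1) exec_NAssign[of m f J i "NConst 0" "NAdd (nv i) (NConst 1)"]] by simp
      from exec_WhileTrue[OF True this u(1)]
      have "exec m f J (While b ?c) \<sigma> (t + 1 + u + 1) \<tau>" .
      moreover have "L m n - nmem \<sigma> i 0 = Suc (L m n - nmem ?\<rho> i 0)" using lt eq by simp
      then have "t + 1 + u + 1 \<le> (L m n - nmem \<sigma> i 0) * (h m n + 2) + 1"
        using t(2) u(2) by simp
      ultimately show ?thesis by blast
    next
      case False
      then show ?thesis by (fastforce intro: exec_WhileFalse)
    qed
  qed
  have "\<exists>t \<tau>. exec m f J (For i b c) \<sigma> t \<tau> \<and> t \<le> L m n * (h m n + 2) + 2" if s: "sizes m n \<sigma>" for m n f J \<sigma>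
  proof -
    have "sizes m n (nstore i 0 0 \<sigma>)" using s i by (simp add: sizes_def)
    from loop[OF this, of f J] obtain t \<tau> where t: "exec m f J (While b ?c) (nstore i 0 0 \<sigma>) t \<tau>"
      "t \<le> L m n * (h m n + 2) + 1" by auto
    have "exec m f J (For i b c) \<sigma> (1 + t) \<tau>"
      unfolding For_def using exec_NAssign[of m f J i "NConst 0" "NConst 0" \<sigma>] t(1)
      by (intro exec_Seq) simp_all
    with t(2) show ?thesis by fastforce
  qed
  moreover have "poly_bounded (\<lambda>m n. L m n * (h m n + 2) + 2)"
    by (intro poly_bounded_intros h L)
  ultimately show ?thesis using polytimeD[OF c] i by (intro polytimeI) auto
qed


section \<open>Basic subroutines\<close>

lemma mem_store_other [simp]:
  "y \<noteq> x \<Longrightarrow> nmem (nstore x i v \<sigma>) y = nmem \<sigma> y"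
  "x \<noteq> y \<Longrightarrow> nmem (nstore x i v \<sigma>) y = nmem \<sigma> y"
  "y \<noteq> x \<Longrightarrow> rmem (rstore x i r \<sigma>) y = rmem \<sigma> y"
  "x \<noteq> y \<Longrightarrow> rmem (rstore x i r \<sigma>) y = rmem \<sigma> y"
  by auto

definition ForM :: "string \<Rightarrow> com \<Rightarrow> com" where
  "ForM i c = For i (NLess (nv i) (nv ''m'')) c"

definition ForN :: "string \<Rightarrow> com \<Rightarrow> com" where
  "ForN i c = For i (NLess (nv i) (nv ''n'')) c"

lemma mod_ForM [simp]: "modN (ForM i c) = insert i (modN c)" "modR (ForM i c) = modR c"
  and mod_ForN [simp]: "modN (ForN i c) = insert i (modN c)" "modR (ForN i c) = modR c"
  by (auto simp: ForM_def ForN_def)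

lemma ForM_inv:
  assumes ex: "reaches m f J (ForM i c) \<sigma> \<tau>" and s: "sizes m n \<sigma>" and i: "i \<notin> modN c" "i \<noteq> ''m''" "''m'' \<notin> modN c"
    and "P 0 \<sigma>" "\<And>j \<rho> v. P j \<rho> \<Longrightarrow> P j (nstore i 0 v \<rho>)"
    and "\<And>j \<rho> \<rho>'. j < m \<Longrightarrow> nmem \<rho> i 0 = j \<Longrightarrow> P j \<rho> \<Longrightarrow>
       agree (insert i (modN c)) (modR c) \<sigma> \<rho> \<Longrightarrow> reaches m f J c \<rho> \<rho>' \<Longrightarrow> P (Suc j) \<rho>'"
  shows "P m \<tau>"
proof (rule For_inv(1)[where P = P, OF ex[unfolded ForM_def] i(1)])
  show "bval (NLess (nv i) (nv ''m'')) \<rho> \<longleftrightarrow> nmem \<rho> i 0 < m"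
    if "agree (insert i (modN c)) (modR c) \<sigma> \<rho>" for \<rho>
    using agree_nmem[OF that, of "''m''"] s i by (auto simp: sizes_def)
qed (use assms in auto)

lemma ForN_inv:
  assumes ex: "reaches m f J (ForN i c) \<sigma> \<tau>" and s: "sizes m n \<sigma>" and i: "i \<notin> modN c" "i \<noteq> ''n''" "''n'' \<notin> modN c"
    and "P 0 \<sigma>" "\<And>j \<rho> v. P j \<rho> \<Longrightarrow> P j (nstore i 0 v \<rho>)"
    and "\<And>j \<rho> \<rho>'. j < n \<Longrightarrow> nmem \<rho> i 0 = j \<Longrightarrow> P j \<rho> \<Longrightarrow>
       agree (insert i (modN c)) (modR c) \<sigma> \<rho> \<Longrightarrow> reaches m f J c \<rho> \<rho>' \<Longrightarrow> P (Suc j) \<rho>'"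
  shows "P n \<tau>"
proof (rule For_inv(1)[where P = P, OF ex[unfolded ForN_def] i(1)])
  show "bval (NLess (nv i) (nv ''n'')) \<rho> \<longleftrightarrow> nmem \<rho> i 0 < n"
    if "agree (insert i (modN c)) (modR c) \<sigma> \<rho>" for \<rho>
    using agree_nmem[OF that, of "''n''"] s i by (auto simp: sizes_def)
qed (use assms in auto)

lemma polytime_ForM: "polytime c \<Longrightarrow> i \<notin> modN c \<Longrightarrow> i \<noteq> ''m'' \<Longrightarrow> i \<noteq> ''n'' \<Longrightarrow> polytime (ForM i c)"
  unfolding ForM_def by (rule polytime_For[where L = "\<lambda>m n. m"]) (auto simp: sizes_def poly_bounded_m)

lemma polytime_ForN: "polytime c \<Longrightarrow> i \<notin> modN c \<Longrightarrow> i \<noteq> ''m'' \<Longrightarrow> i \<noteq> ''n'' \<Longrightarrow> polytime (ForN i c)"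
  unfolding ForN_def by (rule polytime_For[where L = "\<lambda>m n. n"]) (auto simp: sizes_def poly_bounded_n)

lemmas polytime_intros = polytime_Skip polytime_NAssign polytime_RAssign polytime_Value polytime_Indep
  polytime_Seq polytime_Cond polytime_ForM polytime_ForN

lemma reaches_sizes: "reaches m f J c \<sigma> \<tau> \<Longrightarrow> sizes m n \<sigma> \<Longrightarrow> ''m'' \<notin> modN c \<Longrightarrow> ''n'' \<notin> modN c \<Longrightarrow> sizes m n \<tau>"
  using reaches_nmem[of m f J c \<sigma> \<tau>] by (simp add: sizes_def)

lemma agree_sizes: "agree VN VR \<sigma> \<rho> \<Longrightarrow> sizes m n \<sigma> \<Longrightarrow> ''m'' \<notin> VN \<Longrightarrow> ''n'' \<notin> VN \<Longrightarrow> sizes m n \<rho>"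
  by (simp add: sizes_def agree_def)

lemma sizes_store [simp]:
  "x \<noteq> ''m'' \<Longrightarrow> x \<noteq> ''n'' \<Longrightarrow> sizes m n (nstore x i v \<sigma>) = sizes m n \<sigma>"
  "sizes m n (rstore y i r \<sigma>) = sizes m n \<sigma>"
  by (auto simp: sizes_def)

lemma stored_set_0: "stored_set m x 0 \<sigma> = {e. e < m \<and> nmem \<sigma> x e \<noteq> 0}"
  by (simp add: stored_set_def)

lemma stored_set_cong: "(\<And>e. e < m \<Longrightarrow> nmem \<tau> y (j + e) = nmem \<sigma> x (i + e)) \<Longrightarrow> stored_set m y j \<tau> = stored_set m x i \<sigma>"
  by (auto simp: stored_set_def)

lemma stored_set_subset: "stored_set m x i \<sigma> \<subseteq> {..<m}"
  by (auto simp: stored_set_def)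

definition copy :: "string \<Rightarrow> string \<Rightarrow> com" where
  "copy X Y = ForM ''i'' (NAssign Y (nv ''i'') (NGet X (nv ''i'')))"

lemma mod_copy [simp]: "modN (copy X Y) = {''i'', Y}" "modR (copy X Y) = {}"
  by (auto simp: copy_def)

lemma polytime_copy: "Y \<notin> {''i'', ''m'', ''n''} \<Longrightarrow> polytime (copy X Y)"
  unfolding copy_def by (intro polytime_intros) auto

lemma copy_spec:
  assumes ex: "reaches m f J (copy X Y) \<sigma> \<tau>" and s: "sizes m n \<sigma>" and Y: "Y \<notin> {''i'', ''m'', X}" and X: "X \<noteq> ''i''"
    and e: "e < m"
  shows "nmem \<tau> Y e = nmem \<sigma> X e"
proof -
  have "\<forall>e<m. nmem \<tau> Y e = nmem \<sigma> X e"
  proof (rule ForM_inv[where P = "\<lambda>j \<rho>. \<forall>e<j. nmem \<rho> Y e = nmem \<sigma> X e", OF ex[unfolded copy_def] s])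
    fix j \<rho> \<rho>'
    assume j: "nmem \<rho> ''i'' 0 = j" "\<forall>e<j. nmem \<rho> Y e = nmem \<sigma> X e"
      and a: "agree (insert ''i'' (modN (NAssign Y (nv ''i'') (NGet X (nv ''i''))))) (modR (NAssign Y (nv ''i'') (NGet X (nv ''i'')))) \<sigma> \<rho>"
      and e: "reaches m f J (NAssign Y (nv ''i'') (NGet X (nv ''i''))) \<rho> \<rho>'"
    then show "\<forall>e<Suc j. nmem \<rho>' Y e = nmem \<sigma> X e"
      using Y X agree_nmem[OF a, of X] by (auto simp: less_Suc_eq)
  qed (use Y X in auto)
  with e show ?thesis by blast
qed

lemma copy_stored_set:
  assumes "reaches m f J (copy X Y) \<sigma> \<tau>" "sizes m n \<sigma>" "Y \<notin> {''i'', ''m'', X}" "X \<noteq> ''i''"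
  shows "stored_set m Y 0 \<tau> = stored_set m X 0 \<sigma>"
  using copy_spec[OF assms] by (auto simp: stored_set_0)

text \<open>\<open>b\<close> is evaluated with the candidate element in \<open>i\<close>; any test
  on that cell thus becomes the indicator vector of a set.\<close>

definition compr :: "string \<Rightarrow> bexp \<Rightarrow> com" where
  "compr Y b = ForM ''i'' (Cond b (NAssign Y (nv ''i'') (NConst 1)) (NAssign Y (nv ''i'') (NConst 0)))"

lemma mod_compr [simp]: "modN (compr Y b) = {''i'', Y}" "modR (compr Y b) = {}"
  by (auto simp: compr_def)

lemma polytime_compr: "Y \<notin> {''i'', ''m'', ''n''} \<Longrightarrow> polytime (compr Y b)"
  unfolding compr_def by (intro polytime_intros) auto

lemma compr_spec:
  assumes ex: "reaches m f J (compr Y b) \<sigma> \<tau>" and s: "sizes m n \<sigma>" and Y: "Y \<notin> {''i'', ''m''}"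
    and b: "\<And>\<rho>. agree {''i'', Y} {} \<sigma> \<rho> \<Longrightarrow> bval b \<rho> \<longleftrightarrow> b' (nmem \<rho> ''i'' 0)"
  shows "stored_set m Y 0 \<tau> = {e. e < m \<and> b' e}"
proof -
  let ?c = "Cond b (NAssign Y (nv ''i'') (NConst 1)) (NAssign Y (nv ''i'') (NConst 0))"
  have "\<forall>e<m. nmem \<tau> Y e \<noteq> 0 \<longleftrightarrow> b' e"
  proof (rule ForM_inv[where P = "\<lambda>j \<rho>. \<forall>e<j. nmem \<rho> Y e \<noteq> 0 \<longleftrightarrow> b' e", OF ex[unfolded compr_def] s])
    fix j \<rho> \<rho>'
    assume j: "nmem \<rho> ''i'' 0 = j" "\<forall>e<j. nmem \<rho> Y e \<noteq> 0 \<longleftrightarrow> b' e"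
      and a: "agree (insert ''i'' (modN ?c)) (modR ?c) \<sigma> \<rho>" and e: "reaches m f J ?c \<rho> \<rho>'"
    have "bval b \<rho> \<longleftrightarrow> b' j" using b[of \<rho>] a j by simp
    with j e Y show "\<forall>e<Suc j. nmem \<rho>' Y e \<noteq> 0 \<longleftrightarrow> b' e"
      by (auto simp: less_Suc_eq split: if_splits)
  qed (use Y in auto)
  then show ?thesis by (auto simp: stored_set_0)
qed

definition size_of :: "string \<Rightarrow> string \<Rightarrow> com" where
  "size_of S z = Seq (rset z (RNat (NConst 0)))
     (ForM ''i'' (Cond (NLess (NConst 0) (NGet S (nv ''i''))) (rset z (RAdd (rv z) (RGet ''s'' (nv ''i'')))) Skip))"

lemma mod_size_of [simp]: "modN (size_of S z) = {''i''}" "modR (size_of S z) = {z}"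
  by (auto simp: size_of_def)

lemma polytime_size_of: "polytime (size_of S z)"
  unfolding size_of_def by (intro polytime_intros) auto

lemma sum_stored_set:
  "(\<Sum>e<m. if 0 < nmem \<sigma> S e then h e else 0) = sum h (stored_set m S 0 \<sigma>)"
proof -
  have "stored_set m S 0 \<sigma> = {e \<in> {..<m}. 0 < nmem \<sigma> S e}" by (auto simp: stored_set_0)
  then show ?thesis using sum.inter_filter[of "{..<m}" h "\<lambda>e. 0 < nmem \<sigma> S e"] by simp
qed

lemma size_of_spec:
  assumes ex: "reaches m f J (size_of S z) \<sigma> \<tau>" and s: "sizes m n \<sigma>" and S: "S \<noteq> ''i''" and z: "z \<noteq> ''s''"
  shows "rmem \<tau> z 0 = sum (rmem \<sigma> ''s'') (stored_set m S 0 \<sigma>)"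
proof -
  let ?c = "Cond (NLess (NConst 0) (NGet S (nv ''i''))) (rset z (RAdd (rv z) (RGet ''s'' (nv ''i'')))) Skip"
  let ?h = "\<lambda>e. if 0 < nmem \<sigma> S e then rmem \<sigma> ''s'' e else 0"
  obtain \<sigma>0 where \<sigma>0: "\<sigma>0 = rstore z 0 0 \<sigma>" "reaches m f J (ForM ''i'' ?c) \<sigma>0 \<tau>"
    using ex by (auto simp: size_of_def)
  have "rmem \<tau> z 0 = (\<Sum>e<m. ?h e)"
  proof (rule ForM_inv[where P = "\<lambda>j \<rho>. rmem \<rho> z 0 = (\<Sum>e<j. ?h e)", OF \<sigma>0(2)])
    fix j \<rho> \<rho>'
    assume j: "nmem \<rho> ''i'' 0 = j" "rmem \<rho> z 0 = (\<Sum>e<j. ?h e)"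
      and a: "agree (insert ''i'' (modN ?c)) (modR ?c) \<sigma>0 \<rho>" and e: "reaches m f J ?c \<rho> \<rho>'"
    then show "rmem \<rho>' z 0 = (\<Sum>e<Suc j. ?h e)"
      using S z agree_nmem[OF a, of S] agree_rmem[OF a, of "''s''"] \<sigma>0(1) by (auto split: if_splits)
  qed (use s \<sigma>0(1) in auto)
  then show ?thesis by (simp add: sum_stored_set)
qed

section \<open>Evaluating the truncated weighted objective and keeping the best set\<close>

definition wobj :: "nat \<Rightarrow> (nat \<Rightarrow> nat set \<Rightarrow> real) \<Rightarrow> state \<Rightarrow> nat set \<Rightarrow> real" where
  "wobj n f \<sigma> X = (\<Sum>k<n. rmem \<sigma> ''w'' k * min (f k X) (rmem \<sigma> ''B'' 0))"

lemma wobj_cong: "rmem \<tau> ''w'' = rmem \<sigma> ''w'' \<Longrightarrow> rmem \<tau> ''B'' = rmem \<sigma> ''B'' \<Longrightarrow> wobj n f \<tau> = wobj n f \<sigma>"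
  by (auto simp: wobj_def)

lemma wobj_store [simp]:
  "wobj n f (nstore x i v \<sigma>) = wobj n f \<sigma>"
  "y \<noteq> ''w'' \<Longrightarrow> y \<noteq> ''B'' \<Longrightarrow> wobj n f (rstore y i r \<sigma>) = wobj n f \<sigma>"
  by (auto simp: wobj_def)

lemma wobj_objective:
  assumes "\<And>k. k < n \<Longrightarrow> objective E (f k)" "\<And>k. k < n \<Longrightarrow> 0 \<le> rmem \<sigma> ''w'' k" "0 \<le> rmem \<sigma> ''B'' 0"
  shows "objective E (wobj n f \<sigma>)"
  unfolding wobj_def using assms by (intro objective_weighted_sum objective_truncate) auto

definition eval_obj :: "string \<Rightarrow> string \<Rightarrow> com" where
  "eval_obj S out = Seq (rset out (RNat (NConst 0)))
     (ForN ''k'' (Seq (Value ''tv'' (NConst 0) (nv ''k'') S)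
       (Seq (Cond (RLess (rv ''B'') (rv ''tv'')) (rset ''tv'' (rv ''B'')) Skip)
         (rset out (RAdd (rv out) (RMul (RGet ''w'' (nv ''k'')) (rv ''tv'')))))))"

lemma mod_eval_obj [simp]: "modN (eval_obj S out) = {''k''}" "modR (eval_obj S out) = {''tv'', out}"
  by (auto simp: eval_obj_def)

lemma polytime_eval_obj: "polytime (eval_obj S out)"
  unfolding eval_obj_def by (intro polytime_intros) auto

lemma eval_obj_spec:
  assumes ex: "reaches m f J (eval_obj S out) \<sigma> \<tau>" and s: "sizes m n \<sigma>" and S: "S \<noteq> ''k''"
    and out: "out \<notin> {''tv'', ''B'', ''w''}"
  shows "rmem \<tau> out 0 = wobj n f \<sigma> (stored_set m S 0 \<sigma>)"
proof -
  let ?c = "Seq (Value ''tv'' (NConst 0) (nv ''k'') S)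
       (Seq (Cond (RLess (rv ''B'') (rv ''tv'')) (rset ''tv'' (rv ''B'')) Skip)
         (rset out (RAdd (rv out) (RMul (RGet ''w'' (nv ''k'')) (rv ''tv'')))))"
  let ?h = "\<lambda>k. rmem \<sigma> ''w'' k * min (f k (stored_set m S 0 \<sigma>)) (rmem \<sigma> ''B'' 0)"
  obtain \<sigma>0 where \<sigma>0: "\<sigma>0 = rstore out 0 0 \<sigma>" "reaches m f J (ForN ''k'' ?c) \<sigma>0 \<tau>"
    using ex by (auto simp: eval_obj_def)
  have "rmem \<tau> out 0 = (\<Sum>k<n. ?h k)"
  proof (rule ForN_inv[where P = "\<lambda>j \<rho>. rmem \<rho> out 0 = (\<Sum>k<j. ?h k)", OF \<sigma>0(2)])
    fix j \<rho> \<rho>'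
    assume j: "nmem \<rho> ''k'' 0 = j" "rmem \<rho> out 0 = (\<Sum>k<j. ?h k)"
      and a: "agree (insert ''k'' (modN ?c)) (modR ?c) \<sigma>0 \<rho>" and e: "reaches m f J ?c \<rho> \<rho>'"
    have "stored_set m S 0 \<rho> = stored_set m S 0 \<sigma>"
      using agree_nmem[OF a, of S] S \<sigma>0(1) by (intro stored_set_cong) simp
    moreover have "rmem \<rho> ''w'' = rmem \<sigma> ''w''" "rmem \<rho> ''B'' = rmem \<sigma> ''B''"
      using agree_rmem[OF a, of "''w''"] agree_rmem[OF a, of "''B''"] \<sigma>0(1) out by auto
    moreover obtain \<rho>2 where \<rho>2: "reaches m f J (Cond (RLess (rv ''B'') (rv ''tv'')) (rset ''tv'' (rv ''B'')) Skip)
        (rstore ''tv'' 0 (f j (stored_set m S 0 \<rho>)) \<rho>) \<rho>2"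
        "\<rho>' = rstore out 0 (rmem \<rho>2 out 0 + rmem \<rho>2 ''w'' (nmem \<rho>2 ''k'' 0) * rmem \<rho>2 ''tv'' 0) \<rho>2"
      using e j(1) by (auto simp del: reaches_Cond)
    moreover have "rmem \<rho>2 ''tv'' 0 = min (f j (stored_set m S 0 \<rho>)) (rmem \<rho> ''B'' 0)"
      using \<rho>2(1) by (auto split: if_splits)
    ultimately show "rmem \<rho>' out 0 = (\<Sum>k<Suc j. ?h k)"
      using j out by (simp add: reaches_nmem[OF \<rho>2(1)] reaches_rmem[OF \<rho>2(1)])
  qed (use s \<sigma>0(1) in auto)
  then show ?thesis by (simp add: wobj_def)
qed

definition keep :: "string \<Rightarrow> string \<Rightarrow> string \<Rightarrow> string \<Rightarrow> com" where
  "keep S v X b = Cond (RLess (rv b) (rv v)) (Seq (copy S X) (rset b (rv v))) Skip"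

lemma mod_keep [simp]: "modN (keep S v X b) = {''i'', X}" "modR (keep S v X b) = {b}"
  by (auto simp: keep_def)

lemma polytime_keep: "X \<notin> {''i'', ''m'', ''n''} \<Longrightarrow> polytime (keep S v X b)"
  unfolding keep_def by (intro polytime_intros polytime_copy) auto

lemma keep_spec:
  assumes ex: "reaches m f J (keep S v X b) \<sigma> \<tau>" and s: "sizes m n \<sigma>" and X: "X \<notin> {''i'', ''m'', S}" and S: "S \<noteq> ''i''"
  shows "rmem \<tau> b 0 = max (rmem \<sigma> b 0) (rmem \<sigma> v 0)"
    and "\<tau> = \<sigma> \<or> (rmem \<tau> b 0 = rmem \<sigma> v 0 \<and> (\<forall>e<m. nmem \<tau> X e = nmem \<sigma> S e))"
proof -
  have "\<tau> = \<sigma> \<and> rmem \<sigma> v 0 \<le> rmem \<sigma> b 0 \<or>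
      rmem \<sigma> b 0 < rmem \<sigma> v 0 \<and> rmem \<tau> b 0 = rmem \<sigma> v 0 \<and> (\<forall>e<m. nmem \<tau> X e = nmem \<sigma> S e)"
  proof (cases "rmem \<sigma> b 0 < rmem \<sigma> v 0")
    case True
    then obtain \<rho> where \<rho>: "reaches m f J (copy S X) \<sigma> \<rho>" "\<tau> = rstore b 0 (rmem \<rho> v 0) \<rho>"
      using ex by (auto simp: keep_def)
    have "rmem \<rho> = rmem \<sigma>" using reaches_rmem[OF \<rho>(1)] by auto
    with True \<rho> copy_spec[OF \<rho>(1) s X S] show ?thesis by simp
  qed (use ex in \<open>auto simp: keep_def\<close>)
  then show "rmem \<tau> b 0 = max (rmem \<sigma> b 0) (rmem \<sigma> v 0)"
    and "\<tau> = \<sigma> \<or> (rmem \<tau> b 0 = rmem \<sigma> v 0 \<and> (\<forall>e<m. nmem \<tau> X e = nmem \<sigma> S e))"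
    by auto
qed

lemma keep_stored_set:
  assumes "reaches m f J (keep S v X b) \<sigma> \<tau>" "sizes m n \<sigma>" "X \<notin> {''i'', ''m'', S}" "S \<noteq> ''i''"
  shows "\<tau> = \<sigma> \<or> (rmem \<tau> b 0 = rmem \<sigma> v 0 \<and> stored_set m X 0 \<tau> = stored_set m S 0 \<sigma>)"
  using keep_spec(2)[OF assms] by (auto simp: stored_set_0)

lemmas polytime_subroutines = polytime_copy polytime_compr polytime_size_of polytime_eval_obj polytime_keep


section \<open>The algorithm for a knapsack constraint\<close>

definition greedy_try :: com where
  "greedy_try =
     Seq (copy ''Y'' ''Q'') (Seq (NAssign ''Q'' (nv ''e'') (NConst 1)) (Seq (size_of ''Q'' ''z'')
       (Cond (RLess (rv ''C'') (rv ''z'')) Skip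
         (Seq (eval_obj ''Q'' ''v'')
           (Seq (rset ''d'' (RDiv (RSub (rv ''v'') (rv ''v0'')) (RGet ''s'' (nv ''e''))))
             (keep ''Q'' ''d'' ''BQ'' ''bd''))))))"

definition greedy_add :: com where
  "greedy_add = Seq (eval_obj ''Y'' ''v0'') (Seq (rset ''bd'' (RNat (NConst 0))) (Seq (copy ''Y'' ''BQ'')
     (Seq (ForM ''e'' (Cond (NLess (NConst 0) (NGet ''Y'' (nv ''e''))) Skip greedy_try)) (copy ''BQ'' ''Y''))))"

lemma mod_greedy_try [simp]:
  "modN greedy_try = {''i'', ''k'', ''Q'', ''BQ''}" "modR greedy_try = {''z'', ''tv'', ''v'', ''d'', ''bd''}"
  by (auto simp: greedy_try_def)

lemma mod_greedy_add [simp]: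
  "modN greedy_add = {''i'', ''k'', ''e'', ''Q'', ''BQ'', ''Y''}"
  "modR greedy_add = {''z'', ''tv'', ''v'', ''v0'', ''d'', ''bd''}"
  by (auto simp: greedy_add_def)

lemma polytime_greedy_add: "polytime greedy_add"
  unfolding greedy_add_def greedy_try_def
  by (intro polytime_intros polytime_subroutines) auto

lemma greedy_try_spec:
  assumes ex: "reaches m f J greedy_try \<rho> \<rho>'" and s: "sizes m n \<rho>"
    and v0: "rmem \<rho> ''v0'' 0 = wobj n f \<rho> Y" and Y: "Y = stored_set m ''Y'' 0 \<rho>"
    and e: "e = nmem \<rho> ''e'' 0" "e < m" "e \<notin> Y"
    and inv: "greedy_step {..<m} (wobj n f \<rho>) (rmem \<rho> ''s'') (rmem \<rho> ''C'' 0) {..<e} Y (rmem \<rho> ''bd'' 0) (stored_set m ''BQ'' 0 \<rho>)"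
  shows "greedy_step {..<m} (wobj n f \<rho>) (rmem \<rho> ''s'') (rmem \<rho> ''C'' 0) {..<Suc e} Y (rmem \<rho>' ''bd'' 0) (stored_set m ''BQ'' 0 \<rho>')"
proof -
  let ?F = "wobj n f \<rho>" and ?s = "rmem \<rho> ''s''" and ?C = "rmem \<rho> ''C'' 0"
  obtain \<rho>1 \<rho>2 where
    1: "reaches m f J (copy ''Y'' ''Q'') \<rho> \<rho>1" and
    2: "reaches m f J (size_of ''Q'' ''z'') (nstore ''Q'' (nmem \<rho>1 ''e'' 0) 1 \<rho>1) \<rho>2" and
    3: "reaches m f J (Cond (RLess (rv ''C'') (rv ''z'')) Skip
         (Seq (eval_obj ''Q'' ''v'')
           (Seq (rset ''d'' (RDiv (RSub (rv ''v'') (rv ''v0'')) (RGet ''s'' (nv ''e''))))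
             (keep ''Q'' ''d'' ''BQ'' ''bd'')))) \<rho>2 \<rho>'"
    using ex by (auto simp: greedy_try_def simp del: reaches_Cond)
  note fr = reaches_nmem[OF 1] reaches_rmem[OF 1] reaches_nmem[OF 2] reaches_rmem[OF 2]
  have s1: "sizes m n \<rho>1" using reaches_sizes[OF 1 s] by simp
  have "stored_set m ''Q'' 0 \<rho>1 = Y"
    using copy_stored_set[OF 1 s] Y by simp
  then have Q1: "stored_set m ''Q'' 0 (nstore ''Q'' (nmem \<rho>1 ''e'' 0) 1 \<rho>1) = insert e Y"
    using e fr by (auto simp: stored_set_0)
  have s2: "sizes m n \<rho>2" using reaches_sizes[OF 2] s1 by simp
  have Q2: "stored_set m ''Q'' 0 \<rho>2 = insert e Y"
    unfolding Q1[symmetric] by (rule stored_set_cong) (simp add: fr)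
  have z: "rmem \<rho>2 ''z'' 0 = sum ?s (insert e Y)"
    using size_of_spec[OF 2, of n] s1 Q1 by (simp add: fr)
  have BQ2: "stored_set m ''BQ'' 0 \<rho>2 = stored_set m ''BQ'' 0 \<rho>" by (rule stored_set_cong) (simp add: fr)
  have bd2: "rmem \<rho>2 ''bd'' 0 = rmem \<rho> ''bd'' 0" by (simp add: fr)
  show ?thesis
  proof (cases "sum ?s (insert e Y) \<le> ?C")
    case False
    then have "\<rho>' = \<rho>2" using 3 z by (simp add: fr)
    with inv False BQ2 bd2 show ?thesis by (auto simp: greedy_step_def less_Suc_eq)
  next
    case True
    then obtain \<rho>3 where
      4: "reaches m f J (eval_obj ''Q'' ''v'') \<rho>2 \<rho>3" and
      5: "reaches m f J (keep ''Q'' ''d'' ''BQ'' ''bd'')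
        (rstore ''d'' 0 ((rmem \<rho>3 ''v'' 0 - rmem \<rho>3 ''v0'' 0) / rmem \<rho>3 ''s'' (nmem \<rho>3 ''e'' 0)) \<rho>3) \<rho>'"
      (is "reaches m f J _ ?\<rho>4 _")
      using 3 z by (auto simp: fr)
    note fr' = fr reaches_nmem[OF 4] reaches_rmem[OF 4]
    have s4: "sizes m n ?\<rho>4" using reaches_sizes[OF 4 s2] by simp
    have "wobj n f \<rho>2 = ?F" by (rule wobj_cong) (simp_all add: fr)
    then have "rmem \<rho>3 ''v'' 0 = ?F (insert e Y)"
      using eval_obj_spec[OF 4 s2] Q2 by simp
    then have d: "rmem ?\<rho>4 ''d'' 0 = gain_density ?F ?s Y e"
      using v0 e by (simp add: fr' gain_density_def)
    have bd4: "rmem ?\<rho>4 ''bd'' 0 = rmem \<rho> ''bd'' 0" by (simp add: fr')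
    have Q4: "stored_set m ''Q'' 0 ?\<rho>4 = insert e Y"
      unfolding Q2[symmetric] by (rule stored_set_cong) (simp add: fr')
    have BQ4: "stored_set m ''BQ'' 0 ?\<rho>4 = stored_set m ''BQ'' 0 \<rho>" by (rule stored_set_cong) (simp add: fr')
    have A: "rmem \<rho>' ''bd'' 0 = max (rmem \<rho> ''bd'' 0) (gain_density ?F ?s Y e)"
      using keep_spec(1)[OF 5 s4] bd4 d by simp
    have B: "(rmem \<rho>' ''bd'' 0 = rmem \<rho> ''bd'' 0 \<and> stored_set m ''BQ'' 0 \<rho>' = stored_set m ''BQ'' 0 \<rho>) \<or>
        (rmem \<rho>' ''bd'' 0 = gain_density ?F ?s Y e \<and> stored_set m ''BQ'' 0 \<rho>' = insert e Y)"
      using keep_stored_set[OF 5 s4] bd4 d Q4 BQ4 by auto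
    have C: "\<forall>e'\<in>{..<Suc e} - Y. sum ?s (insert e' Y) \<le> ?C \<longrightarrow> gain_density ?F ?s Y e' \<le> rmem \<rho>' ''bd'' 0"
      using inv unfolding A by (fastforce simp: greedy_step_def less_Suc_eq)
    have "0 \<le> rmem \<rho>' ''bd'' 0" using inv unfolding A by (auto simp: greedy_step_def)
    moreover have "(stored_set m ''BQ'' 0 \<rho>' = Y \<and> rmem \<rho>' ''bd'' 0 = 0 \<or>
       (\<exists>u\<in>{..<m} - Y. sum ?s (insert u Y) \<le> ?C \<and> stored_set m ''BQ'' 0 \<rho>' = insert u Y \<and>
          gain_density ?F ?s Y u = rmem \<rho>' ''bd'' 0))"
      using B
    proof
      assume "rmem \<rho>' ''bd'' 0 = rmem \<rho> ''bd'' 0 \<and> stored_set m ''BQ'' 0 \<rho>' = stored_set m ''BQ'' 0 \<rho>"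
      then show ?thesis using inv unfolding greedy_step_def by simp
    next
      assume "rmem \<rho>' ''bd'' 0 = gain_density ?F ?s Y e \<and> stored_set m ''BQ'' 0 \<rho>' = insert e Y"
      then show ?thesis using e True by auto
    qed
    ultimately show ?thesis unfolding greedy_step_def using C by blast
  qed
qed

lemma greedy_add_spec:
  assumes ex: "reaches m f J greedy_add \<sigma> \<tau>" and s: "sizes m n \<sigma>"
  shows "\<exists>d. greedy_step {..<m} (wobj n f \<sigma>) (rmem \<sigma> ''s'') (rmem \<sigma> ''C'' 0) {..<m}
    (stored_set m ''Y'' 0 \<sigma>) d (stored_set m ''Y'' 0 \<tau>)"
proof -
  let ?F = "wobj n f \<sigma>" and ?s = "rmem \<sigma> ''s''" and ?C = "rmem \<sigma> ''C'' 0" and ?Y = "stored_set m ''Y'' 0 \<sigma>"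
  let ?c = "Cond (NLess (NConst 0) (NGet ''Y'' (nv ''e''))) Skip greedy_try"
  obtain \<sigma>1 \<sigma>2 \<sigma>3 where
    1: "reaches m f J (eval_obj ''Y'' ''v0'') \<sigma> \<sigma>1" and
    2: "reaches m f J (copy ''Y'' ''BQ'') (rstore ''bd'' 0 0 \<sigma>1) \<sigma>2" and
    3: "reaches m f J (ForM ''e'' ?c) \<sigma>2 \<sigma>3" and
    4: "reaches m f J (copy ''BQ'' ''Y'') \<sigma>3 \<tau>"
    using ex by (auto simp: greedy_add_def simp del: reaches_Cond)
  note fr = reaches_nmem[OF 1] reaches_rmem[OF 1] reaches_nmem[OF 2] reaches_rmem[OF 2]
  have s1: "sizes m n \<sigma>1" using reaches_sizes[OF 1 s] by simp
  have s2: "sizes m n \<sigma>2" using reaches_sizes[OF 2] s1 by simp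
  have Y1: "stored_set m ''Y'' 0 (rstore ''bd'' 0 0 \<sigma>1) = ?Y" by (rule stored_set_cong) (simp add: fr)
  let ?P = "\<lambda>j \<rho>. greedy_step {..<m} ?F ?s ?C {..<j} ?Y (rmem \<rho> ''bd'' 0) (stored_set m ''BQ'' 0 \<rho>)"
  have "?P m \<sigma>3"
  proof (rule ForM_inv[where P = ?P, OF 3 s2])
    have "stored_set m ''BQ'' 0 \<sigma>2 = ?Y" using copy_stored_set[OF 2, of n] s1 Y1 by simp
    then show "?P 0 \<sigma>2" by (simp add: greedy_step_def fr)
  next
    fix j \<rho> v assume "?P j \<rho>"
    then show "?P j (nstore ''e'' 0 v \<rho>)" by (simp add: stored_set_0)
  next
    fix j \<rho> \<rho>'
    assume j: "j < m" "nmem \<rho> ''e'' 0 = j" and P: "?P j \<rho>"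
      and a: "agree (insert ''e'' (modN ?c)) (modR ?c) \<sigma>2 \<rho>" and e: "reaches m f J ?c \<rho> \<rho>'"
    note ag = agree_nmem[OF a] agree_rmem[OF a]
    have Y: "stored_set m ''Y'' 0 \<rho> = ?Y" by (rule stored_set_cong) (simp add: ag fr)
    have F: "wobj n f \<rho> = ?F" by (rule wobj_cong) (simp_all add: ag fr)
    have sR: "rmem \<rho> ''s'' = ?s" "rmem \<rho> ''C'' 0 = ?C" by (simp_all add: ag fr)
    show "?P (Suc j) \<rho>'"
    proof (cases "j \<in> ?Y")
      case True
      then have "j \<in> stored_set m ''Y'' 0 \<rho>" using Y by simp
      then have "\<rho>' = \<rho>" using e j by (simp add: stored_set_0)
      with P True show ?thesis by (auto simp: greedy_step_def less_Suc_eq)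
    next
      case False
      then have "j \<notin> stored_set m ''Y'' 0 \<rho>" using Y by simp
      then have e': "reaches m f J greedy_try \<rho> \<rho>'" using e j by (simp add: stored_set_0)
      have "rmem \<sigma>1 ''v0'' 0 = ?F ?Y" using eval_obj_spec[OF 1 s] by simp
      then have "rmem \<rho> ''v0'' 0 = wobj n f \<rho> ?Y" unfolding F by (simp add: ag fr)
      from greedy_try_spec[OF e' agree_sizes[OF a s2] this Y[symmetric] j(2)[symmetric] j(1) False]
      show ?thesis using P unfolding F sR by simp
    qed
  qed auto
  moreover have "stored_set m ''Y'' 0 \<tau> = stored_set m ''BQ'' 0 \<sigma>3"
    using copy_stored_set[OF 4] reaches_sizes[OF 3 s2] by simp
  ultimately show ?thesis by auto
qed

definition neq :: "nexp \<Rightarrow> nexp \<Rightarrow> bexp" where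
  "neq a b = BNot (BAnd (BNot (NLess a b)) (BNot (NLess b a)))"

lemma bval_neq [simp]: "bval (neq a b) \<sigma> \<longleftrightarrow> nval a \<sigma> \<noteq> nval b \<sigma>"
  by (auto simp: neq_def)

text \<open>The start is written as a negated conjunction because tests have no disjunction. Once
  all elements of size zero belong to it, every density computed for the remaining ones has a
  positive denominator.\<close>

definition knap_triple :: com where
  "knap_triple = Seq (compr ''Y'' (BNot (BAnd (neq (nv ''i'') (nv ''a'')) (BAnd (neq (nv ''i'') (nv ''b''))
       (BAnd (neq (nv ''i'') (nv ''c'')) (RLess (RNat (NConst 0)) (RGet ''s'' (nv ''i''))))))))
     (Seq (size_of ''Y'' ''z'') (Cond (RLess (rv ''C'') (rv ''z'')) Skip
       (Seq (ForM ''g'' greedy_add) (Seq (eval_obj ''Y'' ''v'') (keep ''Y'' ''v'' ''X'' ''best'')))))"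

definition knap_prog :: com where
  "knap_prog = Seq (compr ''X'' (NLess (NConst 0) (NConst 0))) (Seq (rset ''best'' (RNat (NConst 0)))
     (ForM ''a'' (ForM ''b'' (ForM ''c'' knap_triple))))"

lemma mod_knap_triple [simp]:
  "modN knap_triple = {''i'', ''k'', ''e'', ''Q'', ''BQ'', ''Y'', ''g'', ''X''}"
  "modR knap_triple = {''z'', ''tv'', ''v'', ''v0'', ''d'', ''bd'', ''best''}"
  by (auto simp: knap_triple_def)

lemma mod_knap_prog [simp]:
  "modN knap_prog = {''i'', ''k'', ''e'', ''Q'', ''BQ'', ''Y'', ''g'', ''X'', ''a'', ''b'', ''c''}"
  "modR knap_prog = {''z'', ''tv'', ''v'', ''v0'', ''d'', ''bd'', ''best''}"
  by (auto simp: knap_prog_def)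

lemma polytime_knap_prog: "polytime knap_prog"
  unfolding knap_prog_def knap_triple_def
  by (intro polytime_intros polytime_subroutines polytime_greedy_add) auto

text \<open>\<open>X\<close> holds the best set so far and \<open>best\<close> its value. Both
  constraint types share this invariant, and the conjunct on \<open>wobj\<close> ties the memory to
  one objective \<open>F\<close> throughout.\<close>

definition incumbent :: "nat \<Rightarrow> nat \<Rightarrow> (nat \<Rightarrow> nat set \<Rightarrow> real) \<Rightarrow> nat set set \<Rightarrow> (nat set \<Rightarrow> real) \<Rightarrow> state \<Rightarrow> bool" where
  "incumbent m n f \<I> F \<sigma> \<longleftrightarrow> sizes m n \<sigma> \<and> wobj n f \<sigma> = F \<and>
     stored_set m ''X'' 0 \<sigma> \<in> \<I> \<and> rmem \<sigma> ''best'' 0 = F (stored_set m ''X'' 0 \<sigma>)"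

lemma incumbent_frame:
  assumes "reaches m f J c \<sigma> \<tau>" "incumbent m n f \<I> F \<sigma>" "''m'' \<notin> modN c" "''n'' \<notin> modN c" "''X'' \<notin> modN c"
    "''w'' \<notin> modR c" "''B'' \<notin> modR c" "''best'' \<notin> modR c"
  shows "incumbent m n f \<I> F \<tau>"
proof -
  note fr = reaches_nmem[OF assms(1)] reaches_rmem[OF assms(1)]
  have "stored_set m ''X'' 0 \<tau> = stored_set m ''X'' 0 \<sigma>" by (rule stored_set_cong) (simp add: fr assms)
  moreover have "wobj n f \<tau> = wobj n f \<sigma>" by (rule wobj_cong) (simp_all add: fr assms)
  ultimately show ?thesis using assms(2) reaches_sizes[OF assms(1)] assms(3,4) fr(2)[OF assms(8)]
    by (simp add: incumbent_def)
qed

lemma incumbent_store [simp]: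
  "x \<notin> {''m'', ''n'', ''X''} \<Longrightarrow> incumbent m n f \<I> F (nstore x i v \<sigma>) = incumbent m n f \<I> F \<sigma>"
  "y \<notin> {''w'', ''B'', ''best''} \<Longrightarrow> incumbent m n f \<I> F (rstore y i r \<sigma>) = incumbent m n f \<I> F \<sigma>"
  by (auto simp: incumbent_def stored_set_0)

lemma keep_incumbent:
  assumes ex: "reaches m f J (keep S v ''X'' ''best'') \<sigma> \<tau>" and inc: "incumbent m n f \<I> F \<sigma>"
    and S: "stored_set m S 0 \<sigma> \<in> \<I>" "S \<notin> {''i'', ''X''}" and v: "rmem \<sigma> v 0 = F (stored_set m S 0 \<sigma>)"
  shows "incumbent m n f \<I> F \<tau>" and "rmem \<tau> ''best'' 0 = max (rmem \<sigma> ''best'' 0) (F (stored_set m S 0 \<sigma>))"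
proof -
  have s: "sizes m n \<sigma>" using inc by (simp add: incumbent_def)
  have "wobj n f \<tau> = wobj n f \<sigma>" using reaches_rmem[OF ex] by (intro wobj_cong) auto
  moreover have "sizes m n \<tau>" using reaches_sizes[OF ex s] by simp
  moreover have "\<tau> = \<sigma> \<or> (rmem \<tau> ''best'' 0 = rmem \<sigma> v 0 \<and> stored_set m ''X'' 0 \<tau> = stored_set m S 0 \<sigma>)"
    using S by (intro keep_stored_set[OF ex s]) auto
  ultimately show "incumbent m n f \<I> F \<tau>"
    using inc S v by (auto simp: incumbent_def)
  show "rmem \<tau> ''best'' 0 = max (rmem \<sigma> ''best'' 0) (F (stored_set m S 0 \<sigma>))"
    using keep_spec(1)[OF ex s] S v by auto
qed

text \<open>The property of a start on which the analysis of the greedy extension rests. The program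
  never tests it: it tries all triples, and \<open>heavy_triple\<close> shows that every nonempty
  \<open>Q\<close> has one.\<close>

definition heavy :: "nat \<Rightarrow> (nat set \<Rightarrow> real) \<Rightarrow> nat set \<Rightarrow> nat \<Rightarrow> nat \<Rightarrow> nat \<Rightarrow> bool" where
  "heavy m F Q a b c \<longleftrightarrow> {a, b, c} \<subseteq> Q \<and> (\<forall>e\<in>Q. \<forall>Y. {a, b, c} \<subseteq> Y \<longrightarrow> Y \<subseteq> {..<m} \<longrightarrow>
     F (insert e Y) - F Y \<le> F {a, b, c} / 3)"

lemma greedy_loop_spec:
  assumes ex: "reaches m f J (ForM ''g'' greedy_add) \<sigma> \<tau>" and sz: "sizes m n \<sigma>"
    and F: "objective {..<m} F" "wobj n f \<sigma> = F" and s: "rmem \<sigma> ''s'' = s" "\<And>e. e < m \<Longrightarrow> 0 \<le> s e"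
    and C: "rmem \<sigma> ''C'' 0 = C" and Q: "Q \<subseteq> {..<m}" "sum s Q \<le> C"
    and Y0: "Y0 = stored_set m ''Y'' 0 \<sigma>" "Y0 = {e. e < m \<and> (e = a \<or> e = b \<or> e = c \<or> \<not> 0 < s e)}" "sum s Y0 \<le> C"
  shows "stored_set m ''Y'' 0 \<tau> \<subseteq> {..<m} \<and> sum s (stored_set m ''Y'' 0 \<tau>) \<le> C \<and>
    (heavy m F Q a b c \<longrightarrow> (1 - 1 / exp 1) * F Q \<le> F (stored_set m ''Y'' 0 \<tau>))"
proof -
  let ?St = "\<lambda>\<rho>. stored_set m ''Y'' 0 \<rho>"
  let ?P = "\<lambda>j \<rho>. Y0 \<subseteq> ?St \<rho> \<and> sum s (?St \<rho>) \<le> C \<and>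
     (heavy m F Q a b c \<longrightarrow> greedy_progress {..<m} F s C Q Y0 j (?St \<rho>))"
  have "?P m \<tau>"
  proof (rule ForM_inv[where P = ?P, OF ex sz])
    show "?P 0 \<sigma>" using Y0 by (simp add: greedy_progress_start)
  next
    fix j \<rho> v assume "?P j \<rho>"
    then show "?P j (nstore ''g'' 0 v \<rho>)" by (simp add: stored_set_0)
  next
    fix j \<rho> \<rho>'
    assume P: "?P j \<rho>" and a: "agree (insert ''g'' (modN greedy_add)) (modR greedy_add) \<sigma> \<rho>"
      and e: "reaches m f J greedy_add \<rho> \<rho>'"
    note ag = agree_rmem[OF a]
    have F\<rho>: "wobj n f \<rho> = F" unfolding F(2)[symmetric] by (rule wobj_cong) (simp_all add: ag)
    obtain d where d: "greedy_step {..<m} F s C {..<m} (?St \<rho>) d (?St \<rho>')"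
      using greedy_add_spec[OF e agree_sizes[OF a sz]] F\<rho> by (auto simp: ag s C)
    have "greedy_progress {..<m} F s C Q Y0 (Suc j) (?St \<rho>')" if h: "heavy m F Q a b c"
    proof (rule greedy_progress_step[OF F(1) _ _ Q(1) _ _ _ _ _ stored_set_subset _ d])
      have abc: "{a, b, c} \<subseteq> Q" "{a, b, c} \<subseteq> Y0" "Y0 \<subseteq> {..<m}" using h Q Y0(2) by (auto simp: heavy_def)
      have fin: "finite Q" "finite Y0" using Q abc finite_subset[of _ "{..<m}"] by auto
      \<comment> \<open>Elements of size zero use no capacity, so the capacity left by the start
        still accommodates the rest of \<open>Q\<close>.\<close>
      have "sum s Y0 = sum s {a, b, c}"
        using fin abc s(2) by (intro sum.mono_neutral_right) (auto simp: Y0(2) intro: antisym)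
      moreover have "sum s (Q - Y0) + sum s {a, b, c} \<le> sum s Q"
        using fin abc s(2) Q by (subst sum.union_disjoint[symmetric]) (auto intro!: sum_mono2)
      ultimately show "sum s (Q - Y0) \<le> C - sum s Y0" using Q(2) by simp
      show "Y0 \<subseteq> {..<m}" by fact
      show "0 < s e" if "e \<in> {..<m} - Y0" for e using that Y0(2) by auto
      fix e Y assume e: "e \<in> Q" "Y0 \<subseteq> Y" "Y \<subseteq> {..<m}"
      have "F (insert e Y) - F Y \<le> F {a, b, c} / 3" using h e abc unfolding heavy_def by (meson order_trans)
      also have "\<dots> \<le> F Y0 / 3" using abc by (intro divide_right_mono objective_mono[OF F(1)]) auto
      finally show "F (insert e Y) - F Y \<le> F Y0 / 3" .
    qed (use P h s in auto)
    moreover have "?St \<rho> \<subseteq> ?St \<rho>'" "sum s (?St \<rho>') \<le> C"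
      using d P by (auto simp: greedy_step_def)
    ultimately show "?P (Suc j) \<rho>'" using P by blast
  qed auto
  moreover have "(1 - 1 / exp 1) * F Q \<le> F (?St \<tau>)"
    if "heavy m F Q a b c" "greedy_progress {..<m} F s C Q Y0 m (?St \<tau>)"
    using that by (intro greedy_progress_end[OF F(1) _ Q(1) stored_set_subset]) auto
  ultimately show ?thesis using stored_set_subset by blast
qed

definition knap_inv ::
  "nat \<Rightarrow> nat \<Rightarrow> (nat \<Rightarrow> nat set \<Rightarrow> real) \<Rightarrow> (nat set \<Rightarrow> real) \<Rightarrow> (nat \<Rightarrow> real) \<Rightarrow> real \<Rightarrow> state \<Rightarrow> bool" where
  "knap_inv m n f F s C \<sigma> \<longleftrightarrow> incumbent m n f (feasible m (Knapsack s C)) F \<sigma> \<and>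
     rmem \<sigma> ''s'' = s \<and> rmem \<sigma> ''C'' 0 = C"

lemma knap_inv_store [simp]:
  "x \<notin> {''m'', ''n'', ''X''} \<Longrightarrow> knap_inv m n f F s C (nstore x i v \<sigma>) = knap_inv m n f F s C \<sigma>"
  by (simp add: knap_inv_def)

lemma knap_triple_spec:
  assumes ex: "reaches m f J knap_triple \<sigma> \<tau>" and inv: "knap_inv m n f F s C \<sigma>"
    and F: "objective {..<m} F" and s: "\<And>e. e < m \<Longrightarrow> 0 \<le> s e"
    and Q: "Q \<subseteq> {..<m}" "sum s Q \<le> C"
    and abc: "nmem \<sigma> ''a'' 0 = a" "nmem \<sigma> ''b'' 0 = b" "nmem \<sigma> ''c'' 0 = c"
  shows "knap_inv m n f F s C \<tau>" and "rmem \<sigma> ''best'' 0 \<le> rmem \<tau> ''best'' 0"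
    and "heavy m F Q a b c \<Longrightarrow> (1 - 1 / exp 1) * F Q \<le> rmem \<tau> ''best'' 0"
proof -
  let ?b = "BNot (BAnd (neq (nv ''i'') (nv ''a'')) (BAnd (neq (nv ''i'') (nv ''b''))
       (BAnd (neq (nv ''i'') (nv ''c'')) (RLess (RNat (NConst 0)) (RGet ''s'' (nv ''i''))))))"
  let ?body = "Seq (ForM ''g'' greedy_add) (Seq (eval_obj ''Y'' ''v'') (keep ''Y'' ''v'' ''X'' ''best''))"
  let ?I = "feasible m (Knapsack s C)"
  let ?Y0 = "{e. e < m \<and> (e = a \<or> e = b \<or> e = c \<or> \<not> 0 < s e)}"
  have inc: "incumbent m n f ?I F \<sigma>" and sz: "sizes m n \<sigma>" and sC: "rmem \<sigma> ''s'' = s" "rmem \<sigma> ''C'' 0 = C"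
    using inv by (auto simp: knap_inv_def incumbent_def)
  obtain \<sigma>1 \<sigma>2 where
    1: "reaches m f J (compr ''Y'' ?b) \<sigma> \<sigma>1" and 2: "reaches m f J (size_of ''Y'' ''z'') \<sigma>1 \<sigma>2" and
    3: "reaches m f J (Cond (RLess (rv ''C'') (rv ''z'')) Skip ?body) \<sigma>2 \<tau>"
    using ex by (auto simp: knap_triple_def simp del: reaches_Cond)
  note fr = reaches_nmem[OF 1] reaches_rmem[OF 1] reaches_nmem[OF 2] reaches_rmem[OF 2]
  have sz1: "sizes m n \<sigma>1" using reaches_sizes[OF 1 sz] by simp
  have sz2: "sizes m n \<sigma>2" using reaches_sizes[OF 2 sz1] by simp
  have Y1: "stored_set m ''Y'' 0 \<sigma>1 = ?Y0"
  proof (rule compr_spec[OF 1 sz])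
    fix \<rho> assume a: "agree {''i'', ''Y''} {} \<sigma> \<rho>"
    show "bval ?b \<rho> \<longleftrightarrow> nmem \<rho> ''i'' 0 = a \<or> nmem \<rho> ''i'' 0 = b \<or> nmem \<rho> ''i'' 0 = c \<or> \<not> 0 < s (nmem \<rho> ''i'' 0)"
      using abc sC by (auto simp: agree_nmem[OF a] agree_rmem[OF a])
  qed auto
  have Y2: "stored_set m ''Y'' 0 \<sigma>2 = ?Y0" unfolding Y1[symmetric] by (rule stored_set_cong) (simp add: fr)
  have z: "rmem \<sigma>2 ''z'' 0 = sum s ?Y0" using size_of_spec[OF 2 sz1] Y1 sC by (simp add: fr)
  have inc2: "incumbent m n f ?I F \<sigma>2"
    by (rule incumbent_frame[OF 2 incumbent_frame[OF 1 inc]]) auto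
  have sC2: "rmem \<sigma>2 ''s'' = s" "rmem \<sigma>2 ''C'' 0 = C" using sC by (simp_all add: fr)
  have best2: "rmem \<sigma>2 ''best'' 0 = rmem \<sigma> ''best'' 0" by (simp add: fr)
  have "knap_inv m n f F s C \<tau> \<and> rmem \<sigma> ''best'' 0 \<le> rmem \<tau> ''best'' 0 \<and>
    (heavy m F Q a b c \<longrightarrow> (1 - 1 / exp 1) * F Q \<le> rmem \<tau> ''best'' 0)"
  proof (cases "sum s ?Y0 \<le> C")
    case False
    then have "\<tau> = \<sigma>2" using 3 z sC2 by simp
    \<comment> \<open>A start that exceeds the capacity cannot come from elements of a feasible
      \<open>Q\<close>, so no heavy triple is lost by skipping it.\<close>
    moreover have "\<not> heavy m F Q a b c"
    proof
      assume h: "heavy m F Q a b c"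
      then have abc: "{a, b, c} \<subseteq> Q" by (simp add: heavy_def)
      have finQ: "finite Q" using Q finite_subset by blast
      have "sum s ?Y0 = sum s {a, b, c}"
        using abc s Q by (intro sum.mono_neutral_right) (auto intro: antisym)
      also have "\<dots> \<le> sum s Q" using finQ abc s Q by (intro sum_mono2) auto
      finally show False using False Q by simp
    qed
    ultimately show ?thesis using inc2 sC2 best2 by (simp add: knap_inv_def)
  next
    case True
    then obtain \<sigma>3 \<sigma>4 where
      4: "reaches m f J (ForM ''g'' greedy_add) \<sigma>2 \<sigma>3" and 5: "reaches m f J (eval_obj ''Y'' ''v'') \<sigma>3 \<sigma>4" and
      6: "reaches m f J (keep ''Y'' ''v'' ''X'' ''best'') \<sigma>4 \<tau>"
      using 3 z sC2 by auto
    have F2: "wobj n f \<sigma>2 = F" using inc2 by (simp add: incumbent_def)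
    note g = greedy_loop_spec[OF 4 sz2 F F2 sC2(1) s sC2(2) Q Y2[symmetric] refl True]
    have inc3: "incumbent m n f ?I F \<sigma>3" by (rule incumbent_frame[OF 4 inc2]) auto
    have inc4: "incumbent m n f ?I F \<sigma>4" by (rule incumbent_frame[OF 5 inc3]) auto
    have Y4: "stored_set m ''Y'' 0 \<sigma>4 = stored_set m ''Y'' 0 \<sigma>3"
      by (rule stored_set_cong) (simp add: reaches_nmem[OF 5])
    have v4: "rmem \<sigma>4 ''v'' 0 = F (stored_set m ''Y'' 0 \<sigma>4)"
      using eval_obj_spec[OF 5, of n] inc3 Y4 by (simp add: incumbent_def)
    have Yf: "stored_set m ''Y'' 0 \<sigma>4 \<in> ?I" using g Y4 by simp
    have best4: "rmem \<sigma>4 ''best'' 0 = rmem \<sigma> ''best'' 0"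
      using best2 by (simp add: reaches_rmem[OF 4] reaches_rmem[OF 5])
    note k = keep_incumbent[OF 6 inc4 Yf _ v4]
    have "rmem \<tau> ''s'' = s" "rmem \<tau> ''C'' 0 = C"
      using sC2 by (simp_all add: reaches_rmem[OF 4] reaches_rmem[OF 5] reaches_rmem[OF 6])
    then show ?thesis using k g best4 Y4 by (auto simp: knap_inv_def)
  qed
  then show "knap_inv m n f F s C \<tau>" "rmem \<sigma> ''best'' 0 \<le> rmem \<tau> ''best'' 0"
    "heavy m F Q a b c \<Longrightarrow> (1 - 1 / exp 1) * F Q \<le> rmem \<tau> ''best'' 0" by auto
qed

text \<open>\<open>Q\<close> is arbitrary but the same throughout the run. As \<open>best\<close>
  never decreases, the bound obtained from a heavy triple of \<open>Q\<close> persists through the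
  three nested loops.\<close>

lemma knap_spec:
  assumes ex: "reaches m f J knap_prog \<sigma> \<tau>" and sz: "sizes m n \<sigma>" and F: "objective {..<m} (wobj n f \<sigma>)"
    and s: "\<And>e. e < m \<Longrightarrow> 0 \<le> rmem \<sigma> ''s'' e" "0 \<le> rmem \<sigma> ''C'' 0"
    and Q: "Q \<in> feasible m (Knapsack (rmem \<sigma> ''s'') (rmem \<sigma> ''C'' 0))"
  shows "stored_set m ''X'' 0 \<tau> \<in> feasible m (Knapsack (rmem \<sigma> ''s'') (rmem \<sigma> ''C'' 0))"
    and "(1 - 1 / exp 1) * wobj n f \<sigma> Q \<le> wobj n f \<sigma> (stored_set m ''X'' 0 \<tau>)"
proof -
  define F where "F = wobj n f \<sigma>"
  define s' where "s' = rmem \<sigma> ''s''"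
  define C where "C = rmem \<sigma> ''C'' 0"
  let ?I = "knap_inv m n f F s' C"
  let ?hit = "\<lambda>\<rho>. (1 - 1 / exp 1) * F Q \<le> rmem \<rho> ''best'' 0"
  have F': "objective {..<m} F" using F by (simp add: F_def)
  have s'': "\<And>e. e < m \<Longrightarrow> 0 \<le> s' e" "0 \<le> C" using s by (auto simp: s'_def C_def)
  have Q': "Q \<subseteq> {..<m}" "sum s' Q \<le> C" using Q by (auto simp: s'_def C_def)
  obtain \<sigma>1 where 1: "reaches m f J (compr ''X'' (NLess (NConst 0) (NConst 0))) \<sigma> \<sigma>1" and
    2: "reaches m f J (ForM ''a'' (ForM ''b'' (ForM ''c'' knap_triple))) (rstore ''best'' 0 0 \<sigma>1) \<tau>"
    using ex by (auto simp: knap_prog_def)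
  let ?\<sigma>2 = "rstore ''best'' 0 0 \<sigma>1"
  have "stored_set m ''X'' 0 \<sigma>1 = {e. e < m \<and> False}" by (rule compr_spec[OF 1 sz]) auto
  then have X2: "stored_set m ''X'' 0 ?\<sigma>2 = {}" by (simp add: stored_set_0)
  have F2: "wobj n f ?\<sigma>2 = F" unfolding F_def by (rule wobj_cong) (simp_all add: reaches_rmem[OF 1])
  have inv2: "?I ?\<sigma>2"
    using X2 F2 reaches_sizes[OF 1 sz] s''(2) objective_empty[OF F']
    by (simp add: knap_inv_def incumbent_def reaches_rmem[OF 1] s'_def C_def)
  have c_loop: "?I \<rho>' \<and> (?hit \<rho> \<longrightarrow> ?hit \<rho>') \<and> (\<forall>c<m. heavy m F Q a b c \<longrightarrow> ?hit \<rho>')"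
    if e: "reaches m f J (ForM ''c'' knap_triple) \<rho> \<rho>'" and I: "?I \<rho>"
      and ab: "nmem \<rho> ''a'' 0 = a" "nmem \<rho> ''b'' 0 = b" for \<rho> \<rho>' a b
  proof (rule ForM_inv[where P = "\<lambda>j \<rho>'. ?I \<rho>' \<and> (?hit \<rho> \<longrightarrow> ?hit \<rho>') \<and> (\<forall>c<j. heavy m F Q a b c \<longrightarrow> ?hit \<rho>')", OF e])
    fix j \<mu> \<mu>'
    assume j: "nmem \<mu> ''c'' 0 = j"
      and P: "?I \<mu> \<and> (?hit \<rho> \<longrightarrow> ?hit \<mu>) \<and> (\<forall>c<j. heavy m F Q a b c \<longrightarrow> ?hit \<mu>)"
      and ag: "agree (insert ''c'' (modN knap_triple)) (modR knap_triple) \<rho> \<mu>" and e: "reaches m f J knap_triple \<mu> \<mu>'"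
    have "nmem \<mu> ''a'' 0 = a" "nmem \<mu> ''b'' 0 = b" using ab by (simp_all add: agree_nmem[OF ag])
    note t = knap_triple_spec[OF e _ F' s''(1) Q' this j]
    have "?I \<mu>'" "rmem \<mu> ''best'' 0 \<le> rmem \<mu>' ''best'' 0" "heavy m F Q a b j \<Longrightarrow> ?hit \<mu>'"
      using t P by auto
    moreover from this(2) have "?hit \<mu> \<Longrightarrow> ?hit \<mu>'" by linarith
    ultimately show "?I \<mu>' \<and> (?hit \<rho> \<longrightarrow> ?hit \<mu>') \<and> (\<forall>c<Suc j. heavy m F Q a b c \<longrightarrow> ?hit \<mu>')"
      using P by (auto simp: less_Suc_eq)
  qed (use I in \<open>auto simp: knap_inv_def incumbent_def stored_set_0\<close>)
  have b_loop: "?I \<rho>' \<and> (?hit \<rho> \<longrightarrow> ?hit \<rho>') \<and> (\<forall>b<m. \<forall>c<m. heavy m F Q a b c \<longrightarrow> ?hit \<rho>')"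
    if e: "reaches m f J (ForM ''b'' (ForM ''c'' knap_triple)) \<rho> \<rho>'" and I: "?I \<rho>"
      and a: "nmem \<rho> ''a'' 0 = a" for \<rho> \<rho>' a
  proof (rule ForM_inv[where P = "\<lambda>j \<rho>'. ?I \<rho>' \<and> (?hit \<rho> \<longrightarrow> ?hit \<rho>') \<and> (\<forall>b<j. \<forall>c<m. heavy m F Q a b c \<longrightarrow> ?hit \<rho>')", OF e])
    fix j \<mu> \<mu>'
    assume j: "nmem \<mu> ''b'' 0 = j"
      and P: "?I \<mu> \<and> (?hit \<rho> \<longrightarrow> ?hit \<mu>) \<and> (\<forall>b<j. \<forall>c<m. heavy m F Q a b c \<longrightarrow> ?hit \<mu>)"
      and ag: "agree (insert ''b'' (modN (ForM ''c'' knap_triple))) (modR (ForM ''c'' knap_triple)) \<rho> \<mu>"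
      and e: "reaches m f J (ForM ''c'' knap_triple) \<mu> \<mu>'"
    have "nmem \<mu> ''a'' 0 = a" using a by (simp add: agree_nmem[OF ag])
    from c_loop[OF e _ this j] P
    show "?I \<mu>' \<and> (?hit \<rho> \<longrightarrow> ?hit \<mu>') \<and> (\<forall>b<Suc j. \<forall>c<m. heavy m F Q a b c \<longrightarrow> ?hit \<mu>')"
      by (auto simp: less_Suc_eq)
  qed (use I in \<open>auto simp: knap_inv_def incumbent_def stored_set_0\<close>)
  have a_loop: "?I \<tau> \<and> (\<forall>a<m. \<forall>b<m. \<forall>c<m. heavy m F Q a b c \<longrightarrow> ?hit \<tau>)"
  proof (rule ForM_inv[where P = "\<lambda>j \<rho>'. ?I \<rho>' \<and> (\<forall>a<j. \<forall>b<m. \<forall>c<m. heavy m F Q a b c \<longrightarrow> ?hit \<rho>')", OF 2])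
    fix j \<mu> \<mu>'
    assume j: "nmem \<mu> ''a'' 0 = j"
      and P: "?I \<mu> \<and> (\<forall>a<j. \<forall>b<m. \<forall>c<m. heavy m F Q a b c \<longrightarrow> ?hit \<mu>)"
      and e: "reaches m f J (ForM ''b'' (ForM ''c'' knap_triple)) \<mu> \<mu>'"
    from b_loop[OF e _ j] P
    show "?I \<mu>' \<and> (\<forall>a<Suc j. \<forall>b<m. \<forall>c<m. heavy m F Q a b c \<longrightarrow> ?hit \<mu>')"
      by (auto simp: less_Suc_eq)
  qed (use inv2 in \<open>auto simp: knap_inv_def incumbent_def stored_set_0\<close>)
  have "stored_set m ''X'' 0 \<tau> \<in> feasible m (Knapsack s' C)"
    and best: "rmem \<tau> ''best'' 0 = F (stored_set m ''X'' 0 \<tau>)"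
    using a_loop by (simp_all add: knap_inv_def incumbent_def)
  then show "stored_set m ''X'' 0 \<tau> \<in> feasible m (Knapsack (rmem \<sigma> ''s'') (rmem \<sigma> ''C'' 0))"
    by (simp add: s'_def C_def)
  have "(1 - 1 / exp 1) * F Q \<le> F (stored_set m ''X'' 0 \<tau>)"
  proof (cases "Q = {}")
    \<comment> \<open>An empty \<open>Q\<close> has no triple, but its value is 0.\<close>
    case True
    then show ?thesis using objective_empty[OF F'] objective_nonneg[OF F' stored_set_subset] by simp
  next
    case False
    obtain a b c where "a \<in> Q" "b \<in> Q" "c \<in> Q" "heavy m F Q a b c"
      using heavy_triple[OF F' Q'(1) _ False] finite_subset[OF Q'(1)] by (auto simp: heavy_def)
    then show ?thesis using a_loop Q'(1) unfolding best[symmetric] by blast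
  qed
  then show "(1 - 1 / exp 1) * wobj n f \<sigma> Q \<le> wobj n f \<sigma> (stored_set m ''X'' 0 \<tau>)"
    by (simp add: F_def)
qed


section \<open>The algorithm for a matroid\<close>

fun member_test :: "nat list \<Rightarrow> nexp \<Rightarrow> bexp" where
  "member_test [] a = NLess a a"
| "member_test (j # js) a = BNot (BAnd (neq a (NConst j)) (BNot (member_test js a)))"

lemma bval_member_test [simp]: "bval (member_test js a) \<sigma> \<longleftrightarrow> nval a \<sigma> \<in> set js"
  by (induction js) auto

text \<open>The sum over the index sets is unrolled into program text, whose length depends on \<open>l\<close> only.\<close>

fun eval_parts :: "nat \<Rightarrow> nat list list \<Rightarrow> string \<Rightarrow> string \<Rightarrow> com" where
  "eval_parts l [] x out = Skip"
| "eval_parts l (js # jss) x out =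
     Seq (compr ''R'' (member_test js (NGet x (nv ''i'')))) (Seq (eval_obj ''R'' ''gt'')
       (Seq (rset out (RAdd (rv out) (RMul (RDiv (RNat (NConst (ls_num l (length js)))) (RNat (NConst (ls_den l (length js))))) (rv ''gt''))))
         (eval_parts l jss x out)))"

definition eval_potential :: "nat \<Rightarrow> string \<Rightarrow> string \<Rightarrow> com" where
  "eval_potential l x out = Seq (rset out (RNat (NConst 0))) (eval_parts l (List.subseqs [1..<Suc l]) x out)"

lemma mod_eval_parts:
  "modN (eval_parts l jss x out) = (if jss = [] then {} else {''i'', ''R'', ''k''})"
  "modR (eval_parts l jss x out) = (if jss = [] then {} else {''gt'', ''tv'', out})"
  by (induction jss) auto

lemma subseqs_not_Nil: "List.subseqs xs \<noteq> []"
  by (induction xs) (auto simp: Let_def)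

lemma mod_eval_potential [simp]:
  "modN (eval_potential l x out) = {''i'', ''R'', ''k''}"
  "modR (eval_potential l x out) = {''gt'', ''tv'', out}"
  by (auto simp: eval_potential_def mod_eval_parts subseqs_not_Nil)

lemma polytime_eval_potential: "polytime (eval_potential l x out)"
proof -
  have "polytime (eval_parts l jss x out)" for jss
    by (induction jss) (auto intro!: polytime_intros polytime_subroutines)
  then show ?thesis unfolding eval_potential_def by (intro polytime_intros)
qed

lemma eval_parts_spec:
  assumes "reaches m f J (eval_parts l jss x out) \<sigma> \<tau>" "sizes m n \<sigma>" "x \<notin> {''i'', ''R'', ''k''}"
    "out \<notin> {''tv'', ''gt'', ''B'', ''w''}"
  shows "rmem \<tau> out 0 = rmem \<sigma> out 0 +
    (\<Sum>js\<leftarrow>jss. ls_coeff l (length js) * wobj n f \<sigma> (labelled {..<m} (nmem \<sigma> x) (set js)))"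
  using assms
proof (induction jss arbitrary: \<sigma>)
  case (Cons js jss)
  obtain \<sigma>1 \<sigma>2 where
    1: "reaches m f J (compr ''R'' (member_test js (NGet x (nv ''i'')))) \<sigma> \<sigma>1" and
    2: "reaches m f J (eval_obj ''R'' ''gt'') \<sigma>1 \<sigma>2" and
    3: "reaches m f J (eval_parts l jss x out) (rstore out 0 (rmem \<sigma>2 out 0 + ls_coeff l (length js) * rmem \<sigma>2 ''gt'' 0) \<sigma>2) \<tau>"
      (is "reaches m f J _ ?\<sigma>3 \<tau>")
    using Cons.prems(1) by (auto simp: ls_coeff_def)
  note fr = reaches_nmem[OF 1] reaches_rmem[OF 1] reaches_nmem[OF 2] reaches_rmem[OF 2]
  have s1: "sizes m n \<sigma>1" using reaches_sizes[OF 1 Cons.prems(2)] by simp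
  have s3: "sizes m n ?\<sigma>3" using reaches_sizes[OF 2 s1] by simp
  have "stored_set m ''R'' 0 \<sigma>1 = {e. e < m \<and> nmem \<sigma> x e \<in> set js}"
  proof (rule compr_spec[OF 1 Cons.prems(2)])
    fix \<rho> assume a: "agree {''i'', ''R''} {} \<sigma> \<rho>"
    show "bval (member_test js (NGet x (nv ''i''))) \<rho> \<longleftrightarrow> nmem \<sigma> x (nmem \<rho> ''i'' 0) \<in> set js"
      using Cons.prems(3) agree_nmem[OF a, of x] by simp
  qed auto
  then have R: "stored_set m ''R'' 0 \<sigma>1 = labelled {..<m} (nmem \<sigma> x) (set js)" by (auto simp: labelled_def)
  have F1: "wobj n f \<sigma>1 = wobj n f \<sigma>" by (rule wobj_cong) (simp_all add: fr)
  have F3: "wobj n f ?\<sigma>3 = wobj n f \<sigma>" using Cons.prems(4) by (intro wobj_cong) (simp_all add: fr)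
  have "rmem \<sigma>2 ''gt'' 0 = wobj n f \<sigma> (labelled {..<m} (nmem \<sigma> x) (set js))"
    using eval_obj_spec[OF 2 s1] R F1 by simp
  moreover have "nmem ?\<sigma>3 x = nmem \<sigma> x" using Cons.prems(3) by (simp add: fr)
  moreover have "rmem \<sigma>2 out 0 = rmem \<sigma> out 0" using Cons.prems(4) by (simp add: fr)
  ultimately show ?case using Cons.IH[OF 3 s3 Cons.prems(3,4)] F3 by simp
qed simp

lemma eval_potential_spec:
  assumes ex: "reaches m f J (eval_potential l x out) \<sigma> \<tau>" and s: "sizes m n \<sigma>" and x: "x \<notin> {''i'', ''R'', ''k''}"
    and out: "out \<notin> {''tv'', ''gt'', ''B'', ''w''}"
  shows "rmem \<tau> out 0 = ls_potential l {..<m} (wobj n f \<sigma>) (nmem \<sigma> x)"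
proof -
  let ?xs = "[1..<Suc l]" and ?F = "wobj n f \<sigma>"
  let ?h = "\<lambda>A. ls_coeff l (card A) * ?F (labelled {..<m} (nmem \<sigma> x) A)"
  have ex': "reaches m f J (eval_parts l (List.subseqs ?xs) x out) (rstore out 0 0 \<sigma>) \<tau>"
    using ex by (simp add: eval_potential_def)
  have F: "wobj n f (rstore out 0 0 \<sigma>) = ?F" using out by (intro wobj_cong) auto
  have "rmem \<tau> out 0 = (\<Sum>js\<leftarrow>List.subseqs ?xs. ls_coeff l (length js) * ?F (labelled {..<m} (nmem \<sigma> x) (set js)))"
    using eval_parts_spec[OF ex' _ x out] s F by simp
  also have "\<dots> = (\<Sum>js\<leftarrow>List.subseqs ?xs. ?h (set js))"
    using distinct_card subseqs_distinctD[of _ ?xs]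
    by (intro arg_cong[of _ _ sum_list] map_cong refl) (simp add: distinct_card)
  also have "\<dots> = (\<Sum>A\<leftarrow>map set (List.subseqs ?xs). ?h A)" by (simp add: comp_def)
  \<comment> \<open>For a list without repetitions \<open>subseqs\<close> produces every subset
    exactly once, so the unrolled sum is the sum over \<open>Pow\<close>.\<close>
  also have "\<dots> = (\<Sum>A\<in>set (map set (List.subseqs ?xs)). ?h A)"
    by (rule sum.distinct_set_conv_list[symmetric]) (rule distinct_set_subseqs, simp)
  also have "set (map set (List.subseqs ?xs)) = Pow (set ?xs)" by (simp only: set_map subseqs_powset)
  also have "set ?xs = {1..l}" by auto
  finally show ?thesis by (simp add: ls_potential_def)
qed

text \<open>\<open>u\<close> loses its label, then \<open>v\<close>, if unlabelled, gets label h +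
  1, as \<open>h\<close> counts from 0. Because \<open>u\<close> is cleared before \<open>v\<close>
  is tested, \<open>v = u\<close> yields a relabelling. The array of labels itself is queried for
  independence: its nonzero entries are the indicator of the candidate base.\<close>

definition ls_try :: "nat \<Rightarrow> com" where
  "ls_try l = Seq (copy ''L'' ''Q'') (Seq (NAssign ''Q'' (nv ''u'') (NConst 0))
     (Cond (NLess (NConst 0) (NGet ''Q'' (nv ''v''))) Skip
       (Seq (NAssign ''Q'' (nv ''v'') (NAdd (nv ''h'') (NConst 1))) (Seq (Indep ''t'' (NConst 0) ''Q'')
         (Cond (NLess (NConst 0) (nv ''t''))
           (Seq (eval_potential l ''Q'' ''gv'') (keep ''Q'' ''gv'' ''BL'' ''bg'')) Skip)))))"

definition ls_step :: "nat \<Rightarrow> com" where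
  "ls_step l = Seq (eval_obj ''L'' ''v'') (Seq (keep ''L'' ''v'' ''X'' ''best'') (Seq (eval_potential l ''L'' ''bg'')
     (Seq (copy ''L'' ''BL'') (Seq (ForM ''u'' (ForM ''v'' (For ''h'' (NLess (nv ''h'') (NConst l)) (ls_try l))))
       (copy ''BL'' ''L'')))))"

lemma mod_ls_try [simp]:
  "modN (ls_try l) = {''i'', ''R'', ''k'', ''Q'', ''t'', ''BL''}"
  "modR (ls_try l) = {''gt'', ''tv'', ''gv'', ''bg''}"
  by (auto simp: ls_try_def)

lemma mod_ls_step [simp]:
  "modN (ls_step l) = {''i'', ''R'', ''k'', ''Q'', ''t'', ''BL'', ''L'', ''X'', ''u'', ''v'', ''h''}"
  "modR (ls_step l) = {''gt'', ''tv'', ''gv'', ''bg'', ''v'', ''best''}"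
  by (auto simp: ls_step_def)

lemma polytime_ls_step: "polytime (ls_step l)"
proof -
  have "polytime (For ''h'' (NLess (nv ''h'') (NConst l)) (ls_try l))"
    by (rule polytime_For[where L = "\<lambda>m n. l"])
      (auto simp: poly_bounded_const ls_try_def intro!: polytime_intros polytime_subroutines polytime_eval_potential)
  then show ?thesis unfolding ls_step_def
    by (intro polytime_intros polytime_subroutines polytime_eval_potential) auto
qed

lemma labelled_cong: "(\<And>e. e \<in> E \<Longrightarrow> L e = L' e) \<Longrightarrow> labelled E L = labelled E L'"
  by (auto simp: labelled_def fun_eq_iff)

lemma ls_potential_cong: "(\<And>e. e \<in> E \<Longrightarrow> L e = L' e) \<Longrightarrow> ls_potential l E F L = ls_potential l E F L'"
  using labelled_cong[of E L L'] by (simp add: ls_potential_def)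

definition basis_labelling :: "nat \<Rightarrow> nat set set \<Rightarrow> nat \<Rightarrow> (nat \<Rightarrow> nat) \<Rightarrow> bool" where
  "basis_labelling m \<I> l L \<longleftrightarrow> (\<forall>e<m. L e \<le> l) \<and> basis \<I> {e. e < m \<and> L e \<noteq> 0}"

lemma basis_labelling_cong:
  "(\<And>e. e < m \<Longrightarrow> L e = L' e) \<Longrightarrow> basis_labelling m \<I> l L = basis_labelling m \<I> l L'"
proof -
  assume a: "\<And>e. e < m \<Longrightarrow> L e = L' e"
  then have "{e. e < m \<and> L e \<noteq> 0} = {e. e < m \<and> L' e \<noteq> 0}" by auto
  with a show ?thesis by (simp add: basis_labelling_def)
qed

text \<open>Independence is all that has to be queried: the swap does not shrink the set, and an
  independent set at least as large as a base is a base.\<close>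

lemma basis_labelling_swap:
  assumes M: "matroid {..<m} \<I>" and L: "basis_labelling m \<I> l L" and v: "v < m" "(L(u := 0)) v = 0" and h: "h < l"
    and ind: "{e. e < m \<and> (L(u := 0, v := Suc h)) e \<noteq> 0} \<in> \<I>" (is "?S' \<in> \<I>")
  shows "basis_labelling m \<I> l (L(u := 0, v := Suc h))"
proof -
  let ?S = "{e. e < m \<and> L e \<noteq> 0}"
  have eq: "?S' = insert v (?S - {u})" using v by auto
  have "v \<notin> ?S - {u}" using v by (auto split: if_splits)
  then have "card ?S' = Suc (card (?S - {u}))" unfolding eq by (intro card_insert_disjoint) auto
  moreover have "card ?S \<le> Suc (card (?S - {u}))" using card_Suc_Diff1[of ?S u] by (cases "u \<in> ?S") auto
  ultimately have "card ?S \<le> card ?S'" by simp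
  then have "basis \<I> ?S'" using L ind unfolding basis_labelling_def basis_def by (meson order_trans)
  moreover have "\<forall>e<m. (L(u := 0, v := Suc h)) e \<le> l" using L h by (auto simp: basis_labelling_def)
  ultimately show ?thesis by (simp add: basis_labelling_def)
qed

text \<open>\<open>BL\<close> holds the best labelling found so far, starting from the current labelling \<open>L0\<close>.\<close>

definition ls_inv ::
  "nat \<Rightarrow> nat \<Rightarrow> (nat \<Rightarrow> nat set \<Rightarrow> real) \<Rightarrow> nat set set \<Rightarrow> (nat set \<Rightarrow> real) \<Rightarrow> nat \<Rightarrow> (nat \<Rightarrow> nat) \<Rightarrow> state \<Rightarrow> bool" where
  "ls_inv m n f \<I> F l L0 \<sigma> \<longleftrightarrow> sizes m n \<sigma> \<and> wobj n f \<sigma> = F \<and> (\<forall>e<m. nmem \<sigma> ''L'' e = L0 e) \<and>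
     basis_labelling m \<I> l (nmem \<sigma> ''BL'') \<and> rmem \<sigma> ''bg'' 0 = ls_potential l {..<m} F (nmem \<sigma> ''BL'')"

lemma ls_inv_store [simp]:
  "x \<notin> {''m'', ''n'', ''L'', ''BL''} \<Longrightarrow> ls_inv m n f \<I> F l L0 (nstore x i v \<sigma>) = ls_inv m n f \<I> F l L0 \<sigma>"
  by (simp add: ls_inv_def)

lemma ls_try_spec:
  assumes ex: "reaches m f \<I> (ls_try l) \<sigma> \<tau>" and inv: "ls_inv m n f \<I> F l L0 \<sigma>"
    and M: "matroid {..<m} \<I>" and L0: "basis_labelling m \<I> l L0"
    and uvh: "nmem \<sigma> ''u'' 0 = u" "nmem \<sigma> ''v'' 0 = v" "nmem \<sigma> ''h'' 0 = h" "u < m" "v < m" "h < l"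
  shows "ls_inv m n f \<I> F l L0 \<tau>" and "rmem \<sigma> ''bg'' 0 \<le> rmem \<tau> ''bg'' 0"
    and "(L0(u := 0)) v = 0 \<Longrightarrow> {e. e < m \<and> (L0(u := 0, v := Suc h)) e \<noteq> 0} \<in> \<I> \<Longrightarrow>
      ls_potential l {..<m} F (L0(u := 0, v := Suc h)) \<le> rmem \<tau> ''bg'' 0"
proof -
  let ?L' = "L0(u := 0, v := Suc h)"
  have sz: "sizes m n \<sigma>" and F: "wobj n f \<sigma> = F" and L: "\<And>e. e < m \<Longrightarrow> nmem \<sigma> ''L'' e = L0 e"
    and BL: "basis_labelling m \<I> l (nmem \<sigma> ''BL'')" "rmem \<sigma> ''bg'' 0 = ls_potential l {..<m} F (nmem \<sigma> ''BL'')"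
    using inv by (auto simp: ls_inv_def)
  obtain \<sigma>1 where
    1: "reaches m f \<I> (copy ''L'' ''Q'') \<sigma> \<sigma>1" and
    2: "reaches m f \<I> (Cond (NLess (NConst 0) (NGet ''Q'' (nv ''v''))) Skip
       (Seq (NAssign ''Q'' (nv ''v'') (NAdd (nv ''h'') (NConst 1))) (Seq (Indep ''t'' (NConst 0) ''Q'')
         (Cond (NLess (NConst 0) (nv ''t''))
           (Seq (eval_potential l ''Q'' ''gv'') (keep ''Q'' ''gv'' ''BL'' ''bg'')) Skip))))
      (nstore ''Q'' u 0 \<sigma>1) \<tau>" (is "reaches m f \<I> _ ?\<sigma>2 \<tau>")
    using ex uvh by (auto simp: ls_try_def reaches_nmem simp del: reaches_Cond)
  note fr = reaches_nmem[OF 1] reaches_rmem[OF 1]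
  have Q1: "nmem \<sigma>1 ''Q'' e = L0 e" if "e < m" for e using copy_spec[OF 1 sz _ _ that] L[OF that] by simp
  have sz2: "sizes m n ?\<sigma>2" using reaches_sizes[OF 1 sz] by simp
  have Q2: "nmem ?\<sigma>2 ''Q'' e = (L0(u := 0)) e" if "e < m" for e using Q1[OF that] by simp
  have F2: "wobj n f ?\<sigma>2 = F" unfolding F[symmetric] by (rule wobj_cong) (simp_all add: fr)
  have inv2: "ls_inv m n f \<I> F l L0 ?\<sigma>2"
    using inv sz2 F2 by (simp add: ls_inv_def fr)
  have "ls_inv m n f \<I> F l L0 \<tau> \<and> rmem \<sigma> ''bg'' 0 \<le> rmem \<tau> ''bg'' 0 \<and>
    ((L0(u := 0)) v = 0 \<longrightarrow> {e. e < m \<and> ?L' e \<noteq> 0} \<in> \<I> \<longrightarrow> ls_potential l {..<m} F ?L' \<le> rmem \<tau> ''bg'' 0)"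
  proof (cases "(L0(u := 0)) v = 0")
    case False
    then have "\<tau> = ?\<sigma>2" using 2 Q2[OF uvh(5)] uvh(2) by (simp add: fr)
    with False inv2 show ?thesis by (simp add: fr)
  next
    case v0: True
    let ?\<sigma>3 = "nstore ''Q'' v (Suc h) ?\<sigma>2"
    have 3: "reaches m f \<I> (Seq (Indep ''t'' (NConst 0) ''Q'') (Cond (NLess (NConst 0) (nv ''t''))
           (Seq (eval_potential l ''Q'' ''gv'') (keep ''Q'' ''gv'' ''BL'' ''bg'')) Skip)) ?\<sigma>3 \<tau>"
      using 2 v0 Q2[OF uvh(5)] uvh by (simp add: fr)
    have Q3: "nmem ?\<sigma>3 ''Q'' e = ?L' e" if "e < m" for e using Q2[OF that] by simp
    have inv3: "ls_inv m n f \<I> F l L0 ?\<sigma>3" using inv2 by simp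
    have set3: "stored_set m ''Q'' 0 ?\<sigma>3 = {e. e < m \<and> ?L' e \<noteq> 0}" unfolding stored_set_0 by (intro Collect_cong conj_cong refl) (simp only: Q3)
    show ?thesis
    proof (cases "{e. e < m \<and> ?L' e \<noteq> 0} \<in> \<I>")
      case False
      then have "\<tau> = nstore ''t'' 0 0 ?\<sigma>3" using 3 unfolding set3[symmetric] by simp
      with False inv3 show ?thesis by (simp add: fr)
    next
      case True
      let ?\<sigma>4 = "nstore ''t'' 0 1 ?\<sigma>3"
      obtain \<sigma>5 where 5: "reaches m f \<I> (eval_potential l ''Q'' ''gv'') ?\<sigma>4 \<sigma>5" and
        6: "reaches m f \<I> (keep ''Q'' ''gv'' ''BL'' ''bg'') \<sigma>5 \<tau>"
        using 3 True unfolding set3[symmetric] by auto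
      note fr' = reaches_nmem[OF 5] reaches_rmem[OF 5]
      have inv4: "ls_inv m n f \<I> F l L0 ?\<sigma>4" using inv3 by simp
      then have sz4: "sizes m n ?\<sigma>4" and F4: "wobj n f ?\<sigma>4 = F" by (simp_all add: ls_inv_def)
      have sz5: "sizes m n \<sigma>5" using reaches_sizes[OF 5 sz4] by simp
      have F5: "wobj n f \<sigma>5 = F" unfolding F4[symmetric] by (rule wobj_cong) (simp_all add: fr')
      have Q5: "nmem \<sigma>5 ''Q'' e = ?L' e" if "e < m" for e using Q3[OF that] by (simp add: fr')
      have "rmem \<sigma>5 ''gv'' 0 = ls_potential l {..<m} F (nmem ?\<sigma>4 ''Q'')"
        using eval_potential_spec[OF 5 sz4] F4 by simp
      also have "\<dots> = ls_potential l {..<m} F ?L'" using Q3 by (intro ls_potential_cong) simp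
      finally have gv: "rmem \<sigma>5 ''gv'' 0 = ls_potential l {..<m} F ?L'" .
      have bg5: "rmem \<sigma>5 ''bg'' 0 = rmem \<sigma> ''bg'' 0" by (simp add: fr fr')
      have BL5: "nmem \<sigma>5 ''BL'' = nmem \<sigma> ''BL''" by (simp add: fr fr')
      have L5: "nmem \<sigma>5 ''L'' = nmem \<sigma> ''L''" by (simp add: fr fr')
      have bg: "rmem \<tau> ''bg'' 0 = max (rmem \<sigma> ''bg'' 0) (ls_potential l {..<m} F ?L')"
        using keep_spec(1)[OF 6 sz5] gv bg5 by simp
      have sz\<tau>: "sizes m n \<tau>" using reaches_sizes[OF 6 sz5] by simp
      have F\<tau>: "wobj n f \<tau> = F" unfolding F5[symmetric] by (rule wobj_cong) (simp_all add: reaches_rmem[OF 6])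
      have L\<tau>: "nmem \<tau> ''L'' = nmem \<sigma> ''L''" using L5 by (simp add: reaches_nmem[OF 6])
      have "basis_labelling m \<I> l (nmem \<tau> ''BL'') \<and> rmem \<tau> ''bg'' 0 = ls_potential l {..<m} F (nmem \<tau> ''BL'')"
      proof -
        consider "\<tau> = \<sigma>5" | "rmem \<tau> ''bg'' 0 = rmem \<sigma>5 ''gv'' 0" "\<forall>e<m. nmem \<tau> ''BL'' e = nmem \<sigma>5 ''Q'' e"
          using keep_spec(2)[OF 6 sz5] by auto
        then show ?thesis
        proof cases
          case 1
          then show ?thesis using BL bg5 BL5 by simp
        next
          case 2
          then have eq: "nmem \<tau> ''BL'' e = ?L' e" if "e < m" for e using Q5 that by simp
          have "basis_labelling m \<I> l (nmem \<tau> ''BL'') = basis_labelling m \<I> l ?L'"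
            by (rule basis_labelling_cong) (rule eq)
          moreover have "ls_potential l {..<m} F (nmem \<tau> ''BL'') = ls_potential l {..<m} F ?L'"
            by (rule ls_potential_cong) (simp add: eq)
          moreover have "basis_labelling m \<I> l ?L'" by (rule basis_labelling_swap[OF M L0 uvh(5) v0 uvh(6) True])
          ultimately show ?thesis using 2(1) gv by simp
        qed
      qed
      then have "ls_inv m n f \<I> F l L0 \<tau>" using sz\<tau> F\<tau> L\<tau> L by (simp add: ls_inv_def)
      with bg show ?thesis by simp
    qed
  qed
  then show "ls_inv m n f \<I> F l L0 \<tau>" "rmem \<sigma> ''bg'' 0 \<le> rmem \<tau> ''bg'' 0"
    "(L0(u := 0)) v = 0 \<Longrightarrow> {e. e < m \<and> (L0(u := 0, v := Suc h)) e \<noteq> 0} \<in> \<I> \<Longrightarrow>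
      ls_potential l {..<m} F (L0(u := 0, v := Suc h)) \<le> rmem \<tau> ''bg'' 0" by auto
qed

text \<open>All swaps start from the same labelling \<open>L0\<close>, and \<open>bg\<close> only
  grows, so the value of a swap stays below \<open>bg\<close> from its trial to the end of the
  search.\<close>

lemma ls_search_spec:
  assumes ex: "reaches m f \<I> (ForM ''u'' (ForM ''v'' (For ''h'' (NLess (nv ''h'') (NConst l)) (ls_try l)))) \<sigma> \<tau>"
    and inv: "ls_inv m n f \<I> F l L0 \<sigma>" and M: "matroid {..<m} \<I>" and L0: "basis_labelling m \<I> l L0"
  shows "ls_inv m n f \<I> F l L0 \<tau>" and "rmem \<sigma> ''bg'' 0 \<le> rmem \<tau> ''bg'' 0"
    and "u < m \<Longrightarrow> v < m \<Longrightarrow> h < l \<Longrightarrow> (L0(u := 0)) v = 0 \<Longrightarrow> {e. e < m \<and> (L0(u := 0, v := Suc h)) e \<noteq> 0} \<in> \<I> \<Longrightarrow>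
      ls_potential l {..<m} F (L0(u := 0, v := Suc h)) \<le> rmem \<tau> ''bg'' 0"
proof -
  let ?I = "ls_inv m n f \<I> F l L0" and ?bg = "\<lambda>\<rho>. rmem \<rho> ''bg'' 0"
  let ?H = "\<lambda>u v h \<rho>. (L0(u := 0)) v = 0 \<longrightarrow> {e. e < m \<and> (L0(u := 0, v := Suc h)) e \<noteq> 0} \<in> \<I> \<longrightarrow>
      ls_potential l {..<m} F (L0(u := 0, v := Suc h)) \<le> ?bg \<rho>"
  let ?ch = "For ''h'' (NLess (nv ''h'') (NConst l)) (ls_try l)"
  have sz: "?I \<rho> \<Longrightarrow> sizes m n \<rho>" for \<rho> by (simp add: ls_inv_def)
  have h_loop: "?I \<rho>' \<and> ?bg \<rho> \<le> ?bg \<rho>' \<and> (\<forall>h<l. ?H u v h \<rho>')"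
    if e: "reaches m f \<I> ?ch \<rho> \<rho>'" and I: "?I \<rho>" and uv: "nmem \<rho> ''u'' 0 = u" "nmem \<rho> ''v'' 0 = v" "u < m" "v < m"
    for \<rho> \<rho>' u v
  proof (rule For_inv(1)[where P = "\<lambda>j \<rho>'. ?I \<rho>' \<and> ?bg \<rho> \<le> ?bg \<rho>' \<and> (\<forall>h<j. ?H u v h \<rho>')", OF e])
    fix j \<mu> \<mu>'
    assume j: "j < l" "nmem \<mu> ''h'' 0 = j" and P: "?I \<mu> \<and> ?bg \<rho> \<le> ?bg \<mu> \<and> (\<forall>h<j. ?H u v h \<mu>)"
      and ag: "agree (insert ''h'' (modN (ls_try l))) (modR (ls_try l)) \<rho> \<mu>" and e: "reaches m f \<I> (ls_try l) \<mu> \<mu>'"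
    have uv': "nmem \<mu> ''u'' 0 = u" "nmem \<mu> ''v'' 0 = v" using uv by (simp_all add: agree_nmem[OF ag])
    have I': "?I \<mu>" using P by blast
    note t = ls_try_spec[OF e I' M L0 uv' j(2) uv(3,4) j(1)]
    have "?H u v h \<mu>'" if "?H u v h \<mu>" for h using that t(2) by (meson order_trans)
    then show "?I \<mu>' \<and> ?bg \<rho> \<le> ?bg \<mu>' \<and> (\<forall>h<Suc j. ?H u v h \<mu>')"
      using P t unfolding less_Suc_eq by (meson order_trans)
  qed (use I in auto)
  have v_loop: "?I \<rho>' \<and> ?bg \<rho> \<le> ?bg \<rho>' \<and> (\<forall>v<m. \<forall>h<l. ?H u v h \<rho>')"
    if e: "reaches m f \<I> (ForM ''v'' ?ch) \<rho> \<rho>'" and I: "?I \<rho>" and u: "nmem \<rho> ''u'' 0 = u" "u < m" for \<rho> \<rho>' u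
  proof (rule ForM_inv[where P = "\<lambda>j \<rho>'. ?I \<rho>' \<and> ?bg \<rho> \<le> ?bg \<rho>' \<and> (\<forall>v<j. \<forall>h<l. ?H u v h \<rho>')", OF e])
    fix j \<mu> \<mu>'
    assume j: "j < m" "nmem \<mu> ''v'' 0 = j" and P: "?I \<mu> \<and> ?bg \<rho> \<le> ?bg \<mu> \<and> (\<forall>v<j. \<forall>h<l. ?H u v h \<mu>)"
      and ag: "agree (insert ''v'' (modN ?ch)) (modR ?ch) \<rho> \<mu>" and e: "reaches m f \<I> ?ch \<mu> \<mu>'"
    have u': "nmem \<mu> ''u'' 0 = u" using u by (simp add: agree_nmem[OF ag])
    have I': "?I \<mu>" using P by blast
    note t = h_loop[OF e I' u' j(2) u(2) j(1)]
    have "?H u v h \<mu>'" if "?H u v h \<mu>" for v h using that t by (meson order_trans)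
    then show "?I \<mu>' \<and> ?bg \<rho> \<le> ?bg \<mu>' \<and> (\<forall>v<Suc j. \<forall>h<l. ?H u v h \<mu>')"
      using P t unfolding less_Suc_eq by (meson order_trans)
  qed (use I sz[OF I] in simp_all)
  have "?I \<tau> \<and> ?bg \<sigma> \<le> ?bg \<tau> \<and> (\<forall>u<m. \<forall>v<m. \<forall>h<l. ?H u v h \<tau>)"
  proof (rule ForM_inv[where P = "\<lambda>j \<rho>'. ?I \<rho>' \<and> ?bg \<sigma> \<le> ?bg \<rho>' \<and> (\<forall>u<j. \<forall>v<m. \<forall>h<l. ?H u v h \<rho>')", OF ex])
    fix j \<mu> \<mu>'
    assume j: "j < m" "nmem \<mu> ''u'' 0 = j" and P: "?I \<mu> \<and> ?bg \<sigma> \<le> ?bg \<mu> \<and> (\<forall>u<j. \<forall>v<m. \<forall>h<l. ?H u v h \<mu>)"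
      and e: "reaches m f \<I> (ForM ''v'' ?ch) \<mu> \<mu>'"
    have I': "?I \<mu>" using P by blast
    note t = v_loop[OF e I' j(2,1)]
    have "?H u v h \<mu>'" if "?H u v h \<mu>" for u v h using that t by (meson order_trans)
    then show "?I \<mu>' \<and> ?bg \<sigma> \<le> ?bg \<mu>' \<and> (\<forall>u<Suc j. \<forall>v<m. \<forall>h<l. ?H u v h \<mu>')"
      using P t unfolding less_Suc_eq by (meson order_trans)
  qed (use inv sz[OF inv] in simp_all)
  then show "?I \<tau>" "?bg \<sigma> \<le> ?bg \<tau>"
    "u < m \<Longrightarrow> v < m \<Longrightarrow> h < l \<Longrightarrow> (L0(u := 0)) v = 0 \<Longrightarrow> {e. e < m \<and> (L0(u := 0, v := Suc h)) e \<noteq> 0} \<in> \<I> \<Longrightarrow>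
      ls_potential l {..<m} F (L0(u := 0, v := Suc h)) \<le> ?bg \<tau>" by blast+
qed

text \<open>The current base is offered to the incumbent before the move, since it is a base of low
  value that guarantees an improving swap. The search increases the potential and not
  \<open>F\<close> itself, hence the best base seen is kept rather than the last.\<close>

lemma ls_step_spec:
  assumes ex: "reaches m f \<I> (ls_step l) \<sigma> \<tau>" and inc: "incumbent m n f \<I> F \<sigma>"
    and L: "basis_labelling m \<I> l (nmem \<sigma> ''L'')" and M: "matroid {..<m} \<I>"
  shows "incumbent m n f \<I> F \<tau>" and "basis_labelling m \<I> l (nmem \<tau> ''L'')"
    and "rmem \<sigma> ''best'' 0 \<le> rmem \<tau> ''best'' 0"
    and "F {e. e < m \<and> nmem \<sigma> ''L'' e \<noteq> 0} \<le> rmem \<tau> ''best'' 0"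
    and "ls_potential l {..<m} F (nmem \<sigma> ''L'') \<le> ls_potential l {..<m} F (nmem \<tau> ''L'')"
    and "u < m \<Longrightarrow> v < m \<Longrightarrow> h < l \<Longrightarrow> ((nmem \<sigma> ''L'')(u := 0)) v = 0 \<Longrightarrow>
      {e. e < m \<and> ((nmem \<sigma> ''L'')(u := 0, v := Suc h)) e \<noteq> 0} \<in> \<I> \<Longrightarrow>
      ls_potential l {..<m} F ((nmem \<sigma> ''L'')(u := 0, v := Suc h)) \<le> ls_potential l {..<m} F (nmem \<tau> ''L'')"
proof -
  let ?L = "nmem \<sigma> ''L''" and ?pot = "ls_potential l {..<m} F"
  let ?loop = "ForM ''u'' (ForM ''v'' (For ''h'' (NLess (nv ''h'') (NConst l)) (ls_try l)))"
  obtain \<sigma>1 \<sigma>2 \<sigma>3 \<sigma>4 \<sigma>5 where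
    1: "reaches m f \<I> (eval_obj ''L'' ''v'') \<sigma> \<sigma>1" and 2: "reaches m f \<I> (keep ''L'' ''v'' ''X'' ''best'') \<sigma>1 \<sigma>2" and
    3: "reaches m f \<I> (eval_potential l ''L'' ''bg'') \<sigma>2 \<sigma>3" and 4: "reaches m f \<I> (copy ''L'' ''BL'') \<sigma>3 \<sigma>4" and
    5: "reaches m f \<I> ?loop \<sigma>4 \<sigma>5" and 6: "reaches m f \<I> (copy ''BL'' ''L'') \<sigma>5 \<tau>"
    using ex by (auto simp: ls_step_def)
  have sz: "sizes m n \<sigma>" and F: "wobj n f \<sigma> = F" using inc by (auto simp: incumbent_def)
  have inc1: "incumbent m n f \<I> F \<sigma>1" by (rule incumbent_frame[OF 1 inc]) auto
  have L1: "nmem \<sigma>1 ''L'' = ?L" by (simp add: reaches_nmem[OF 1])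
  have S: "stored_set m ''L'' 0 \<sigma>1 = {e. e < m \<and> ?L e \<noteq> 0}" by (simp add: stored_set_0 L1)
  have v1: "rmem \<sigma>1 ''v'' 0 = F (stored_set m ''L'' 0 \<sigma>1)"
    using eval_obj_spec[OF 1 sz] F L1 by (simp add: stored_set_0)
  have S1: "stored_set m ''L'' 0 \<sigma>1 \<in> \<I>" using L S by (simp add: basis_labelling_def basis_def)
  note k = keep_incumbent[OF 2 inc1 S1 _ v1]
  have inc2: "incumbent m n f \<I> F \<sigma>2" using k by simp
  have best2: "rmem \<sigma>2 ''best'' 0 = max (rmem \<sigma> ''best'' 0) (F {e. e < m \<and> ?L e \<noteq> 0})"
    using k(2) S by (simp add: reaches_rmem[OF 1])
  have L2: "nmem \<sigma>2 ''L'' = ?L" using L1 by (simp add: reaches_nmem[OF 2])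
  have inc3: "incumbent m n f \<I> F \<sigma>3" by (rule incumbent_frame[OF 3 inc2]) auto
  have inc4: "incumbent m n f \<I> F \<sigma>4" by (rule incumbent_frame[OF 4 inc3]) auto
  have inc5: "incumbent m n f \<I> F \<sigma>5" by (rule incumbent_frame[OF 5 inc4]) auto
  show "incumbent m n f \<I> F \<tau>" by (rule incumbent_frame[OF 6 inc5]) auto
  have best: "rmem \<tau> ''best'' 0 = rmem \<sigma>2 ''best'' 0"
    by (simp add: reaches_rmem[OF 3] reaches_rmem[OF 4] reaches_rmem[OF 5] reaches_rmem[OF 6])
  then show "rmem \<sigma> ''best'' 0 \<le> rmem \<tau> ''best'' 0" "F {e. e < m \<and> ?L e \<noteq> 0} \<le> rmem \<tau> ''best'' 0"
    using best2 by simp_all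
  have L3: "nmem \<sigma>3 ''L'' = ?L" and L4: "nmem \<sigma>4 ''L'' = ?L" using L2 by (simp_all add: reaches_nmem[OF 3] reaches_nmem[OF 4])
  have BL4: "nmem \<sigma>4 ''BL'' e = ?L e" if "e < m" for e
    using copy_spec[OF 4 _ _ _ that, of n] inc3 L3 by (simp add: incumbent_def)
  have bg4: "rmem \<sigma>4 ''bg'' 0 = ?pot ?L"
    using eval_potential_spec[OF 3, of n] inc2 L2 by (simp add: incumbent_def reaches_rmem[OF 4])
  have "ls_inv m n f \<I> F l ?L \<sigma>4"
    using inc4 L4 bg4 L basis_labelling_cong[OF BL4] ls_potential_cong[of "{..<m}" "nmem \<sigma>4 ''BL''" ?L l F] BL4
    by (simp add: ls_inv_def incumbent_def)
  note s = ls_search_spec[OF 5 this M L]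
  have L6: "nmem \<tau> ''L'' e = nmem \<sigma>5 ''BL'' e" if "e < m" for e
    using copy_spec[OF 6 _ _ _ that, of n] inc5 by (simp add: incumbent_def)
  have pot6: "?pot (nmem \<tau> ''L'') = rmem \<sigma>5 ''bg'' 0"
    using s(1) L6 ls_potential_cong[of "{..<m}" "nmem \<tau> ''L''" "nmem \<sigma>5 ''BL''" l F] by (simp add: ls_inv_def)
  show "basis_labelling m \<I> l (nmem \<tau> ''L'')"
    using s(1) basis_labelling_cong[OF L6] by (simp add: ls_inv_def)
  show "?pot ?L \<le> ?pot (nmem \<tau> ''L'')" using s(2) pot6 bg4 by simp
  show "?pot (?L(u := 0, v := Suc h)) \<le> ?pot (nmem \<tau> ''L'')"
    if "u < m" "v < m" "h < l" "(?L(u := 0)) v = 0" "{e. e < m \<and> (?L(u := 0, v := Suc h)) e \<noteq> 0} \<in> \<I>"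
    unfolding pot6 by (rule s(3)[OF that])
qed

definition base_prog :: com where
  "base_prog = Seq (compr ''L'' (NLess (NConst 0) (NConst 0)))
     (ForM ''e'' (Seq (NAssign ''L'' (nv ''e'') (NConst 1)) (Seq (Indep ''t'' (NConst 0) ''L'')
       (Cond (NLess (NConst 0) (nv ''t'')) Skip (NAssign ''L'' (nv ''e'') (NConst 0))))))"

lemma mod_base_prog [simp]: "modN base_prog = {''i'', ''e'', ''L'', ''t''}" "modR base_prog = {}"
  by (auto simp: base_prog_def)

lemma polytime_base_prog: "polytime base_prog"
  unfolding base_prog_def by (intro polytime_intros polytime_subroutines) auto

text \<open>An element rejected once stays rejected, because the set only grows; so the final set is
  maximal independent. All labels are 0 or 1: the whole base forms the first class.\<close>

lemma base_prog_spec: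
  assumes ex: "reaches m f \<I> base_prog \<sigma> \<tau>" and sz: "sizes m n \<sigma>" and M: "matroid {..<m} \<I>" and l: "1 \<le> l"
  shows "basis_labelling m \<I> l (nmem \<tau> ''L'')"
proof -
  let ?c = "Seq (NAssign ''L'' (nv ''e'') (NConst 1)) (Seq (Indep ''t'' (NConst 0) ''L'')
       (Cond (NLess (NConst 0) (nv ''t'')) Skip (NAssign ''L'' (nv ''e'') (NConst 0))))"
  let ?S = "\<lambda>\<rho>. stored_set m ''L'' 0 \<rho>"
  obtain \<sigma>1 where 1: "reaches m f \<I> (compr ''L'' (NLess (NConst 0) (NConst 0))) \<sigma> \<sigma>1" and
    2: "reaches m f \<I> (ForM ''e'' ?c) \<sigma>1 \<tau>"
    using ex by (auto simp: base_prog_def simp del: reaches_Cond)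
  have sz1: "sizes m n \<sigma>1" using reaches_sizes[OF 1 sz] by simp
  have "?S \<sigma>1 = {e. e < m \<and> False}" by (rule compr_spec[OF 1 sz]) auto
  then have S1: "?S \<sigma>1 = {}" by simp
  let ?P = "\<lambda>j \<rho>. ?S \<rho> \<in> \<I> \<and> ?S \<rho> \<subseteq> {..<j} \<and> (\<forall>e<j. nmem \<rho> ''L'' e \<le> 1) \<and>
    (\<forall>e<j. e \<notin> ?S \<rho> \<longrightarrow> insert e (?S \<rho>) \<notin> \<I>)"
  have P: "?P m \<tau>"
  proof (rule ForM_inv[where P = ?P, OF 2 sz1])
    show "?P 0 \<sigma>1" using S1 matroid_empty[OF M] by simp
  next
    fix j \<rho> v assume "?P j \<rho>"
    moreover have "?S (nstore ''e'' 0 v \<rho>) = ?S \<rho>" by (rule stored_set_cong) simp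
    ultimately show "?P j (nstore ''e'' 0 v \<rho>)" by simp
  next
    fix j \<rho> \<rho>'
    assume j: "j < m" "nmem \<rho> ''e'' 0 = j" and P: "?P j \<rho>" and e: "reaches m f \<I> ?c \<rho> \<rho>'"
    let ?\<rho>1 = "nstore ''L'' j 1 \<rho>"
    have S': "?S ?\<rho>1 = insert j (?S \<rho>)" using j by (auto simp: stored_set_0)
    show "?P (Suc j) \<rho>'"
    proof (cases "insert j (?S \<rho>) \<in> \<I>")
      case True
      then have \<rho>': "\<rho>' = nstore ''t'' 0 1 ?\<rho>1" using e j unfolding S'[symmetric] by simp
      have S: "?S \<rho>' = insert j (?S \<rho>)" unfolding S'[symmetric] \<rho>' by (rule stored_set_cong) simp
      have "insert e (insert j (?S \<rho>)) \<notin> \<I>" if "e < j" "e \<notin> ?S \<rho>" for e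
      proof
        assume "insert e (insert j (?S \<rho>)) \<in> \<I>"
        then have "insert e (?S \<rho>) \<in> \<I>" by (rule matroid_down[OF M]) auto
        with P that show False by blast
      qed
      moreover have "\<forall>e<Suc j. nmem \<rho>' ''L'' e \<le> 1" using P by (simp add: \<rho>' less_Suc_eq)
      ultimately show ?thesis using P True unfolding S by (auto simp: less_Suc_eq)
    next
      case False
      then have \<rho>': "\<rho>' = nstore ''L'' j 0 (nstore ''t'' 0 0 ?\<rho>1)" using e j unfolding S'[symmetric] by simp
      have S: "?S \<rho>' = ?S \<rho>" using P by (auto simp: \<rho>' stored_set_0)
      moreover have "\<forall>e<Suc j. nmem \<rho>' ''L'' e \<le> 1" using P by (simp add: \<rho>' less_Suc_eq)
      ultimately show ?thesis using P False unfolding S by (auto simp: less_Suc_eq)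
    qed
  qed auto
  have "basis \<I> (?S \<tau>)"
    using P by (intro maximal_independent_basis[OF M]) auto
  moreover have "\<forall>e<m. nmem \<tau> ''L'' e \<le> l" using P l by force
  ultimately show ?thesis by (simp add: basis_labelling_def stored_set_0)
qed

definition matroid_prog :: "nat \<Rightarrow> nat \<Rightarrow> com" where
  "matroid_prog l K = Seq (compr ''X'' (NLess (NConst 0) (NConst 0))) (Seq (rset ''best'' (RNat (NConst 0)))
     (Seq base_prog (For ''r'' (RLess (RNat (nv ''r'')) (RMul (RNat (NConst K)) (RAdd (RNat (nv ''m'')) (RNat (NConst 1)))))
       (ls_step l))))"

lemma mod_matroid_prog [simp]:
  "modN (matroid_prog l K) = {''i'', ''R'', ''k'', ''Q'', ''t'', ''BL'', ''L'', ''X'', ''u'', ''v'', ''h'', ''e'', ''r''}"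
  "modR (matroid_prog l K) = {''gt'', ''tv'', ''gv'', ''bg'', ''v'', ''best''}"
  by (auto simp: matroid_prog_def)

lemma real_less_bound: "real r < real K * (real m + 1) \<longleftrightarrow> r < K * (m + 1)"
  by (metis of_nat_1 of_nat_add of_nat_less_iff of_nat_mult)

lemma polytime_matroid_prog: "polytime (matroid_prog l K)"
proof -
  have "polytime (For ''r'' (RLess (RNat (nv ''r'')) (RMul (RNat (NConst K)) (RAdd (RNat (nv ''m'')) (RNat (NConst 1)))))
       (ls_step l))"
  proof (rule polytime_For[where L = "\<lambda>m n. K * (m + 1)"])
    show "poly_bounded (\<lambda>m n. K * (m + 1))" by (intro poly_bounded_intros)
  qed (simp_all add: polytime_ls_step sizes_def real_less_bound del: mult_Suc_right)
  then show ?thesis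
    unfolding matroid_prog_def by (intro polytime_intros polytime_subroutines polytime_base_prog) auto
qed

text \<open>As long as the incumbent misses the target, each of the K (m + 1) steps raises the
  potential by \<delta> F(P) / m. Together this exceeds the sum of the coefficients times F(P), the
  most the potential can be, so the target is reached.\<close>

lemma matroid_spec:
  assumes ex: "reaches m f \<I> (matroid_prog l K) \<sigma> \<tau>" and sz: "sizes m n \<sigma>" and F: "objective {..<m} (wobj n f \<sigma>)"
    and M: "matroid {..<m} \<I>" and l: "1 \<le> l" and \<delta>: "0 < \<delta>"
    and K: "(\<Sum>J\<in>Pow {1..l}. ls_coeff l (card J)) < real K * \<delta>" and Q: "Q \<in> \<I>"
  shows "stored_set m ''X'' 0 \<tau> \<in> \<I>"
    and "(1 - (1 + 1 / real l) powi (- int l) - \<delta>) * wobj n f \<sigma> Q \<le> wobj n f \<sigma> (stored_set m ''X'' 0 \<tau>)"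
proof -
  define F where "F = wobj n f \<sigma>"
  define \<rho> where "\<rho> = 1 - (1 + 1 / real l) powi (- int l) - \<delta>"
  have F': "objective {..<m} F" using F by (simp add: F_def)
  let ?pot = "ls_potential l {..<m} F"
  let ?b = "RLess (RNat (nv ''r'')) (RMul (RNat (NConst K)) (RAdd (RNat (nv ''m'')) (RNat (NConst 1))))"
  obtain \<sigma>1 \<sigma>3 where 1: "reaches m f \<I> (compr ''X'' (NLess (NConst 0) (NConst 0))) \<sigma> \<sigma>1" and
    3: "reaches m f \<I> base_prog (rstore ''best'' 0 0 \<sigma>1) \<sigma>3" and 4: "reaches m f \<I> (For ''r'' ?b (ls_step l)) \<sigma>3 \<tau>"
    using ex by (auto simp: matroid_prog_def)
  let ?\<sigma>2 = "rstore ''best'' 0 0 \<sigma>1"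
  have "stored_set m ''X'' 0 \<sigma>1 = {e. e < m \<and> False}" by (rule compr_spec[OF 1 sz]) auto
  then have X2: "stored_set m ''X'' 0 ?\<sigma>2 = {}" by (simp add: stored_set_0)
  have F2: "wobj n f ?\<sigma>2 = F" unfolding F_def by (rule wobj_cong) (simp_all add: reaches_rmem[OF 1])
  have inc2: "incumbent m n f \<I> F ?\<sigma>2"
    using X2 F2 reaches_sizes[OF 1 sz] matroid_empty[OF M] objective_empty[OF F'] by (simp add: incumbent_def)
  then have sz2: "sizes m n ?\<sigma>2" by (simp add: incumbent_def)
  have inc3: "incumbent m n f \<I> F \<sigma>3" by (rule incumbent_frame[OF 3 inc2]) auto
  have sz3: "sizes m n \<sigma>3" using inc3 by (simp add: incumbent_def)
  have L3: "basis_labelling m \<I> l (nmem \<sigma>3 ''L'')" by (rule base_prog_spec[OF 3 sz2 M l])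
  have finI: "finite \<I>" using M by (auto simp: matroid_def intro: finite_subset[of _ "Pow {..<m}"])
  obtain P0 where P0: "P0 \<in> \<I>" "\<And>X. X \<in> \<I> \<Longrightarrow> F X \<le> F P0"
    using finite_has_argmax[OF finI, of F] Q by blast
  \<comment> \<open>By monotonicity an optimal independent set may be enlarged to a base, as
    Brualdi's bijection requires.\<close>
  obtain P where P: "basis \<I> P" "P0 \<subseteq> P" using basis_superset[OF M P0(1)] by blast
  have PI: "P \<in> \<I>" using P by (simp add: basis_def)
  have "F P0 \<le> F P" using P matroid_subset[OF M PI] by (intro objective_mono[OF F']) auto
  then have Pmax: "F X \<le> F P" if "X \<in> \<I>" for X using P0(2)[OF that] by simp
  let ?Inv = "\<lambda>j \<mu>. incumbent m n f \<I> F \<mu> \<and> basis_labelling m \<I> l (nmem \<mu> ''L'') \<and>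
     (0 < F P \<longrightarrow> \<rho> * F P \<le> rmem \<mu> ''best'' 0 \<or> real j * (\<delta> * F P / real m) \<le> ?pot (nmem \<mu> ''L''))"
  have inv: "?Inv (K * (m + 1)) \<tau>"
  proof (rule For_inv(1)[where P = ?Inv, OF 4])
    show "bval ?b \<mu> = (nmem \<mu> ''r'' 0 < K * (m + 1))"
      if "agree (insert ''r'' (modN (ls_step l))) (modR (ls_step l)) \<sigma>3 \<mu>" for \<mu>
      using agree_sizes[OF that sz3] by (simp add: sizes_def real_less_bound del: mult_Suc_right)
    show "?Inv 0 \<sigma>3" using inc3 L3 ls_potential_nonneg[OF F'] by simp
  next
    fix j \<mu> v assume "?Inv j \<mu>"
    then show "?Inv j (nstore ''r'' 0 v \<mu>)" by simp
  next
    fix j \<mu> \<mu>'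
    assume I: "?Inv j \<mu>" and e: "reaches m f \<I> (ls_step l) \<mu> \<mu>'"
    let ?L = "nmem \<mu> ''L''" and ?S = "{e. e < m \<and> nmem \<mu> ''L'' e \<noteq> 0}"
    have inc: "incumbent m n f \<I> F \<mu>" and L: "basis_labelling m \<I> l ?L" using I by auto
    note st = ls_step_spec[OF e inc L M]
    have "\<rho> * F P \<le> rmem \<mu>' ''best'' 0 \<or> real (Suc j) * (\<delta> * F P / real m) \<le> ?pot (nmem \<mu>' ''L'')"
      if FP: "0 < F P"
    proof (cases "\<rho> * F P \<le> rmem \<mu>' ''best'' 0")
      case False
      then have pot: "real j * (\<delta> * F P / real m) \<le> ?pot ?L" using I FP st(3) by auto
      have S: "?S = labelled {..<m} ?L {1..l}" using L by (auto simp: labelled_def basis_labelling_def)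
      have bas: "basis \<I> ?S" using L by (simp add: basis_labelling_def)
      have low: "F ?S \<le> (1 - (1 + 1 / real l) powi (- int l) - \<delta>) * F P"
        using st(4) False by (simp add: \<rho>_def)
      have lab: "?L e \<in> {0..l}" if "e \<in> {..<m}" for e using L that by (auto simp: basis_labelling_def)
      obtain u v k where uvk: "u < m" "v < m" "k \<in> {1..l}" "v \<notin> ?S - {u}" "insert v (?S - {u}) \<in> \<I>"
          "?pot ?L + \<delta> * F P / real (card {..<m}) \<le> ?pot (?L(u := 0, v := k))"
        using ls_improving_swap[OF M F' lab l S bas P(1) \<delta> FP low] by (meson lessThan_iff)
      obtain h where h: "k = Suc h" "h < l" using uvk(3) by (cases k) auto
      have v0: "(?L(u := 0)) v = 0" using uvk by auto
      have "{e. e < m \<and> (?L(u := 0, v := Suc h)) e \<noteq> 0} = insert v (?S - {u})" using uvk(2) by auto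
      then have "?pot (?L(u := 0, v := Suc h)) \<le> ?pot (nmem \<mu>' ''L'')"
        using st(6)[OF uvk(1,2) h(2) v0] uvk(5) by simp
      then have "?pot ?L + \<delta> * F P / real m \<le> ?pot (nmem \<mu>' ''L'')" using uvk(6) h(1) by simp
      moreover have "real (Suc j) * (\<delta> * F P / real m) = real j * (\<delta> * F P / real m) + \<delta> * F P / real m"
        by (simp add: distrib_right add_divide_distrib)
      ultimately show ?thesis using pot by linarith
    qed simp
    then show "?Inv (Suc j) \<mu>'" using st(1,2) by blast
  qed auto
  have X: "stored_set m ''X'' 0 \<tau> \<in> \<I>" and best: "rmem \<tau> ''best'' 0 = F (stored_set m ''X'' 0 \<tau>)"
    using inv by (auto simp: incumbent_def)
  show "stored_set m ''X'' 0 \<tau> \<in> \<I>" by (rule X)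
  have X0: "0 \<le> F (stored_set m ''X'' 0 \<tau>)" using objective_nonneg[OF F' stored_set_subset] .
  have main: "\<rho> * F P \<le> F (stored_set m ''X'' 0 \<tau>)"
  proof (cases "0 < F P")
    case True
    let ?A = "\<Sum>J\<in>Pow {1..l}. ls_coeff l (card J)"
    show ?thesis
    proof (rule ccontr)
      assume "\<not> ?thesis"
      then have "real (K * (m + 1)) * (\<delta> * F P / real m) \<le> ?pot (nmem \<tau> ''L'')" using inv True best by auto
      also have "\<dots> \<le> ?A * F P"
      proof (rule ls_potential_le[OF F' _ Pmax])
        have "labelled {..<m} (nmem \<tau> ''L'') {1..l} = {e. e < m \<and> nmem \<tau> ''L'' e \<noteq> 0}"
          using inv by (auto simp: labelled_def basis_labelling_def)
        then show "labelled {..<m} (nmem \<tau> ''L'') {1..l} \<in> \<I>"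
          using inv by (simp add: basis_labelling_def basis_def)
      qed
      also have "\<dots> < real K * \<delta> * F P" using K True by (rule mult_strict_right_mono)
      finally have lt: "real (K * (m + 1)) * (\<delta> * F P / real m) < real K * \<delta> * F P" .
      have "m \<noteq> 0"
      proof
        assume "m = 0"
        then have "P = {}" using matroid_subset[OF M PI] by auto
        then show False using True objective_empty[OF F'] by simp
      qed
      then have "real K * \<delta> * F P = real (K * m) * (\<delta> * F P / real m)" by simp
      also have "\<dots> \<le> real (K * (m + 1)) * (\<delta> * F P / real m)"
        using \<delta> True by (intro mult_right_mono) auto
      finally show False using lt by simp
    qed
  next
    case False
    then have "F P = 0" using objective_nonneg[OF F' matroid_subset[OF M PI]] by simp
    then show ?thesis using X0 by simp
  qed
  \<comment> \<open>The ratio may be negative; then 0 is enough, and otherwise \<open>Q\<close> is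
    compared with the optimal base \<open>P\<close>.\<close>
  have "\<rho> * F Q \<le> F (stored_set m ''X'' 0 \<tau>)"
  proof (cases "0 \<le> \<rho>")
    case True
    then have "\<rho> * F Q \<le> \<rho> * F P" using Pmax[OF Q] by (intro mult_left_mono)
    then show ?thesis using main by simp
  next
    case False
    then have "\<rho> * F Q \<le> 0"
      using objective_nonneg[OF F' matroid_subset[OF M Q]] by (simp add: mult_nonpos_nonneg)
    then show ?thesis using X0 by simp
  qed
  then show "(1 - (1 + 1 / real l) powi (- int l) - \<delta>) * wobj n f \<sigma> Q \<le> wobj n f \<sigma> (stored_set m ''X'' 0 \<tau>)"
    by (simp add: F_def \<rho>_def)
qed


section \<open>The complete algorithm\<close>

text \<open>The part of the input that all subprograms leave intact, in contrast to
  \<open>input\<close>, which also fixes the scratch memory. Sizes are prescribed on the ground set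
  only.\<close>

fun represents :: "nat \<Rightarrow> nat \<Rightarrow> constraint \<Rightarrow> state \<Rightarrow> bool" where
  "represents m n (Knapsack s C) \<sigma> \<longleftrightarrow> sizes m n \<sigma> \<and> nmem \<sigma> ''matroid'' 0 = 0 \<and>
     (\<forall>e<m. rmem \<sigma> ''s'' e = s e) \<and> rmem \<sigma> ''C'' 0 = C"
| "represents m n (Matroid \<I>) \<sigma> \<longleftrightarrow> sizes m n \<sigma> \<and> nmem \<sigma> ''matroid'' 0 = 1"

lemma represents_sizes: "represents m n c \<sigma> \<Longrightarrow> sizes m n \<sigma>"
  by (cases c) auto

lemma represents_input: "represents m n c (input m n c)"
  by (cases c) (auto simp: sizes_def blank_def nstore_def)

lemma represents_agree:
  assumes "agree VN VR \<sigma> \<tau>" "represents m n c \<sigma>" "''m'' \<notin> VN" "''n'' \<notin> VN" "''matroid'' \<notin> VN" "''s'' \<notin> VR" "''C'' \<notin> VR"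
  shows "represents m n c \<tau>"
  using assms by (cases c) (auto simp: sizes_def agree_def)

lemma represents_store [simp]:
  "x \<notin> {''m'', ''n'', ''matroid''} \<Longrightarrow> represents m n c (nstore x i v \<sigma>) = represents m n c \<sigma>"
  "y \<notin> {''s'', ''C''} \<Longrightarrow> represents m n c (rstore y i r \<sigma>) = represents m n c \<sigma>"
  by (cases c; auto)+

lemma feasible_down: "valid_constraint m c \<Longrightarrow> X \<in> feasible m c \<Longrightarrow> Y \<subseteq> X \<Longrightarrow> Y \<in> feasible m c"
proof (cases c)
  case (Knapsack s C)
  assume a: "valid_constraint m c" "X \<in> feasible m c" "Y \<subseteq> X"
  then have "sum s Y \<le> sum s X"
    using Knapsack by (intro sum_mono2) (auto intro: finite_subset)
  with a Knapsack show ?thesis by auto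
qed (auto simp: matroid_def)

lemma feasible_subset: "valid_constraint m c \<Longrightarrow> feasible m c \<subseteq> Pow {..<m}"
  by (cases c) (auto simp: matroid_def)

section \<open>Computing the scale of the instance\<close>

definition scan_singleton :: com where
  "scan_singleton = Seq (compr ''Q'' (BNot (neq (nv ''i'') (nv ''e''))))
     (Seq (Cond (NLess (NConst 0) (nv ''matroid'')) (Indep ''t'' (NConst 0) ''Q'')
         (Cond (RLess (rv ''C'') (RGet ''s'' (nv ''e''))) (nset ''t'' (NConst 0)) (nset ''t'' (NConst 1))))
       (Cond (NLess (NConst 0) (nv ''t''))
         (Seq (Value ''tv'' (NConst 0) (nv ''kk'') ''Q'') (Cond (RLess (rv ''ak'') (rv ''tv'')) (rset ''ak'' (rv ''tv'')) Skip))
         Skip))"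

text \<open>The test on \<open>kk\<close> makes the first objective set \<open>a\<close> whatever
  the cell contained; later objectives can only lower it.\<close>

definition scale_prog :: com where
  "scale_prog = ForN ''kk'' (Seq (rset ''ak'' (RNat (NConst 0))) (Seq (ForM ''e'' scan_singleton)
     (Cond (BAnd (NLess (NConst 0) (nv ''kk'')) (BNot (RLess (rv ''ak'') (rv ''a'')))) Skip (rset ''a'' (rv ''ak'')))))"

lemma mod_scan_singleton [simp]: "modN scan_singleton = {''i'', ''Q'', ''t''}" "modR scan_singleton = {''tv'', ''ak''}"
  by (auto simp: scan_singleton_def)

lemma mod_scale_prog [simp]:
  "modN scale_prog = {''i'', ''Q'', ''t'', ''e'', ''kk''}" "modR scale_prog = {''tv'', ''ak'', ''a''}"
  by (auto simp: scale_prog_def)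

lemma polytime_scale_prog: "polytime scale_prog"
  unfolding scale_prog_def scan_singleton_def by (intro polytime_intros polytime_subroutines) auto

lemma scan_singleton_spec:
  assumes ex: "reaches m f (independence_oracle c) scan_singleton \<sigma> \<tau>" and rep: "represents m n c \<sigma>"
    and e: "nmem \<sigma> ''e'' 0 = e" "e < m" and k: "nmem \<sigma> ''kk'' 0 = k"
  shows "rmem \<tau> ''ak'' 0 = (if {e} \<in> feasible m c then max (rmem \<sigma> ''ak'' 0) (f k {e}) else rmem \<sigma> ''ak'' 0)"
proof -
  let ?J = "independence_oracle c"
  let ?test = "Cond (NLess (NConst 0) (nv ''matroid'')) (Indep ''t'' (NConst 0) ''Q'')
         (Cond (RLess (rv ''C'') (RGet ''s'' (nv ''e''))) (nset ''t'' (NConst 0)) (nset ''t'' (NConst 1)))"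
  let ?upd = "Cond (NLess (NConst 0) (nv ''t''))
         (Seq (Value ''tv'' (NConst 0) (nv ''kk'') ''Q'') (Cond (RLess (rv ''ak'') (rv ''tv'')) (rset ''ak'' (rv ''tv'')) Skip))
         Skip"
  obtain \<sigma>1 \<sigma>2 where
    1: "reaches m f ?J (compr ''Q'' (BNot (neq (nv ''i'') (nv ''e'')))) \<sigma> \<sigma>1" and
    2: "reaches m f ?J ?test \<sigma>1 \<sigma>2" and 3: "reaches m f ?J ?upd \<sigma>2 \<tau>"
    using ex by (auto simp: scan_singleton_def simp del: reaches_Cond)
  have sz: "sizes m n \<sigma>" using rep by (rule represents_sizes)
  have "stored_set m ''Q'' 0 \<sigma>1 = {i. i < m \<and> i = e}"
  proof (rule compr_spec[OF 1 sz])
    fix \<rho> assume a: "agree {''i'', ''Q''} {} \<sigma> \<rho>"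
    show "bval (BNot (neq (nv ''i'') (nv ''e''))) \<rho> \<longleftrightarrow> nmem \<rho> ''i'' 0 = e"
      using e by (simp add: agree_nmem[OF a])
  qed auto
  then have Q1: "stored_set m ''Q'' 0 \<sigma>1 = {e}" using e by auto
  have rep1: "represents m n c \<sigma>1" by (rule represents_agree[OF reaches_agree[OF 1] rep]) auto
  have e1: "nmem \<sigma>1 ''e'' 0 = e" using e by (simp add: reaches_nmem[OF 1])
  have t: "0 < nmem \<sigma>2 ''t'' 0 \<longleftrightarrow> {e} \<in> feasible m c"
  proof (cases c)
    case (Knapsack s C)
    then show ?thesis using 2 rep1 e1 e(2) by (auto split: if_splits)
  next
    case (Matroid \<I>)
    then show ?thesis using 2 rep1 Q1 by auto
  qed
  have ak2: "rmem \<sigma>2 ''ak'' 0 = rmem \<sigma> ''ak'' 0" by (simp add: reaches_rmem[OF 1] reaches_rmem[OF 2])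
  have k2: "nmem \<sigma>2 ''kk'' 0 = k" using k by (simp add: reaches_nmem[OF 1] reaches_nmem[OF 2])
  have Q2: "stored_set m ''Q'' 0 \<sigma>2 = {e}"
    unfolding Q1[symmetric] by (rule stored_set_cong) (simp add: reaches_nmem[OF 2])
  show ?thesis
  proof (cases "{e} \<in> feasible m c")
    case False
    then show ?thesis using 3 t ak2 by simp
  next
    case True
    then show ?thesis using 3 t ak2 k2 Q2 by (cases "rmem \<sigma> ''ak'' 0 < f k {e}") auto
  qed
qed

text \<open>These are the facts that \<open>nu_star_ge_individual\<close> and
  \<open>nu_star_le_singletons\<close> ask of \<open>a\<close>. The maximum over singletons starts
  at 0, so the empty set is the witness when no feasible singleton has positive value.\<close>

lemma scale_spec:
  assumes ex: "reaches m f (independence_oracle c) scale_prog \<sigma> \<tau>" and rep: "represents m n c \<sigma>" and n: "1 \<le> n"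
    and f: "\<And>k. k < n \<Longrightarrow> objective {..<m} (f k)" and c: "valid_constraint m c"
  shows "0 \<le> rmem \<tau> ''a'' 0" and "k < n \<Longrightarrow> \<exists>X\<in>feasible m c. rmem \<tau> ''a'' 0 \<le> f k X"
    and "\<exists>k<n. \<forall>e. {e} \<in> feasible m c \<longrightarrow> f k {e} \<le> rmem \<tau> ''a'' 0"
proof -
  let ?I = "feasible m c" and ?J = "independence_oracle c"
  let ?upd = "Cond (BAnd (NLess (NConst 0) (nv ''kk'')) (BNot (RLess (rv ''ak'') (rv ''a'')))) Skip (rset ''a'' (rv ''ak''))"
  let ?c = "Seq (rset ''ak'' (RNat (NConst 0))) (Seq (ForM ''e'' scan_singleton) ?upd)"
  have sz: "sizes m n \<sigma>" using rep by (rule represents_sizes)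
  \<comment> \<open>Before the first objective has been processed \<open>a\<close> has no meaning,
    hence the escape \<open>j = 0\<close>.\<close>
  let ?P = "\<lambda>j \<rho>. j = 0 \<or> (0 \<le> rmem \<rho> ''a'' 0 \<and> (\<forall>k<j. \<exists>X\<in>?I. rmem \<rho> ''a'' 0 \<le> f k X) \<and>
     (\<exists>k<j. \<forall>e. {e} \<in> ?I \<longrightarrow> f k {e} \<le> rmem \<rho> ''a'' 0))"
  have "?P n \<tau>"
  proof (rule ForN_inv[where P = ?P, OF ex[unfolded scale_prog_def] sz])
    fix k \<rho> \<rho>'
    assume k: "k < n" "nmem \<rho> ''kk'' 0 = k" and P: "?P k \<rho>"
      and a: "agree (insert ''kk'' (modN ?c)) (modR ?c) \<sigma> \<rho>" and e: "reaches m f ?J ?c \<rho> \<rho>'"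
    obtain \<rho>2 where 2: "reaches m f ?J (ForM ''e'' scan_singleton) (rstore ''ak'' 0 0 \<rho>) \<rho>2" and 3: "reaches m f ?J ?upd \<rho>2 \<rho>'"
      using e by (auto simp del: reaches_Cond)
    have rep1: "represents m n c (rstore ''ak'' 0 0 \<rho>)" using represents_agree[OF a rep] by simp
    let ?R = "\<lambda>j \<mu>. 0 \<le> rmem \<mu> ''ak'' 0 \<and> (\<exists>X\<in>?I. rmem \<mu> ''ak'' 0 \<le> f k X) \<and>
       (\<forall>e<j. {e} \<in> ?I \<longrightarrow> f k {e} \<le> rmem \<mu> ''ak'' 0)"
    have R: "?R m \<rho>2"
    proof (rule ForM_inv[where P = ?R, OF 2])
      show "?R 0 (rstore ''ak'' 0 0 \<rho>)"
        using empty_feasible[OF c] objective_empty[OF f[OF k(1)]] by (auto intro!: bexI[of _ "{}"])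
    next
      fix j \<mu> \<mu>'
      assume j: "j < m" "nmem \<mu> ''e'' 0 = j" and R: "?R j \<mu>"
        and a: "agree (insert ''e'' (modN scan_singleton)) (modR scan_singleton) (rstore ''ak'' 0 0 \<rho>) \<mu>"
        and e: "reaches m f ?J scan_singleton \<mu> \<mu>'"
      have rep': "represents m n c \<mu>" by (rule represents_agree[OF a rep1]) auto
      have k': "nmem \<mu> ''kk'' 0 = k" using k by (simp add: agree_nmem[OF a])
      from scan_singleton_spec[OF e rep' j(2,1) k'] R
      show "?R (Suc j) \<mu>'" by (auto simp: less_Suc_eq max_def intro: order_trans)
    qed (use represents_sizes[OF rep1] in auto)
    have all: "\<forall>e. {e} \<in> ?I \<longrightarrow> f k {e} \<le> rmem \<rho>2 ''ak'' 0"
      using R feasible_subset[OF c] by blast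
    have a2: "rmem \<rho>2 ''a'' 0 = rmem \<rho> ''a'' 0" and k2: "nmem \<rho>2 ''kk'' 0 = k"
      using k by (simp_all add: reaches_rmem[OF 2] reaches_nmem[OF 2])
    show "?P (Suc k) \<rho>'"
    proof (cases "0 < k \<and> rmem \<rho> ''a'' 0 \<le> rmem \<rho>2 ''ak'' 0")
      case True
      then have "\<rho>' = \<rho>2" using 3 a2 k2 by auto
      moreover have "\<exists>X\<in>?I. rmem \<rho> ''a'' 0 \<le> f k X" using R True by (meson order_trans)
      ultimately show ?thesis using P True a2 by (auto simp: less_Suc_eq)
    next
      case False
      then have \<rho>': "rmem \<rho>' ''a'' 0 = rmem \<rho>2 ''ak'' 0" using 3 a2 k2 by (auto split: if_splits)
      have "\<exists>X\<in>?I. rmem \<rho>2 ''ak'' 0 \<le> f k' X" if "k' < Suc k" for k'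
      proof (cases "k' = k")
        case k'ne: False
        then have "rmem \<rho>2 ''ak'' 0 \<le> rmem \<rho> ''a'' 0" "k' < k" using False that by auto
        then show ?thesis using P by (metis order_trans not_less_zero)
      qed (use R in auto)
      then show ?thesis unfolding \<rho>' using R all by auto
    qed
  qed (use sz in auto)
  with n show "0 \<le> rmem \<tau> ''a'' 0" "k < n \<Longrightarrow> \<exists>X\<in>?I. rmem \<tau> ''a'' 0 \<le> f k X"
    "\<exists>k<n. \<forall>e. {e} \<in> ?I \<longrightarrow> f k {e} \<le> rmem \<tau> ''a'' 0" by auto
qed

section \<open>Weights, stored sets and the number of rounds\<close>

definition init_weights :: com where
  "init_weights = ForN ''k'' (RAssign ''w'' (nv ''k'') (RNat (NConst 1)))"

lemma mod_init_weights [simp]: "modN init_weights = {''k''}" "modR init_weights = {''w''}"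
  by (auto simp: init_weights_def)

lemma init_weights_spec:
  assumes ex: "reaches m f J init_weights \<sigma> \<tau>" and sz: "sizes m n \<sigma>"
  shows "\<forall>k<n. rmem \<tau> ''w'' k = 1"
  by (rule ForN_inv[where P = "\<lambda>j \<rho>. \<forall>k<j. rmem \<rho> ''w'' k = 1", OF ex[unfolded init_weights_def] sz])
    (auto simp: less_Suc_eq)

text \<open>The weight is multiplied by 1 - x / \<kappa>, where x is the truncated value in units of
  \<open>B\<close>, so the learning rate is \<eta> = 1 / \<kappa>. For \<open>B = 0\<close> the
  quotient is 0 and the weights stay as they are.\<close>

definition update_weights :: "nat \<Rightarrow> com" where
  "update_weights \<kappa> = ForN ''k'' (Seq (Value ''tv'' (NConst 0) (nv ''k'') ''X'')
     (Seq (Cond (RLess (rv ''B'') (rv ''tv'')) (rset ''tv'' (rv ''B'')) Skip)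
       (RAssign ''w'' (nv ''k'') (RSub (RGet ''w'' (nv ''k''))
         (RDiv (RMul (RGet ''w'' (nv ''k'')) (rv ''tv'')) (RMul (RNat (NConst \<kappa>)) (rv ''B'')))))))"

lemma mod_update_weights [simp]: "modN (update_weights \<kappa>) = {''k''}" "modR (update_weights \<kappa>) = {''w'', ''tv''}"
  by (auto simp: update_weights_def)

lemma update_weights_spec:
  assumes ex: "reaches m f J (update_weights \<kappa>) \<sigma> \<tau>" and sz: "sizes m n \<sigma>" and k: "k < n"
  shows "rmem \<tau> ''w'' k = rmem \<sigma> ''w'' k -
    rmem \<sigma> ''w'' k * min (f k (stored_set m ''X'' 0 \<sigma>)) (rmem \<sigma> ''B'' 0) / (real \<kappa> * rmem \<sigma> ''B'' 0)"
proof -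
  let ?cap = "Cond (RLess (rv ''B'') (rv ''tv'')) (rset ''tv'' (rv ''B'')) Skip"
  let ?c = "Seq (Value ''tv'' (NConst 0) (nv ''k'') ''X'') (Seq ?cap
       (RAssign ''w'' (nv ''k'') (RSub (RGet ''w'' (nv ''k''))
         (RDiv (RMul (RGet ''w'' (nv ''k'')) (rv ''tv'')) (RMul (RNat (NConst \<kappa>)) (rv ''B''))))))"
  let ?w = "\<lambda>k. rmem \<sigma> ''w'' k -
    rmem \<sigma> ''w'' k * min (f k (stored_set m ''X'' 0 \<sigma>)) (rmem \<sigma> ''B'' 0) / (real \<kappa> * rmem \<sigma> ''B'' 0)"
  let ?P = "\<lambda>j \<rho>. \<forall>k. rmem \<rho> ''w'' k = (if k < j then ?w k else rmem \<sigma> ''w'' k)"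
  have "?P n \<tau>"
  proof (rule ForN_inv[where P = ?P, OF ex[unfolded update_weights_def] sz])
    fix j \<rho> \<rho>'
    assume j: "nmem \<rho> ''k'' 0 = j" and P: "?P j \<rho>"
      and a: "agree (insert ''k'' (modN ?c)) (modR ?c) \<sigma> \<rho>" and e: "reaches m f J ?c \<rho> \<rho>'"
    have X: "stored_set m ''X'' 0 \<rho> = stored_set m ''X'' 0 \<sigma>"
      by (rule stored_set_cong) (simp add: agree_nmem[OF a])
    have B: "rmem \<rho> ''B'' = rmem \<sigma> ''B''" by (simp add: agree_rmem[OF a])
    obtain \<rho>2 where 2: "reaches m f J ?cap (rstore ''tv'' 0 (f j (stored_set m ''X'' 0 \<sigma>)) \<rho>) \<rho>2" and
      \<rho>': "\<rho>' = rstore ''w'' (nmem \<rho>2 ''k'' 0) (rmem \<rho>2 ''w'' (nmem \<rho>2 ''k'' 0) -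
         rmem \<rho>2 ''w'' (nmem \<rho>2 ''k'' 0) * rmem \<rho>2 ''tv'' 0 / (real \<kappa> * rmem \<rho>2 ''B'' 0)) \<rho>2"
      using e j X by (auto simp del: reaches_Cond)
    have "rmem \<rho>2 ''tv'' 0 = min (f j (stored_set m ''X'' 0 \<sigma>)) (rmem \<sigma> ''B'' 0)"
      using 2 B by (auto split: if_splits)
    moreover have "nmem \<rho>2 ''k'' 0 = j" "rmem \<rho>2 ''w'' = rmem \<rho> ''w''" "rmem \<rho>2 ''B'' = rmem \<sigma> ''B''"
      using j B by (simp_all add: reaches_nmem[OF 2] reaches_rmem[OF 2])
    ultimately show "?P (Suc j) \<rho>'" using P unfolding \<rho>' by (auto simp: less_Suc_eq)
  qed auto
  with k show ?thesis by simp
qed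

definition store_result :: com where
  "store_result = ForM ''i'' (NAssign ''S'' (NAdd (nv ''off'') (nv ''i'')) (NGet ''X'' (nv ''i'')))"

lemma mod_store_result [simp]: "modN store_result = {''i'', ''S''}" "modR store_result = {}"
  by (auto simp: store_result_def)

text \<open>Only cells from j * m on are written, and the block of an earlier round t ends at (t +
  1) * m \<le> j * m.\<close>

lemma store_result_spec:
  assumes ex: "reaches m f J store_result \<sigma> \<tau>" and sz: "sizes m n \<sigma>" and off: "nmem \<sigma> ''off'' 0 = j * m"
  shows "stored_set m ''S'' (j * m) \<tau> = stored_set m ''X'' 0 \<sigma>"
    and "t < j \<Longrightarrow> stored_set m ''S'' (t * m) \<tau> = stored_set m ''S'' (t * m) \<sigma>"
proof -
  let ?c = "NAssign ''S'' (NAdd (nv ''off'') (nv ''i'')) (NGet ''X'' (nv ''i''))"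
  let ?P = "\<lambda>i \<rho>. (\<forall>e<i. nmem \<rho> ''S'' (j * m + e) = nmem \<sigma> ''X'' e) \<and> (\<forall>y<j * m. nmem \<rho> ''S'' y = nmem \<sigma> ''S'' y)"
  have P: "?P m \<tau>"
  proof (rule ForM_inv[where P = ?P, OF ex[unfolded store_result_def] sz])
    fix i \<rho> \<rho>'
    assume i: "nmem \<rho> ''i'' 0 = i" and P: "?P i \<rho>"
      and a: "agree (insert ''i'' (modN ?c)) (modR ?c) \<sigma> \<rho>" and e: "reaches m f J ?c \<rho> \<rho>'"
    have "\<rho>' = nstore ''S'' (j * m + i) (nmem \<sigma> ''X'' i) \<rho>"
      using e i off by (simp add: agree_nmem[OF a])
    then show "?P (Suc i) \<rho>'" using P by (simp add: less_Suc_eq)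
  qed auto
  then show "stored_set m ''S'' (j * m) \<tau> = stored_set m ''X'' 0 \<sigma>" by (intro stored_set_cong) simp
  show "stored_set m ''S'' (t * m) \<tau> = stored_set m ''S'' (t * m) \<sigma>" if "t < j"
  proof (rule stored_set_cong)
    fix e assume "e < m"
    then have "t * m + e < Suc t * m" by simp
    also have "\<dots> \<le> j * m" using that by (intro mult_right_mono) auto
    finally show "nmem \<tau> ''S'' (t * m + e) = nmem \<sigma> ''S'' (t * m + e)" using P by simp
  qed
qed

text \<open>The regret n \<kappa> B must be at most a 1/\<kappa> fraction of T \<nu>. As B =
  \<kappa> (m + 1) n a and a \<le> n \<nu>, the choice T = \<kappa>^3 (m + 1) n^3 achieves
  this.\<close>

definition rounds :: "nat \<Rightarrow> nat \<Rightarrow> nat \<Rightarrow> nat" where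
  "rounds \<kappa> m n = \<kappa> ^ 3 * (m + 1) * n * (n * n)"

definition rounds_exp :: "nat \<Rightarrow> rexp" where
  "rounds_exp \<kappa> = RMul (RMul (RMul (RNat (NConst (\<kappa> ^ 3))) (RAdd (RNat (nv ''m'')) (RNat (NConst 1)))) (RNat (nv ''n'')))
     (RMul (RNat (nv ''n'')) (RNat (nv ''n'')))"

lemma rval_rounds_exp: "sizes m n \<sigma> \<Longrightarrow> rval (rounds_exp \<kappa>) \<sigma> = real (rounds \<kappa> m n)"
  by (simp add: rounds_exp_def rounds_def sizes_def algebra_simps)

definition oracle_prog :: "nat \<Rightarrow> nat \<Rightarrow> com" where
  "oracle_prog l K = Cond (NLess (NConst 0) (nv ''matroid'')) (matroid_prog l K) knap_prog"

lemma mod_oracle_prog [simp]: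
  "modN (oracle_prog l K) = {''i'', ''R'', ''k'', ''Q'', ''t'', ''BL'', ''L'', ''X'', ''u'', ''v'', ''h'', ''e'', ''r'',
     ''BQ'', ''Y'', ''g'', ''a'', ''b'', ''c''}"
  "modR (oracle_prog l K) = {''gt'', ''tv'', ''gv'', ''bg'', ''v'', ''best'', ''z'', ''v0'', ''d'', ''bd''}"
  by (auto simp: oracle_prog_def)

definition round_prog :: "nat \<Rightarrow> nat \<Rightarrow> nat \<Rightarrow> com" where
  "round_prog l K \<kappa> = Seq (oracle_prog l K) (Seq store_result (Seq (nset ''off'' (NAdd (nv ''off'') (nv ''m'')))
     (Seq (update_weights \<kappa>) (RAssign ''p'' (nv ''j'') (RDiv (RNat (NConst 1)) (rounds_exp \<kappa>))))))"

text \<open>With \<delta> = 1 / \<kappa> this value of B gives \<delta> B = n (m + 1) a \<ge> n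
  \<nu>, the requirement of \<open>truncated_weighted_max_ge\<close>.\<close>

definition scale_exp :: "nat \<Rightarrow> rexp" where
  "scale_exp \<kappa> = RMul (RMul (RMul (RNat (NConst \<kappa>)) (RAdd (RNat (nv ''m'')) (RNat (NConst 1)))) (RNat (nv ''n''))) (rv ''a'')"

text \<open>\<open>len\<close> is read off the loop counter: the number of rounds is computed as a
  real and cannot be converted back.\<close>

definition main_prog :: "nat \<Rightarrow> nat \<Rightarrow> nat \<Rightarrow> com" where
  "main_prog l K \<kappa> = Seq scale_prog (Seq (rset ''B'' (scale_exp \<kappa>)) (Seq init_weights (Seq (nset ''off'' (NConst 0))
     (Seq (For ''j'' (RLess (RNat (nv ''j'')) (rounds_exp \<kappa>)) (round_prog l K \<kappa>)) (nset ''len'' (nv ''j''))))))"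

lemma mod_round_prog [simp]:
  "modN (round_prog l K \<kappa>) = {''i'', ''R'', ''k'', ''Q'', ''t'', ''BL'', ''L'', ''X'', ''u'', ''v'', ''h'', ''e'', ''r'',
     ''BQ'', ''Y'', ''g'', ''a'', ''b'', ''c'', ''S'', ''off''}"
  "modR (round_prog l K \<kappa>) = {''gt'', ''tv'', ''gv'', ''bg'', ''v'', ''best'', ''z'', ''v0'', ''d'', ''bd'', ''w'', ''p''}"
  by (auto simp: round_prog_def)

lemma polytime_main_prog: "polytime (main_prog l K \<kappa>)"
proof -
  have "polytime (round_prog l K \<kappa>)"
    unfolding round_prog_def oracle_prog_def store_result_def update_weights_def
    by (intro polytime_intros polytime_matroid_prog polytime_knap_prog) auto
  then have "polytime (For ''j'' (RLess (RNat (nv ''j'')) (rounds_exp \<kappa>)) (round_prog l K \<kappa>))"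
  proof (rule polytime_For[where L = "rounds \<kappa>"])
    show "poly_bounded (rounds \<kappa>)" unfolding rounds_def[abs_def] by (intro poly_bounded_intros)
  qed (simp_all add: rval_rounds_exp)
  then show ?thesis unfolding main_prog_def init_weights_def
    by (intro polytime_intros polytime_scale_prog) auto
qed

text \<open>\<open>\<rho>\<close> is a ratio that both subroutines guarantee: the first conjunct
  serves the knapsack, the others provide enough classes \<open>l\<close> and enough steps
  \<open>K\<close> for the matroid.\<close>

definition suitable :: "nat \<Rightarrow> nat \<Rightarrow> real \<Rightarrow> bool" where
  "suitable l K \<rho> \<longleftrightarrow> \<rho> \<le> 1 - 1 / exp 1 \<and> 1 \<le> l \<and> (\<exists>\<delta>>0. \<rho> \<le> 1 - (1 + 1 / real l) powi (- int l) - \<delta> \<and>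
     (\<Sum>J\<in>Pow {1..l}. ls_coeff l (card J)) < real K * \<delta>)"

text \<open>(1 + 1/l)^l tends to e. Half of the slack below 1 - 1/e pays for a finite number of
  classes, the other half for stopping the local search after finitely many steps.\<close>

lemma suitable_exists:
  assumes "\<rho> < 1 - 1 / exp 1"
  shows "\<exists>l K. suitable l K \<rho>"
proof -
  define \<delta> where "\<delta> = (1 - 1 / exp 1 - \<rho>) / 2"
  have \<delta>: "0 < \<delta>" using assms by (simp add: \<delta>_def)
  have "(\<lambda>l. (1 + 1 / real l) ^ l) \<longlonglongrightarrow> exp 1" using tendsto_exp_limit_sequentially[of 1] by simp
  then have "(\<lambda>l. 1 - inverse ((1 + 1 / real l) ^ l)) \<longlonglongrightarrow> 1 - inverse (exp 1)"
    by (intro tendsto_diff tendsto_const tendsto_inverse) auto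
  then have "eventually (\<lambda>l. 1 - inverse (exp 1) - \<delta> < 1 - inverse ((1 + 1 / real l) ^ l)) sequentially"
    using \<delta> by (intro order_tendstoD(1)[of _ "1 - inverse (exp 1)"]) auto
  then obtain l where l: "1 \<le> l" "1 - inverse (exp 1) - \<delta> < 1 - inverse ((1 + 1 / real l) ^ l)"
    by (metis (mono_tags, lifting) eventually_sequentially le_add1 le_add2)
  obtain K :: nat where "(\<Sum>J\<in>Pow {1..l}. ls_coeff l (card J)) / \<delta> < real K" using reals_Archimedean2 by blast
  then have K: "(\<Sum>J\<in>Pow {1..l}. ls_coeff l (card J)) < real K * \<delta>" using \<delta> by (simp add: field_simps)
  have "\<rho> \<le> 1 - (1 + 1 / real l) powi (- int l) - \<delta>"
  proof -
    have "(1 + 1 / real l) powi (- int l) = inverse ((1 + 1 / real l) ^ l)" by (simp add: power_int_minus)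
    moreover have "1 / exp 1 = inverse (exp (1::real))" by (simp add: inverse_eq_divide)
    moreover have "2 * \<delta> = 1 - 1 / exp 1 - \<rho>" by (simp add: \<delta>_def)
    ultimately show ?thesis using l(2) by linarith
  qed
  with l K \<delta> assms show ?thesis unfolding suitable_def by (intro exI[of _ l] exI[of _ K] conjI) auto
qed

lemma oracle_spec:
  assumes ex: "reaches m f (independence_oracle c) (oracle_prog l K) \<sigma> \<tau>" and rep: "represents m n c \<sigma>"
    and F: "objective {..<m} (wobj n f \<sigma>)" and c: "valid_constraint m c" and lK: "suitable l K \<rho>"
  shows "stored_set m ''X'' 0 \<tau> \<in> feasible m c"
    and "Q \<in> feasible m c \<Longrightarrow> \<rho> * wobj n f \<sigma> Q \<le> wobj n f \<sigma> (stored_set m ''X'' 0 \<tau>)"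
proof -
  let ?F = "wobj n f \<sigma>" and ?X = "stored_set m ''X'' 0 \<tau>"
  have sz: "sizes m n \<sigma>" using rep by (rule represents_sizes)
  have *: "?X \<in> feasible m c \<and> \<rho> * ?F Q \<le> ?F ?X" if Q: "Q \<in> feasible m c" for Q
  proof -
    have nonneg: "0 \<le> ?F Q" using Q feasible_subset[OF c] by (intro objective_nonneg[OF F]) auto
    show ?thesis
    proof (cases c)
      case (Knapsack s C)
      have e: "reaches m f (independence_oracle c) knap_prog \<sigma> \<tau>" using ex rep Knapsack by (simp add: oracle_prog_def)
      have s: "\<And>e. e < m \<Longrightarrow> rmem \<sigma> ''s'' e = s e" "rmem \<sigma> ''C'' 0 = C" using rep Knapsack by auto
      have "sum (rmem \<sigma> ''s'') Y = sum s Y" if "Y \<subseteq> {..<m}" for Y using that s by (intro sum.cong) auto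
      then have I: "feasible m c = feasible m (Knapsack (rmem \<sigma> ''s'') (rmem \<sigma> ''C'' 0))"
        using Knapsack s by auto
      have s0: "0 \<le> rmem \<sigma> ''s'' e" if "e < m" for e using c Knapsack s that by simp
      have C0: "0 \<le> rmem \<sigma> ''C'' 0" using c Knapsack s by simp
      note k = knap_spec[OF e sz F s0 C0 Q[unfolded I]]
      have "\<rho> * ?F Q \<le> (1 - 1 / exp 1) * ?F Q" using lK nonneg by (intro mult_right_mono) (auto simp: suitable_def)
      then show ?thesis using k I by simp
    next
      case (Matroid \<I>)
      have e: "reaches m f \<I> (matroid_prog l K) \<sigma> \<tau>" using ex rep Matroid by (simp add: oracle_prog_def)
      have M: "matroid {..<m} \<I>" "Q \<in> \<I>" using c Matroid Q by auto
      obtain \<delta> where \<delta>: "0 < \<delta>" "\<rho> \<le> 1 - (1 + 1 / real l) powi (- int l) - \<delta>"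
        "(\<Sum>J\<in>Pow {1..l}. ls_coeff l (card J)) < real K * \<delta>" and l: "1 \<le> l" using lK by (auto simp: suitable_def)
      note k = matroid_spec[OF e sz F M(1) l \<delta>(1,3) M(2)]
      have "\<rho> * ?F Q \<le> (1 - (1 + 1 / real l) powi (- int l) - \<delta>) * ?F Q" using \<delta> nonneg by (intro mult_right_mono)
      then show ?thesis using k Matroid by simp
    qed
  qed
  from *[OF empty_feasible[OF c]] show "?X \<in> feasible m c" by blast
  from * show "Q \<in> feasible m c \<Longrightarrow> \<rho> * ?F Q \<le> ?F ?X" by blast
qed

lemma round_spec:
  assumes ex: "reaches m f (independence_oracle c) (round_prog l K \<kappa>) \<sigma> \<tau>" and rep: "represents m n c \<sigma>"
    and f: "\<forall>k<n. objective {..<m} (f k)" and w: "\<forall>k<n. 0 \<le> rmem \<sigma> ''w'' k"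
    and B: "0 \<le> rmem \<sigma> ''B'' 0" and c: "valid_constraint m c" and lK: "suitable l K \<rho>"
    and j: "nmem \<sigma> ''j'' 0 = j" and off: "nmem \<sigma> ''off'' 0 = j * m"
  shows "represents m n c \<tau>" and "nmem \<tau> ''off'' 0 = Suc j * m" and "rmem \<tau> ''B'' 0 = rmem \<sigma> ''B'' 0"
    and "rmem \<tau> ''p'' t = (if t = j then 1 / real (rounds \<kappa> m n) else rmem \<sigma> ''p'' t)"
    and "t < j \<Longrightarrow> stored_set m ''S'' (t * m) \<tau> = stored_set m ''S'' (t * m) \<sigma>"
    and "stored_set m ''S'' (j * m) \<tau> \<in> feasible m c"
    and "Q \<in> feasible m c \<Longrightarrow> \<rho> * wobj n f \<sigma> Q \<le> wobj n f \<sigma> (stored_set m ''S'' (j * m) \<tau>)"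
    and "k < n \<Longrightarrow> rmem \<tau> ''w'' k = rmem \<sigma> ''w'' k -
      rmem \<sigma> ''w'' k * min (f k (stored_set m ''S'' (j * m) \<tau>)) (rmem \<sigma> ''B'' 0) / (real \<kappa> * rmem \<sigma> ''B'' 0)"
proof -
  let ?J = "independence_oracle c"
  obtain \<sigma>1 \<sigma>2 \<sigma>4 where
    1: "reaches m f ?J (oracle_prog l K) \<sigma> \<sigma>1" and 2: "reaches m f ?J store_result \<sigma>1 \<sigma>2" and
    4: "reaches m f ?J (update_weights \<kappa>) (nstore ''off'' 0 (nmem \<sigma>2 ''off'' 0 + nmem \<sigma>2 ''m'' 0) \<sigma>2) \<sigma>4" and
    \<tau>: "\<tau> = rstore ''p'' (nmem \<sigma>4 ''j'' 0) (1 / rval (rounds_exp \<kappa>) \<sigma>4) \<sigma>4"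
    using ex by (auto simp: round_prog_def)
  note fr = reaches_nmem[OF 1] reaches_rmem[OF 1] reaches_nmem[OF 2] reaches_rmem[OF 2] reaches_nmem[OF 4] reaches_rmem[OF 4]
  let ?\<sigma>3 = "nstore ''off'' 0 (nmem \<sigma>2 ''off'' 0 + nmem \<sigma>2 ''m'' 0) \<sigma>2"
  have rep1: "represents m n c \<sigma>1" by (rule represents_agree[OF reaches_agree[OF 1] rep]) auto
  have rep2: "represents m n c \<sigma>2" by (rule represents_agree[OF reaches_agree[OF 2] rep1]) auto
  have rep3: "represents m n c ?\<sigma>3" using rep2 by simp
  have rep4: "represents m n c \<sigma>4" by (rule represents_agree[OF reaches_agree[OF 4] rep3]) auto
  show "represents m n c \<tau>" using rep4 by (simp add: \<tau>)
  have sz: "sizes m n \<sigma>1" "sizes m n \<sigma>2" "sizes m n ?\<sigma>3" "sizes m n \<sigma>4"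
    using rep1 rep2 rep3 rep4 by (simp_all only: represents_sizes)
  have off1: "nmem \<sigma>1 ''off'' 0 = j * m" using off by (simp add: fr)
  show "nmem \<tau> ''off'' 0 = Suc j * m" using off1 sz(2) by (simp add: \<tau> fr sizes_def)
  show "rmem \<tau> ''B'' 0 = rmem \<sigma> ''B'' 0" by (simp add: \<tau> fr)
  have "nmem \<sigma>4 ''j'' 0 = j" using j by (simp add: fr)
  then show "rmem \<tau> ''p'' t = (if t = j then 1 / real (rounds \<kappa> m n) else rmem \<sigma> ''p'' t)"
    using rval_rounds_exp[OF sz(4)] by (simp add: \<tau> fr)
  note st = store_result_spec[OF 2 sz(1) off1]
  have S\<tau>: "stored_set m ''S'' i \<tau> = stored_set m ''S'' i \<sigma>2" for i
    by (rule stored_set_cong) (simp add: \<tau> reaches_nmem[OF 4])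
  show "stored_set m ''S'' (t * m) \<tau> = stored_set m ''S'' (t * m) \<sigma>" if "t < j"
  proof -
    have "stored_set m ''S'' (t * m) \<sigma>1 = stored_set m ''S'' (t * m) \<sigma>" by (rule stored_set_cong) (simp add: reaches_nmem[OF 1])
    then show ?thesis using S\<tau> st(2)[OF that] by simp
  qed
  have X: "stored_set m ''S'' (j * m) \<tau> = stored_set m ''X'' 0 \<sigma>1" using S\<tau> st(1) by simp
  have F: "objective {..<m} (wobj n f \<sigma>)" using f w B by (intro wobj_objective) auto
  note o = oracle_spec[OF 1 rep F c lK]
  show "stored_set m ''S'' (j * m) \<tau> \<in> feasible m c" unfolding X by (rule o(1))
  show "\<rho> * wobj n f \<sigma> Q \<le> wobj n f \<sigma> (stored_set m ''S'' (j * m) \<tau>)" if "Q \<in> feasible m c"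
    unfolding X by (rule o(2)[OF that])
  have X3: "stored_set m ''X'' 0 ?\<sigma>3 = stored_set m ''X'' 0 \<sigma>1" by (rule stored_set_cong) (simp add: reaches_nmem[OF 2])
  show "rmem \<tau> ''w'' k = rmem \<sigma> ''w'' k -
      rmem \<sigma> ''w'' k * min (f k (stored_set m ''S'' (j * m) \<tau>)) (rmem \<sigma> ''B'' 0) / (real \<kappa> * rmem \<sigma> ''B'' 0)"
    if "k < n"
    using update_weights_spec[OF 4 sz(3) that] unfolding X X3 by (simp add: \<tau> reaches_rmem[OF 1] reaches_rmem[OF 2])
qed

text \<open>In units of \<open>B\<close> every answer has weighted mean at least \<open>v\<close>,
  so the total weight decays like exp (- \<eta> v j), while each weight records the gains of its own
  objective. The exponential bounds assume \<open>0 < B\<close>; the facts on the stored sets and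
  probabilities do not, so the output is well formed for \<open>B = 0\<close> too.\<close>

lemma loop_spec:
  fixes c :: constraint and m n \<kappa> :: nat and f :: "nat \<Rightarrow> nat set \<Rightarrow> real"
  defines "\<nu> \<equiv> nu_star n f (feasible m c)" and "\<eta> \<equiv> 1 / real \<kappa>"
  assumes ex: "reaches m f (independence_oracle c) (For ''j'' (RLess (RNat (nv ''j'')) (rounds_exp \<kappa>)) (round_prog l K \<kappa>)) \<sigma> \<tau>"
    and rep: "represents m n c \<sigma>" and n: "1 \<le> n"
    and f: "\<forall>k<n. objective {..<m} (f k)" and w: "\<forall>k<n. rmem \<sigma> ''w'' k = 1"
    and c: "valid_constraint m c" and lK: "suitable l K \<rho>" and \<rho>: "0 < \<rho>" and off: "nmem \<sigma> ''off'' 0 = 0"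
    and \<kappa>: "2 \<le> \<kappa>" and B: "rmem \<sigma> ''B'' 0 = B" "0 \<le> B" "real n * \<nu> \<le> \<eta> * B"
  defines "T \<equiv> rounds \<kappa> m n"
  shows "nmem \<tau> ''j'' 0 = T" and "t < T \<Longrightarrow> stored_set m ''S'' (t * m) \<tau> \<in> feasible m c"
    and "t < T \<Longrightarrow> rmem \<tau> ''p'' t = 1 / real T"
    and "0 < B \<Longrightarrow> k < n \<Longrightarrow> \<rho> * ((1 - \<eta>) * \<nu>) * real T - real n * real \<kappa> * B
      \<le> (1 + 2 * \<eta>) * (\<Sum>t<T. min (f k (stored_set m ''S'' (t * m) \<tau>)) B)"
proof -
  let ?I = "feasible m c" and ?St = "\<lambda>t \<rho>. stored_set m ''S'' (t * m) \<rho>"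
  let ?J = "independence_oracle c"
  let ?x = "\<lambda>t k \<rho>. min (f k (?St t \<rho>)) B / B"
  define v where "v = \<rho> * ((1 - \<eta>) * \<nu>) / B"
  let ?Inv = "\<lambda>j \<mu>. represents m n c \<mu> \<and> rmem \<mu> ''B'' 0 = B \<and> nmem \<mu> ''off'' 0 = j * m \<and>
    (\<forall>t<j. ?St t \<mu> \<in> ?I \<and> rmem \<mu> ''p'' t = 1 / real T) \<and>
    (\<forall>k<n. 0 \<le> rmem \<mu> ''w'' k \<and> (0 < B \<longrightarrow> exp (- (\<eta> * (1 + 2 * \<eta>) * (\<Sum>t<j. ?x t k \<mu>))) \<le> rmem \<mu> ''w'' k)) \<and>
    (0 < B \<longrightarrow> sum (rmem \<mu> ''w'') {..<n} \<le> real n * exp (- (\<eta> * v * real j)))"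
  have sz: "sizes m n \<sigma>" using rep by (rule represents_sizes)
  have \<eta>: "0 < \<eta>" "\<eta> \<le> 1 / 2" using \<kappa> by (auto simp: \<eta>_def field_simps)
  have fin: "finite ?I" and empty: "{} \<in> ?I" using c by (auto intro: finite_feasible empty_feasible)
  have f0: "0 \<le> f k X" if "k < n" "X \<in> ?I" for k X
    using objective_nonneg[of "{..<m}" "f k"] f that feasible_subset[OF c] by blast
  have guard: "bval (RLess (RNat (nv ''j'')) (rounds_exp \<kappa>)) \<mu> = (nmem \<mu> ''j'' 0 < T)"
    if "agree (insert ''j'' (modN (round_prog l K \<kappa>))) (modR (round_prog l K \<kappa>)) \<sigma> \<mu>" for \<mu>
    using rval_rounds_exp[OF agree_sizes[OF that sz]] by (simp add: T_def)
  have step: "?Inv (Suc j) \<mu>'"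
    if j: "nmem \<mu> ''j'' 0 = j" and I: "?Inv j \<mu>" and e: "reaches m f ?J (round_prog l K \<kappa>) \<mu> \<mu>'" for j \<mu> \<mu>'
  proof -
    have rep': "represents m n c \<mu>" and w0: "\<forall>k<n. 0 \<le> rmem \<mu> ''w'' k" and off': "nmem \<mu> ''off'' 0 = j * m"
      and B': "rmem \<mu> ''B'' 0 = B" "0 \<le> rmem \<mu> ''B'' 0" using I B by auto
    note r = round_spec[OF e rep' f w0 B'(2) c lK j off']
    let ?X = "?St j \<mu>'"
    have X: "?X \<in> ?I" by (rule r(6))
    have St: "?St t \<mu>' = ?St t \<mu>" if "t < j" for t by (rule r(5)[OF that])
    have x01: "0 \<le> min (f k ?X) B / B" "min (f k ?X) B / B \<le> 1" if "k < n" for k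
      using f0[OF that X] B(2) by (auto simp: divide_simps)
    have wk: "rmem \<mu>' ''w'' k = rmem \<mu> ''w'' k * (1 - \<eta> * (min (f k ?X) B / B))" if "k < n" for k
      using r(8)[OF that] B' by (simp add: \<eta>_def algebra_simps)
    have St_sum: "(\<Sum>t<Suc j. ?x t k \<mu>') = (\<Sum>t<j. ?x t k \<mu>) + min (f k ?X) B / B" for k
      using St by simp
    have low: "exp (- (\<eta> * (1 + 2 * \<eta>) * (\<Sum>t<Suc j. ?x t k \<mu>'))) \<le> rmem \<mu>' ''w'' k" if "k < n" "0 < B" for k
      unfolding St_sum wk[OF that(1)] using I that by (intro mw_step_lower x01 \<eta>) auto
    have w0': "0 \<le> rmem \<mu>' ''w'' k" if "k < n" for k
    proof -
      have "\<eta> * (min (f k ?X) B / B) \<le> 1 * 1" using x01[OF that] \<eta> by (intro mult_mono) auto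
      then show ?thesis unfolding wk[OF that] using w0 that by (intro mult_nonneg_nonneg) auto
    qed
    have up: "sum (rmem \<mu>' ''w'') {..<n} \<le> real n * exp (- (\<eta> * v * real (Suc j)))" if B0: "0 < B"
    proof -
      let ?w = "rmem \<mu> ''w''"
      have FX: "wobj n f \<mu> ?X = (\<Sum>k<n. ?w k * min (f k ?X) B)" using B' by (simp add: wobj_def)
      \<comment> \<open>The answer is within the ratio \<rho> of the truncated weighted maximum, so
        the answer divided by \<rho> is a valid \<open>V\<close> in
        \<open>truncated_weighted_max_ge\<close>.\<close>
      have "sum ?w {..<n} * ((1 - \<eta>) * \<nu>) \<le> wobj n f \<mu> ?X / \<rho>"
        unfolding \<nu>_def
      proof (rule truncated_weighted_max_ge[OF fin empty n f0 \<eta>(1) _ B(2)])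
        show "real n * nu_star n f ?I \<le> \<eta> * B" using B(3) by (simp add: \<nu>_def)
        fix X assume "X \<in> ?I"
        from r(7)[OF this] have "\<rho> * (\<Sum>k<n. ?w k * min (f k X) B) \<le> wobj n f \<mu> ?X" using B' by (simp add: wobj_def)
        then show "(\<Sum>k<n. ?w k * min (f k X) B) \<le> wobj n f \<mu> ?X / \<rho>" using \<rho> by (simp add: field_simps)
      qed (use \<eta> w0 in auto)
      then have "sum ?w {..<n} * ((1 - \<eta>) * \<nu>) * \<rho> \<le> wobj n f \<mu> ?X" using \<rho> by (simp add: pos_le_divide_eq)
      then have "sum ?w {..<n} * ((1 - \<eta>) * \<nu>) * \<rho> / B \<le> wobj n f \<mu> ?X / B" using B0 by (intro divide_right_mono) auto
      then have "sum ?w {..<n} * v \<le> wobj n f \<mu> ?X / B" by (simp add: v_def mult_ac)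
      also have "\<dots> = (\<Sum>k<n. ?w k * (min (f k ?X) B / B))" unfolding FX by (simp add: sum_divide_distrib)
      finally have "(\<Sum>k<n. ?w k * (1 - \<eta> * (min (f k ?X) B / B))) \<le> real n * exp (- (\<eta> * v * (real j + 1)))"
        using I B0 w0 \<eta> by (intro mw_step_upper) (auto intro: sum_nonneg)
      moreover have "sum (rmem \<mu>' ''w'') {..<n} = (\<Sum>k<n. ?w k * (1 - \<eta> * (min (f k ?X) B / B)))"
        using wk by (intro sum.cong) auto
      ultimately show ?thesis by (simp add: add.commute)
    qed
    have "\<forall>t<Suc j. ?St t \<mu>' \<in> ?I \<and> rmem \<mu>' ''p'' t = 1 / real T"
      using I X St r(4) by (auto simp: less_Suc_eq T_def)
    then show "?Inv (Suc j) \<mu>'" using r(1,2,3) B' low w0' up by auto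
  qed
  have indep: "?Inv j (nstore ''j'' 0 u \<mu>)" if "?Inv j \<mu>" for j u \<mu>
  proof -
    have "?St t (nstore ''j'' 0 u \<mu>) = ?St t \<mu>" for t by (rule stored_set_cong) simp
    with that show ?thesis by simp
  qed
  have start: "?Inv 0 \<sigma>" using rep off B w by simp
  have j_notin: "''j'' \<notin> modN (round_prog l K \<kappa>)" by simp
  show "nmem \<tau> ''j'' 0 = T"
    by (rule For_inv(2)[where P = ?Inv, OF ex j_notin guard start indep step])
  have Inv: "?Inv T \<tau>"
    by (rule For_inv(1)[where P = ?Inv, OF ex j_notin guard start indep step])
  then show "t < T \<Longrightarrow> ?St t \<tau> \<in> ?I" "t < T \<Longrightarrow> rmem \<tau> ''p'' t = 1 / real T" by auto
  show "\<rho> * ((1 - \<eta>) * \<nu>) * real T - real n * real \<kappa> * B \<le> (1 + 2 * \<eta>) * (\<Sum>t<T. min (f k (?St t \<tau>)) B)"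
    if B0: "0 < B" and k: "k < n"
  proof -
    \<comment> \<open>The weight of objective \<open>k\<close> is compared with the total;
      multiplication by \<open>B\<close> then undoes the normalization.\<close>
    have "v * real T - real n / \<eta> \<le> (1 + 2 * \<eta>) * (\<Sum>t<T. ?x t k \<tau>)"
      using Inv B0 k \<eta> by (intro mw_end[of \<eta> _ "rmem \<tau> ''w''" k n]) auto
    then have "B * (v * real T - real n / \<eta>) \<le> B * ((1 + 2 * \<eta>) * (\<Sum>t<T. ?x t k \<tau>))"
      using B0 by (intro mult_left_mono) auto
    moreover have "B * (v * real T - real n / \<eta>) = \<rho> * ((1 - \<eta>) * \<nu>) * real T - real n * real \<kappa> * B"
      using B0 by (simp add: v_def \<eta>_def right_diff_distrib)
    moreover have "B * ((1 + 2 * \<eta>) * (\<Sum>t<T. ?x t k \<tau>)) = (1 + 2 * \<eta>) * (\<Sum>t<T. min (f k (?St t \<tau>)) B)"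
      using B0 by (simp add: sum_divide_distrib[symmetric])
    ultimately show ?thesis by simp
  qed
qed

text \<open>The losses add up to 5 \<delta>: one \<delta> each from approximate maximization,
  truncation and regret, and 2 \<delta> from the factor 1 + 2 \<delta>. As r \<le> 1 this covers the
  first order, and the second-order terms have the right sign.\<close>

lemma final_ratio:
  assumes \<delta>: "0 < \<delta>" "5 * \<delta> \<le> \<epsilon>" and r: "r \<le> (1::real)" and \<nu>: "0 \<le> \<nu>"
    and le: "((r - \<delta>) * (1 - \<delta>) - \<delta>) * \<nu> \<le> (1 + 2 * \<delta>) * y"
  shows "(r - \<epsilon>) * \<nu> \<le> y"
proof -
  have "(1 + 2 * \<delta>) * (r - \<epsilon>) \<le> (1 + 2 * \<delta>) * (r - 5 * \<delta>)" using \<delta> by (intro mult_left_mono) auto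
  also have "\<dots> = r + 2 * (\<delta> * r) - 5 * \<delta> - 10 * (\<delta> * \<delta>)" by (simp add: algebra_simps)
  also have "\<dots> \<le> r - 3 * \<delta> + \<delta> * \<delta>" using mult_left_le[of r \<delta>] mult_nonneg_nonneg[of \<delta> \<delta>] r \<delta> by linarith
  also have "\<dots> \<le> r - r * \<delta> - 2 * \<delta> + \<delta> * \<delta>" using mult_left_le[of r \<delta>] r \<delta> by (simp add: mult.commute)
  also have "\<dots> = (r - \<delta>) * (1 - \<delta>) - \<delta>" by (simp add: algebra_simps)
  finally have "(1 + 2 * \<delta>) * (r - \<epsilon>) * \<nu> \<le> ((r - \<delta>) * (1 - \<delta>) - \<delta>) * \<nu>" using \<nu> by (rule mult_right_mono)
  also note le
  finally have "(1 + 2 * \<delta>) * ((r - \<epsilon>) * \<nu>) \<le> (1 + 2 * \<delta>) * y" by (simp add: mult.assoc)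
  then show ?thesis using \<delta> by simp
qed

lemma main_prog_spec:
  assumes ex: "reaches m f (independence_oracle c) (main_prog l K \<kappa>) (input m n c) \<tau>" and n: "1 \<le> n"
    and f: "\<And>k. k < n \<Longrightarrow> objective {..<m} (f k)" and c: "valid_constraint m c"
    and lK: "suitable l K (1 - 1 / exp 1 - 1 / real \<kappa>)" and \<kappa>: "10 \<le> \<kappa>" "5 / real \<kappa> \<le> \<epsilon>"
  shows "\<exists>p\<in>distributions (feasible m c). outputs m \<tau> p \<and>
    (1 - 1 / exp 1 - \<epsilon>) * nu_star n f (feasible m c) \<le> (MIN k\<in>{..<n}. \<Sum>X\<in>feasible m c. pmf p X * f k X)"
proof -
  let ?I = "feasible m c" and ?J = "independence_oracle c"
  let ?\<sigma> = "input m n c"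
  define \<nu> where "\<nu> = nu_star n f ?I"
  define \<delta> where "\<delta> = 1 / real \<kappa>"
  define T where "T = rounds \<kappa> m n"
  define \<rho> where "\<rho> = 1 - 1 / exp 1 - \<delta>"
  have \<delta>: "0 < \<delta>" "\<delta> \<le> 1 / 10" "5 * \<delta> \<le> \<epsilon>" using \<kappa> by (auto simp: \<delta>_def divide_simps)
  have e2: "1 / exp 1 \<le> 1 / (2::real)" using exp_ge_add_one_self[of 1] by (intro divide_left_mono) auto
  have \<rho>: "0 < \<rho>" using \<delta> e2 unfolding \<rho>_def by linarith
  have fin: "finite ?I" and empty: "{} \<in> ?I" using c by (auto intro: finite_feasible empty_feasible)
  have f0: "0 \<le> f k X" if "k < n" "X \<in> ?I" for k X
    using objective_nonneg[OF f[OF that(1)]] that(2) feasible_subset[OF c] by blast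
  have \<nu>0: "0 \<le> \<nu>" unfolding \<nu>_def using fin empty n f0 by (intro nu_star_nonneg) auto
  obtain \<sigma>1 \<sigma>3 \<sigma>5 where
    1: "reaches m f ?J scale_prog ?\<sigma> \<sigma>1" and 3: "reaches m f ?J init_weights (rstore ''B'' 0 (rval (scale_exp \<kappa>) \<sigma>1) \<sigma>1) \<sigma>3" and
    5: "reaches m f ?J (For ''j'' (RLess (RNat (nv ''j'')) (rounds_exp \<kappa>)) (round_prog l K \<kappa>)) (nstore ''off'' 0 0 \<sigma>3) \<sigma>5" and
    \<tau>: "\<tau> = nstore ''len'' 0 (nmem \<sigma>5 ''j'' 0) \<sigma>5"
    using ex by (auto simp: main_prog_def)
  let ?\<sigma>2 = "rstore ''B'' 0 (rval (scale_exp \<kappa>) \<sigma>1) \<sigma>1"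
  let ?\<sigma>4 = "nstore ''off'' 0 0 \<sigma>3"
  have rep1: "represents m n c \<sigma>1" by (rule represents_agree[OF reaches_agree[OF 1] represents_input]) auto
  have rep2: "represents m n c ?\<sigma>2" using rep1 by simp
  have rep3: "represents m n c \<sigma>3" by (rule represents_agree[OF reaches_agree[OF 3] rep2]) auto
  have rep4: "represents m n c ?\<sigma>4" using rep3 by simp
  define a where "a = rmem \<sigma>1 ''a'' 0"
  define B where "B = real \<kappa> * (real m + 1) * real n * a"
  have sc: "0 \<le> a" "\<And>k. k < n \<Longrightarrow> \<exists>X\<in>?I. a \<le> f k X" "\<exists>k<n. \<forall>e. {e} \<in> ?I \<longrightarrow> f k {e} \<le> a"
    using scale_spec[OF 1 represents_input n f c] by (auto simp: a_def)
  have B4: "rmem ?\<sigma>4 ''B'' 0 = B"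
    using represents_sizes[OF rep1] by (simp add: reaches_rmem[OF 3] scale_exp_def sizes_def B_def a_def add.commute)
  have w4: "\<forall>k<n. rmem ?\<sigma>4 ''w'' k = 1"
    using init_weights_spec[OF 3 represents_sizes[OF rep2]] by simp
  have f': "\<forall>k<n. objective {..<m} (f k)" using f by blast
  have \<nu>a: "\<nu> \<le> real m * a"
  proof -
    obtain k where k: "k < n" "\<And>e. {e} \<in> ?I \<Longrightarrow> f k {e} \<le> a" using sc(3) by blast
    have "\<nu> \<le> real (card {..<m}) * a" unfolding \<nu>_def
    proof (rule nu_star_le_singletons[where f = f and k = k, OF _ feasible_subset[OF c] _ _ n k(1) f[OF k(1)] sc(1)])
      show "?I \<noteq> {}" using empty by blast
      show "Y \<in> ?I" if "X \<in> ?I" "Y \<subseteq> X" for X Y using feasible_down[OF c that] .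
    qed (use k(2) in auto)
    then show ?thesis by simp
  qed
  have a\<nu>: "a \<le> real n * \<nu>"
    using nu_star_ge_individual[OF fin n f0 sc(2)] n by (simp add: \<nu>_def field_simps)
  have B0: "0 \<le> B" using sc(1) by (simp add: B_def)
  have \<delta>B: "\<delta> * B = real n * ((real m + 1) * a)" using \<kappa> by (simp add: \<delta>_def B_def)
  have n\<nu>: "real n * \<nu> \<le> \<delta> * B"
    unfolding \<delta>B using \<nu>a sc(1) by (intro mult_left_mono) (auto simp: algebra_simps)
  have \<rho>': "0 < 1 - 1 / exp 1 - 1 / real \<kappa>" using \<rho> by (simp add: \<rho>_def \<delta>_def)
  have \<kappa>2: "2 \<le> \<kappa>" using \<kappa> by simp
  note loop = loop_spec[OF 5 rep4 n f' w4 c lK \<rho>' _ \<kappa>2 B4 B0,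
      folded \<delta>_def \<nu>_def T_def, folded \<rho>_def]
  have T: "0 < T" using \<kappa> n by (simp add: T_def rounds_def)
  have len: "nmem \<tau> ''len'' 0 = T" and S\<tau>: "stored_set m ''S'' i \<tau> = stored_set m ''S'' i \<sigma>5"
    and p\<tau>: "rmem \<tau> = rmem \<sigma>5" for i
    using loop(1) n\<nu> by (auto simp: \<tau> stored_set_def)
  let ?St = "\<lambda>t. stored_set m ''S'' (t * m) \<tau>"
  have St: "?St t \<in> ?I" if "t < T" for t using loop(2) n\<nu> that S\<tau> by simp
  have "\<exists>p\<in>distributions ?I. (\<forall>X. pmf p X = (\<Sum>t<T. if ?St t = X then 1 / real T else 0)) \<and>
    (\<forall>h. (\<Sum>X\<in>?I. pmf p X * h X) = (\<Sum>t<T. h (?St t)) / real T)"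
    by (rule uniform_distribution[OF T _ fin]) (rule St)
  then obtain p where p: "p \<in> distributions ?I" "\<And>X. pmf p X = (\<Sum>t<T. if ?St t = X then 1 / real T else 0)"
    "\<And>h. (\<Sum>X\<in>?I. pmf p X * h X) = (\<Sum>t<T. h (?St t)) / real T"
    by blast
  have pT: "rmem \<tau> ''p'' t = 1 / real T" if "t < T" for t using loop(3) n\<nu> that p\<tau> by simp
  have out: "outputs m \<tau> p"
    unfolding outputs_def len p(2) using T pT by (auto intro!: sum.cong)
  have val: "(1 - 1 / exp 1 - \<epsilon>) * \<nu> \<le> (\<Sum>X\<in>?I. pmf p X * f k X)" if k: "k < n" for k
  proof (cases "a = 0")
    \<comment> \<open>The scale 0 forces the optimum to be 0, so nonnegativity suffices; the bound
      from the weights is only available for positive \<open>B\<close>.\<close>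
    case True
    then have "\<nu> = 0" using \<nu>a \<nu>0 by simp
    moreover have "0 \<le> (\<Sum>X\<in>?I. pmf p X * f k X)" using f0[OF k] by (intro sum_nonneg) auto
    ultimately show ?thesis by simp
  next
    case False
    then have Bpos: "0 < B" using sc(1) \<kappa> n by (auto simp: B_def intro!: mult_pos_pos add_nonneg_pos)
    let ?y = "(\<Sum>t<T. f k (?St t)) / real T"
    have "\<rho> * ((1 - \<delta>) * \<nu>) * real T - real n * real \<kappa> * B \<le> (1 + 2 * \<delta>) * (\<Sum>t<T. min (f k (?St t)) B)"
      using loop(4) n\<nu> Bpos k S\<tau> by simp
    also have "\<dots> \<le> (1 + 2 * \<delta>) * (\<Sum>t<T. f k (?St t))" using \<delta> by (intro mult_left_mono sum_mono) auto
    also have "\<dots> = (1 + 2 * \<delta>) * ?y * real T" using T by simp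
    finally have 1: "\<rho> * ((1 - \<delta>) * \<nu>) * real T - real n * real \<kappa> * B \<le> (1 + 2 * \<delta>) * ?y * real T" .
    \<comment> \<open>The lower bound a \<le> n \<nu> makes the additive regret proportional to the
      optimum, and \<open>rounds\<close> makes its share at most \<delta>.\<close>
    have "real n * real \<kappa> * B = (real \<kappa> * real \<kappa> * (real m + 1) * real n * real n) * a" by (simp add: B_def)
    also have "\<dots> \<le> (real \<kappa> * real \<kappa> * (real m + 1) * real n * real n) * (real n * \<nu>)"
      using a\<nu> by (intro mult_left_mono) auto
    also have "\<dots> = \<delta> * \<nu> * real T"
      using \<kappa> by (simp add: \<delta>_def T_def rounds_def power3_eq_cube algebra_simps)
    finally have "\<rho> * ((1 - \<delta>) * \<nu>) * real T - \<delta> * \<nu> * real T \<le> (1 + 2 * \<delta>) * ?y * real T" using 1 by linarith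
    then have "((\<rho> * (1 - \<delta>) - \<delta>) * \<nu>) * real T \<le> ((1 + 2 * \<delta>) * ?y) * real T"
      by (simp only: left_diff_distrib mult.assoc)
    then have "(\<rho> * (1 - \<delta>) - \<delta>) * \<nu> \<le> (1 + 2 * \<delta>) * ?y"
      by (rule mult_right_le_imp_le) (use T in simp)
    then have "(1 - 1 / exp 1 - \<epsilon>) * \<nu> \<le> ?y"
      unfolding \<rho>_def by (rule final_ratio[OF \<delta>(1,3) _ \<nu>0, rotated]) simp
    then show ?thesis unfolding p(3) .
  qed
  have "(1 - 1 / exp 1 - \<epsilon>) * \<nu> \<le> (MIN k\<in>{..<n}. \<Sum>X\<in>?I. pmf p X * f k X)"
    using n val by (subst Min_ge_iff) (auto simp: lessThan_empty_iff)
  with p(1) out show ?thesis unfolding \<nu>_def by blast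
qed

theorem mainTheorem6:
  fixes \<epsilon> :: real
  assumes "\<epsilon> > 0"
  shows "\<exists>(A :: com) (q :: nat poly).
    \<forall>(m :: nat) (n :: nat) (f :: nat \<Rightarrow> nat set \<Rightarrow> real) (c :: constraint).
      n \<ge> 1 \<and> (\<forall>k<n. objective {..<m} (f k)) \<and> valid_constraint m c \<longrightarrow>
      (\<exists>t \<tau> p. runs_to A m n f c t \<tau> \<and> t \<le> poly q (m + n) \<and> outputs m \<tau> p \<and>
         p \<in> distributions (feasible m c) \<and>
         (MIN k\<in>{..<n}. \<Sum>X\<in>feasible m c. pmf p X * f k X)
           \<ge> (1 - 1 / exp 1 - \<epsilon>) * nu_star n f (feasible m c))"
proof -
  \<comment> \<open>\<kappa> \<ge> 10 keeps the ratio 1 - 1/e - 1/\<kappa> positive, so that answers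
    can be divided by it; \<kappa> \<ge> 5 / \<epsilon> leaves room for the five losses of size
    1/\<kappa>. \<open>\<kappa>\<close>, \<open>l\<close> and \<open>K\<close> are chosen before the
    instance.\<close>
  define \<kappa> where "\<kappa> = max 10 (nat \<lceil>5 / \<epsilon>\<rceil>)"
  have \<kappa>: "10 \<le> \<kappa>" by (simp add: \<kappa>_def)
  have "5 / \<epsilon> \<le> real \<kappa>" unfolding \<kappa>_def by linarith
  then have \<kappa>\<epsilon>: "5 / real \<kappa> \<le> \<epsilon>" using assms \<kappa> by (simp add: field_simps)
  obtain l K where lK: "suitable l K (1 - 1 / exp 1 - 1 / real \<kappa>)"
    using suitable_exists[of "1 - 1 / exp 1 - 1 / real \<kappa>"] \<kappa> by auto
  obtain h q where h: "\<And>m n f J \<sigma>. sizes m n \<sigma> \<Longrightarrow> \<exists>t \<tau>. exec m f J (main_prog l K \<kappa>) \<sigma> t \<tau> \<and> t \<le> h m n"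
    and q: "\<And>m n. h m n \<le> poly q (m + n)"
    using polytime_main_prog[of l K \<kappa>] unfolding polytime_def poly_bounded_def by blast
  show ?thesis
  proof (rule exI[of _ "main_prog l K \<kappa>"], rule exI[of _ q], intro allI impI)
    fix m n :: nat and f :: "nat \<Rightarrow> nat set \<Rightarrow> real" and c :: constraint
    assume a: "n \<ge> 1 \<and> (\<forall>k<n. objective {..<m} (f k)) \<and> valid_constraint m c"
    obtain t \<tau> where t: "exec m f (independence_oracle c) (main_prog l K \<kappa>) (input m n c) t \<tau>" "t \<le> h m n"
      using h[OF represents_sizes[OF represents_input]] by blast
    then have "reaches m f (independence_oracle c) (main_prog l K \<kappa>) (input m n c) \<tau>" by (auto simp: reaches_def)
    from main_prog_spec[OF this _ _ _ lK \<kappa> \<kappa>\<epsilon>] a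
    obtain p where p: "p \<in> distributions (feasible m c)" "outputs m \<tau> p"
      "(1 - 1 / exp 1 - \<epsilon>) * nu_star n f (feasible m c) \<le> (MIN k\<in>{..<n}. \<Sum>X\<in>feasible m c. pmf p X * f k X)"
      by blast
    have "t \<le> poly q (m + n)" using t(2) q[of m n] by linarith
    then show "\<exists>t \<tau> p. runs_to (main_prog l K \<kappa>) m n f c t \<tau> \<and> t \<le> poly q (m + n) \<and> outputs m \<tau> p \<and>
         p \<in> distributions (feasible m c) \<and>
         (MIN k\<in>{..<n}. \<Sum>X\<in>feasible m c. pmf p X * f k X)
           \<ge> (1 - 1 / exp 1 - \<epsilon>) * nu_star n f (feasible m c)"
      using t(1) p unfolding runs_to_def by blast
  qed
qed

end
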